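(* Let $M=\{u_1,\ldots,u_N\}\subset\mathbb{S}^{n-1}$ be a finite set of $N$ points, let $\xi$ be a spherically contoured random vector in $\mathbb{R}^n$, $T_i=\langle u_i,\xi\rangle$, and $$\Delta(c)=\frac{\sum_{i=1}^N\mathbb{P}(T_i\ge c)-\mathbb{P}\bigl(\max_{1\le i\le N}T_i\ge c\bigr)}{\sum_{i=1}^N\mathbb{P}(T_i\ge c)}.$$ Suppose that the distribution function $F_{R_n}$ of $R_n=\|\xi\|^2$ belongs to $\mathcal{L}_{\beta,\gamma}$ with $\beta<1$ or $(\beta,\gamma)=(1,+\infty)$, with slowly varying function $\ell$, and let $\ell_0$ be any function with $\ell_0(h)\sim\ell(h)$ as $h\to+\infty$. Then, as $c\to+\infty$, $$ \Delta(c) \sim \frac{D}{N}\,\frac{\cos^{n(1-\beta)}\theta_*}{2\sqrt{\pi}\tan\theta_*} \Bigl\{c^{2(1-\beta)}\ell_0(c^2)\Bigr\}^{-\frac{1}{2}} \exp\Bigl\{ -c^{2(1-\beta)} \ell_0(c^2)\, g_\beta(\cos^2\theta_* ) -r_\beta(c^2,\cos^2\theta_* )\Bigr\}, $$ where $D=\sharp\{(i,j)\mid \rho_{ij}=\rho_*\}$. Equivalently, $$ \begin{aligned} \log\Delta(c) ={}& -c^{2(1-\beta)} \ell_0(c^2)\, g_\beta(\cos^2\theta_* ) - \tfrac{1}{2} \log\bigl\{ c^{2(1-\beta)}\ell_0(c^2) \bigr\} - r_\beta(c^2,\cos^2\theta_* ) \\ & +\log\frac{\cos^{n(1-\beta)}\theta_*}{2\sqrt{\pi}\tan\theta_*}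 +\log\frac{D}{N} +o(1),\qquad c\to+\infty. \end{aligned} $$ Moreover, $r_\beta(c^2,\cos^2\theta_* )=o\bigl(c^{2(1-\beta)}\ell_0(c^2)\bigr)$, and the Bonferroni approximation is tail-valid, i.e. $\Delta(c)\to0$ as $c\to+\infty$.
   Context: $n\ge2$. A spherically contoured random vector is $\xi=r\eta$, where $\eta$ is uniformly distributed on the unit sphere $\mathbb{S}^{n-1}$ and $r>0$ is a random variable independent of $\eta$; $R_n=r^2=\|\xi\|^2$. Put $\rho_{ij}=\langle u_i,u_j\rangle$, $\rho_*=\max_{i\ne j}\rho_{ij}$ (so $D$ counts ordered pairs), and let $\theta_*\in[0,\pi/2]$ be the critical radius of $M$, given by $\cos\theta_*=\sqrt{(1+\rho_* )/2}$, $\tan\theta_*=\sqrt{(1-\rho_* )/(1+\rho_* )}$. A distribution function $F$ on $\mathbb{R}_+$ with tail $\bar F=1-F$, $F(x)<1$ for all $x>0$, is in $\mathcal{L}_{\beta,\gamma}$, $\beta\le1$, $\gamma\in(0,+\infty]$, if $\bar F(x)\sim C(x)\exp\{-\int_{x_0}^x\ell(t)t^{-\beta}\,\mathrm{d}t\}$ as $x\to+\infty$ for some $x_0\ge0$, where $C(x)\to C\in(0,+\infty)$ and $\ell$ is slowly varying with $\lim_{t\to+\infty}\ell(t)=\gamma$. Here $f\sim g$ means $f/g\to1$. For $y\in[0,1]$, $$g_\beta(y)=\frac{y^{\beta-1}-1}{1-\beta}\ \text{ if }\beta<1,\qquad g_\beta(y)=-\log y\ \text{ if }\beta=1,$$ and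 $$r_\beta(h,y)=h^{1-\beta}\int_1^{y^{-1}}\{\ell(hv)-\ell_0(h)\}v^{-\beta}\,\mathrm{d}v.$$ The Bonferroni approximation of $\mathbb{P}(\max_iT_i\ge c)$ is $\sum_i\mathbb{P}(T_i\ge c)$. *)

theory Defs
  imports "HOL-Probability.Probability" "HOL-Library.Landau_Symbols"
begin

unbundle asymp_equiv_syntax

section \<open>Spherically contoured random vectors\<close>

text \<open>The uniform distribution on the unit sphere is the normalised cone measure: a Borel set
  \<open>A\<close> of the sphere has mass vol \<open>{t a | 0 < t < 1, a \<in> A}\<close> / vol(ball), which is the normalised
  surface measure.  It is realised as the image of the uniform distribution on the unit ball under
  \<open>x \<mapsto> x / \<parallel>x\<parallel>\<close>; the value of this map at the null set \<open>{0}\<close> is irrelevant.\<close>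

definition sphere_uniform :: "'a::euclidean_space measure" where
  "sphere_uniform = distr (uniform_measure lborel (ball 0 1)) borel (\<lambda>x. x /\<^sub>R norm x)"

lemma sets_sphere_uniform [simp]: "sets sphere_uniform = sets borel"
  and space_sphere_uniform [simp]: "space sphere_uniform = UNIV"
  by (simp_all add: sphere_uniform_def)

lemma emeasure_unit_ball_lborel:
  "emeasure lborel (ball (0::'a::euclidean_space) 1) \<noteq> 0"
  "emeasure lborel (ball (0::'a::euclidean_space) 1) \<noteq> \<infinity>"
proof -
  show fin: "emeasure lborel (ball (0::'a) 1) \<noteq> \<infinity>"
    using emeasure_lborel_ball_finite[of "0::'a" 1] by simp
  have "measure lborel (ball (0::'a) 1) > 0"
    using content_ball_pos[of 1 "0::'a"] by simp
  then show "emeasure lborel (ball (0::'a) 1) \<noteq> 0"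
    using fin by (auto simp: measure_def)
qed

lemma prob_space_sphere_uniform: "prob_space (sphere_uniform :: 'a::euclidean_space measure)"
  unfolding sphere_uniform_def
  by (intro prob_space.prob_space_distr prob_space_uniform_measure emeasure_unit_ball_lborel)
     measurable

lemma AE_sphere_uniform: "AE x in (sphere_uniform :: 'a::euclidean_space measure). norm x = 1"
proof -
  have "AE x in lborel. x \<noteq> (0::'a)"
    by (rule AE_lborel_singleton)
  then have "AE x in uniform_measure lborel (ball (0::'a) 1). norm (x /\<^sub>R norm x) = 1"
    by (intro AE_uniform_measureI) (auto elim: eventually_mono)
  then show ?thesis
    unfolding sphere_uniform_def by (subst AE_distr_iff) auto
qed

lemma distr_sphere_uniform_orthogonal:
  fixes f :: "real ^ 'n::{finite,wellorder} \<Rightarrow> real ^ 'n::_"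
  assumes f: "orthogonal_transformation f"
  shows "distr sphere_uniform borel f = sphere_uniform"
proof (rule measure_eqI)
  interpret linear f
    using f by (simp add: orthogonal_transformation_def)
  have f_meas [measurable]: "f \<in> borel_measurable borel"
    by (intro borel_measurable_continuous_onI linear_continuous_on linear_linear[THEN iffD2]
        linear_axioms linear_conv_bounded_linear[THEN iffD1])
  let ?B = "ball (0 :: real ^ 'n::_) 1"
  let ?s = "\<lambda>x :: real ^ 'n::_. x /\<^sub>R norm x"
  fix A :: "(real ^ 'n::_) set"
  assume "A \<in> sets (distr sphere_uniform borel f)"
  then have A [measurable]: "A \<in> sets borel" by simp
  define S where "S = ?B \<inter> ((f \<circ> ?s) -` A)"
  define T where "T = ?B \<inter> (?s -` A)"
  have s_meas [measurable]: "?s \<in> borel_measurable borel" by measurable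
  have S [measurable]: "S \<in> sets borel"
    unfolding S_def
    using measurable_sets[OF measurable_comp[OF s_meas f_meas] A] by (auto intro: sets.Int)
  have T [measurable]: "T \<in> sets borel"
    unfolding T_def
    using measurable_sets[OF s_meas A] by (auto intro: sets.Int)
  have nf: "norm (f x) = norm x" for x
    using f by (simp add: orthogonal_transformation_norm)
  have img: "f ` S = T"
  proof
    show "f ` S \<subseteq> T" by (auto simp: S_def T_def nf scale)
    show "T \<subseteq> f ` S"
    proof
      fix y assume y: "y \<in> T"
      obtain x where x: "y = f x"
        using orthogonal_transformation_surj[OF f] by (metis surjD)
      then have "x \<in> S" using y by (auto simp: S_def T_def nf scale)
      then show "y \<in> f ` S" using x by blast
    qed
  qed
  have fin: "emeasure lborel X \<noteq> \<infinity>" if "X \<subseteq> ?B" "X \<in> sets borel" for X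
    using emeasure_mono[OF that(1), of lborel] emeasure_unit_ball_lborel(2)[where 'a = "real ^ 'n::_"]
    by (auto simp: top_unique)
  have SB: "S \<subseteq> ?B" and TB: "T \<subseteq> ?B"
    by (auto simp: S_def T_def)
  have "S \<in> lmeasurable"
    by (rule fmeasurableI) (use fin[OF SB S] S in \<open>auto simp: less_top\<close>)
  then have "measure lebesgue (f ` S) = measure lebesgue S"
    by (rule measure_orthogonal_image[OF f])
  then have m: "measure lborel S = measure lborel T"
    by (simp add: img)
  have e: "emeasure lborel S = emeasure lborel T"
    using fin[OF SB S] fin[OF TB T] m by (simp add: emeasure_eq_ennreal_measure)
  have "emeasure (distr sphere_uniform borel f) A
      = emeasure (uniform_measure lborel ?B) ((f \<circ> ?s) -` A)"
    unfolding sphere_uniform_def by (subst distr_distr) (auto simp: emeasure_distr)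
  also have "\<dots> = emeasure lborel S / emeasure lborel ?B"
    unfolding S_def using measurable_sets[OF measurable_comp[OF s_meas f_meas] A]
    by (subst emeasure_uniform_measure) auto
  also have "\<dots> = emeasure lborel T / emeasure lborel ?B"
    by (simp add: e)
  also have "\<dots> = emeasure (uniform_measure lborel ?B) (?s -` A)"
    unfolding T_def using measurable_sets[OF s_meas A]
    by (subst emeasure_uniform_measure) auto
  also have "\<dots> = emeasure sphere_uniform A"
    unfolding sphere_uniform_def by (simp add: emeasure_distr)
  finally show "emeasure (distr sphere_uniform borel f) A = emeasure sphere_uniform A" .
qed simp

text \<open>Independence of \<open>r\<close> and \<open>\<eta>\<close> is independence of the generated \<open>\<sigma>\<close>-algebras;
  the library's \<open>indep_var\<close> requires both variables to have the same codomain type.\<close>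

definition spherically_contoured :: "'b measure \<Rightarrow> ('b \<Rightarrow> 'a::euclidean_space) \<Rightarrow> bool" where
  "spherically_contoured P \<xi> \<longleftrightarrow>
     (\<exists>(r :: 'b \<Rightarrow> real) (\<eta> :: 'b \<Rightarrow> 'a).
        r \<in> borel_measurable P \<and> \<eta> \<in> borel_measurable P \<and>
        (AE \<omega> in P. r \<omega> > 0) \<and>
        distr P borel \<eta> = sphere_uniform \<and>
        prob_space.indep_set P {r -` A \<inter> space P | A. A \<in> sets borel}
                               {\<eta> -` B \<inter> space P | B. B \<in> sets borel} \<and>
        (\<forall>\<omega>\<in>space P. \<xi> \<omega> = r \<omega> *\<^sub>R \<eta> \<omega>))"


section \<open>The class of distribution functions\<close>

definition slowly_varying :: "(real \<Rightarrow> real) \<Rightarrow> bool" where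
  "slowly_varying ell \<longleftrightarrow>
     (\<exists>a. set_borel_measurable borel {a..} ell) \<and>
     eventually (\<lambda>t. ell t > 0) at_top \<and>
     (\<forall>c>0. ((\<lambda>t. ell (c * t) / ell t) \<longlongrightarrow> 1) at_top)"

definition distribution_function_nonneg :: "(real \<Rightarrow> real) \<Rightarrow> bool" where
  "distribution_function_nonneg F \<longleftrightarrow>
     (\<exists>\<mu>. real_distribution \<mu> \<and> measure \<mu> {..<0} = 0 \<and> F = cdf \<mu>)"

text \<open>Membership in the class with a given slowly varying function \<open>ell\<close>.
  The integrability clause says that the integral in the exponent exists.\<close>

definition in_class_with :: "real \<Rightarrow> ereal \<Rightarrow> (real \<Rightarrow> real) \<Rightarrow> (real \<Rightarrow> real) \<Rightarrow> bool" where
  "in_class_with \<beta> \<gamma> ell F \<longleftrightarrow>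
     \<beta> \<le> 1 \<and> 0 < \<gamma> \<and>
     distribution_function_nonneg F \<and> (\<forall>x>0. F x < 1) \<and>
     slowly_varying ell \<and> ((\<lambda>t. ereal (ell t)) \<longlongrightarrow> \<gamma>) at_top \<and>
     (\<exists>x0\<ge>0. \<exists>(C :: real \<Rightarrow> real) C_lim.
        0 < C_lim \<and> (C \<longlongrightarrow> C_lim) at_top \<and>
        (\<forall>x\<ge>x0. set_integrable lborel {x0..x} (\<lambda>t. ell t * t powr (- \<beta>))) \<and>
        (\<lambda>x. 1 - F x) \<sim>[at_top]
          (\<lambda>x. C x * exp (- (LBINT t:{x0..x}. ell t * t powr (- \<beta>)))))"

text \<open>Meaningful for \<open>0 < y \<le> 1\<close>; the mathematical value at \<open>y = 0\<close> is \<open>+\<infinity>\<close>.\<close>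

definition g_fun :: "real \<Rightarrow> real \<Rightarrow> real" where
  "g_fun \<beta> y = (if \<beta> < 1 then (y powr (\<beta> - 1) - 1) / (1 - \<beta>) else - ln y)"

definition r_fun :: "real \<Rightarrow> (real \<Rightarrow> real) \<Rightarrow> (real \<Rightarrow> real) \<Rightarrow> real \<Rightarrow> real \<Rightarrow> real" where
  "r_fun \<beta> ell ell0 h y =
     h powr (1 - \<beta>) * (LBINT v:{1..inverse y}. (ell (h * v) - ell0 h) * v powr (- \<beta>))"


section \<open>Finite sets of points on the sphere\<close>

definition rho_star :: "nat \<Rightarrow> (nat \<Rightarrow> 'a::real_inner) \<Rightarrow> real" where
  "rho_star N u = Max {u i \<bullet> u j | i j. i \<in> {1..N} \<and> j \<in> {1..N} \<and> i \<noteq> j}"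

text \<open>\<open>\<theta>\<^sub>*\<close> is the angle in \<open>[0, \<pi>/2]\<close> with \<open>cos \<theta>\<^sub>* = sqrt ((1 + \<rho>\<^sub>*) / 2)\<close>.\<close>

definition theta_star :: "nat \<Rightarrow> (nat \<Rightarrow> 'a::real_inner) \<Rightarrow> real" where
  "theta_star N u = arccos (sqrt ((1 + rho_star N u) / 2))"

definition num_closest :: "nat \<Rightarrow> (nat \<Rightarrow> 'a::real_inner) \<Rightarrow> nat" where
  "num_closest N u = card {(i, j). i \<in> {1..N} \<and> j \<in> {1..N} \<and> u i \<bullet> u j = rho_star N u}"

definition bonferroni :: "'b measure \<Rightarrow> ('b \<Rightarrow> 'a::real_inner) \<Rightarrow> nat \<Rightarrow> (nat \<Rightarrow> 'a) \<Rightarrow> real \<Rightarrow> real" where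
  "bonferroni P \<xi> N u c = (\<Sum>i=1..N. measure P {\<omega> \<in> space P. u i \<bullet> \<xi> \<omega> \<ge> c})"

definition max_tail :: "'b measure \<Rightarrow> ('b \<Rightarrow> 'a::real_inner) \<Rightarrow> nat \<Rightarrow> (nat \<Rightarrow> 'a) \<Rightarrow> real \<Rightarrow> real" where
  "max_tail P \<xi> N u c = measure P {\<omega> \<in> space P. Max ((\<lambda>i. u i \<bullet> \<xi> \<omega>) ` {1..N}) \<ge> c}"

definition rel_error :: "'b measure \<Rightarrow> ('b \<Rightarrow> 'a::real_inner) \<Rightarrow> nat \<Rightarrow> (nat \<Rightarrow> 'a) \<Rightarrow> real \<Rightarrow> real" where
  "rel_error P \<xi> N u c =
     (bonferroni P \<xi> N u c - max_tail P \<xi> N u c) / bonferroni P \<xi> N u c"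

definition bonferroni_tail_valid ::
    "'b measure \<Rightarrow> ('b \<Rightarrow> 'a::real_inner) \<Rightarrow> nat \<Rightarrow> (nat \<Rightarrow> 'a) \<Rightarrow> bool" where
  "bonferroni_tail_valid P \<xi> N u \<longleftrightarrow> (rel_error P \<xi> N u \<longlongrightarrow> 0) at_top"

end

theory Submission
  imports Defs "HOL-Real_Asymp.Real_Asymp"
begin

text \<open>Conditioning on \<open>R = \<parallel>\<xi>\<parallel>\<^sup>2\<close> turns numerator and denominator of \<open>\<Delta>(c)\<close> into averages
  \<open>E[A(1 - h / R)]\<close>, where \<open>A\<close> is a function of the spherical part alone. If
  \<open>A(s) \<sim> K s\<^sup>a\<close> as \<open>s \<rightarrow> 0\<close>, such an average is asymptotic to
  \<open>K \<Gamma>(a + 1) \<lambda>(h) powr (-a) (1 - F(h))\<close> with \<open>\<lambda>(h) = h powr (1 - \<beta>) \<ell>(h)\<close>, because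
  \<open>(1 - F(h / (1 - t / \<lambda>(h)))) / (1 - F(h)) \<rightarrow> exp (-t)\<close>.
  For the denominator \<open>h = c\<^sup>2\<close> and \<open>A\<close> is the measure of a spherical cap, of order
  \<open>s powr ((n - 1) / 2)\<close>. For the numerator \<open>h = c\<^sup>2 / cos\<^sup>2 \<theta>\<^sub>*\<close>, and near this level only
  intersections of two caps with \<open>\<rho>\<^sub>i\<^sub>j = \<rho>\<^sub>*\<close> survive, each of order \<open>s powr (n / 2)\<close>. The ratio of the
  two tails \<open>1 - F\<close> produces the exponential factor of the theorem.\<close>

section \<open>Averages against a rapidly decreasing tail\<close>

text \<open>The class constrains only the tail 1 - F, so no density of R is available. Averages are
  therefore rewritten by the layer-cake formula as integrals of tail probabilities against a t^(a-1)
  dt. Passing to the limit under the integral needs an exponential bound on the tail ratio for every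
  s in [0,1), not only for s of order 1 / lambda(h). The level c^2 / cos^2 is forced by
  Cauchy-Schwarz: a unit vector x with <u_i,x> >= t and <u_j,x> >= t exists only if t <= |u_i + u_j|
  / 2, and this is at most cos theta_star for i distinct from j. The two exponents differ because a
  cap shrinks like sqrt s in n - 1 directions, whereas a lens shrinks like s in the direction u_i -
  u_j and like sqrt s in the n - 2 directions orthogonal to u_i and u_j. Ball volumes and Gamma
  moments then cancel down to 1 / (sqrt pi tan theta_star); the remaining 1/2 compensates that D
  counts ordered pairs. If cos theta_star = 0, the points are an antipodal pair and tan theta_star
  is infinite; there Delta(c) = 0 for all c > 0, and this case is treated separately.\<close>

abbreviation tail :: "real measure \<Rightarrow> real \<Rightarrow> real" where
  "tail M x \<equiv> measure M {x<..}"

lemma borel_measurable_antimono: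
  fixes f :: "real \<Rightarrow> real"
  assumes "\<And>t t'. t \<le> t' \<Longrightarrow> f t' \<le> f t"
  shows "f \<in> borel_measurable borel"
proof -
  have "mono (\<lambda>t. - f t)" using assms by (auto simp: mono_def)
  then have "(\<lambda>t. - (- f t)) \<in> borel_measurable borel"
    by (intro borel_measurable_uminus borel_measurable_mono)
  then show ?thesis by (simp del: borel_measurable_uminus_eq)
qed

text \<open>Layer-cake input: the power of a positive part is the integral of its derivative over
  the levels below it. The nonnegative integral fits the use of Fubini in
  \<open>powr_average_lim\<close>.\<close>

lemma nn_integral_powr_deriv:
  assumes "a > 0"
  shows "(\<integral>\<^sup>+t. ennreal (a * t powr (a - 1)) * indicator {0<..<y} t \<partial>lborel) = ennreal (max 0 y powr a)"
proof (cases "y > 0")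
  case True
  have "((\<lambda>t. a * t powr (a - 1)) has_integral (a * (y powr (a - 1 + 1) / (a - 1 + 1)))) {0..y}"
    using assms True by (intro has_integral_mult_right has_integral_powr_from_0) auto
  then have "((\<lambda>t. a * t powr (a - 1)) has_integral (y powr a)) {0..y}"
    using assms by simp
  then have "(\<integral>\<^sup>+t. ennreal (indicator {0..y} t * (a * t powr (a - 1))) \<partial>lborel) = ennreal (y powr a)"
    using assms by (intro nn_integral_has_integral_lebesgue) auto
  moreover have "(\<integral>\<^sup>+t. ennreal (indicator {0..y} t * (a * t powr (a - 1))) \<partial>lborel)
      = (\<integral>\<^sup>+t. ennreal (a * t powr (a - 1)) * indicator {0<..<y} t \<partial>lborel)"
  proof (intro nn_integral_cong_AE)
    have "AE t in lborel. t \<notin> {0, y}"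
      by (intro AE_not_in countable_imp_null_set_lborel) auto
    then show "AE t in lborel. ennreal (indicator {0..y} t * (a * t powr (a - 1)))
        = ennreal (a * t powr (a - 1)) * indicator {0<..<y} t"
      by eventually_elim (auto simp: indicator_def)
  qed
  ultimately show ?thesis using True by simp
qed auto

text \<open>The last two assumptions say that, given R > h, the variable lam(h) (1 - h / R) is
  asymptotically standard exponential, with an exponential bound uniform in large h. The argument h
  / (1 - s) of \<open>tail\<close> arises because 1 - h / R > s means R > h / (1 - s).\<close>

locale laplace_tail = real_distribution nu for nu :: "real measure" +
  fixes lam :: "real \<Rightarrow> real" and C c :: real
  assumes tail_pos: "\<And>x. x > 0 \<Longrightarrow> tail nu x > 0"
    and lam_at_top: "filterlim lam at_top at_top"
    and c_pos: "c > 0"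
    and tail_ratio_lim: "\<And>t. t > 0 \<Longrightarrow>
      ((\<lambda>h. tail nu (h / (1 - t / lam h)) / tail nu h) \<longlongrightarrow> exp (- t)) at_top"
    and tail_ratio_bound: "\<forall>\<^sub>F h in at_top. \<forall>s\<in>{0..<1}.
      tail nu (h / (1 - s)) \<le> C * exp (- c * lam h * s) * tail nu h"
begin

text \<open>The survival function \<open>S h t\<close> of lam(h) (1 - h / R) given R > h tends to
  exp (-t) and is dominated by C exp (-c t). Writing the a-th moment as the integral of a t^(a-1)
  \<open>S h t\<close>, dominated convergence yields the moment of the standard exponential
  law.\<close>

lemma powr_average_lim:
  assumes a: "a > 0"
  shows "((\<lambda>h. lam h powr a / tail nu h *
            (\<integral>x. indicator {0<..} x * max 0 (1 - h / x) powr a \<partial>nu)) \<longlongrightarrow> Gamma (a + 1)) at_top"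
proof -
  let ?q = "\<lambda>h x. indicator {0<..} x * max 0 (1 - h / x) powr a"
  let ?g = "\<lambda>t. a * t powr (a - 1) * indicator {0<..} t"
  let ?X = "\<lambda>h t. {x. x > 0 \<and> lam h * (1 - h / x) > t}"
  define S where "S h t = measure nu (?X h t) / tail nu h" for h t
  define w where "w t = C * (a * t powr (a - 1) * exp (- c * t)) * indicator {0<..} t" for t :: real
  define J where "J h = (\<integral>t. ?g t * S h t \<partial>lborel)" for h
  have ev: "\<forall>\<^sub>F h in at_top. h > 0 \<and> lam h > 0 \<and> (\<forall>s\<in>{0..<1}.
      tail nu (h / (1 - s)) \<le> C * exp (- c * lam h * s) * tail nu h)"
    using eventually_gt_at_top[of 0] tail_ratio_bound
      filterlim_at_top_dense[THEN iffD1, OF lam_at_top, rule_format, of 0]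
    by eventually_elim auto
  have setq: "(?X h t) =
      (if t < lam h then {h / (1 - t / lam h)<..} else {})" if "h > 0" "lam h > 0" "t > 0" for h t
  proof (cases "t < lam h")
    case True
    then have p: "1 - t / lam h > 0" using that by simp
    have "x > 0 \<and> lam h * (1 - h / x) > t \<longleftrightarrow> x > h / (1 - t / lam h)" for x
    proof -
      have "lam h * (1 - h / x) > t \<longleftrightarrow> 1 - t / lam h > h / x"
        using that by (simp add: field_simps)
      moreover have "h / (1 - t / lam h) > 0" using p that by simp
      moreover have "1 - t / lam h > h / x \<longleftrightarrow> x > h / (1 - t / lam h)" if "x > 0"
        using that p by (simp add: pos_divide_less_eq mult.commute)
      ultimately show ?thesis by (metis less_trans)
    qed
    then show ?thesis using True by auto
  next
    case False
    have "\<not> (x > 0 \<and> lam h * (1 - h / x) > t)" for x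
    proof
      assume x: "x > 0 \<and> lam h * (1 - h / x) > t"
      then have "lam h * (1 - h / x) < lam h * 1" using that by (intro mult_strict_left_mono) auto
      then show False using x False by simp
    qed
    then show ?thesis using False by auto
  qed
  have Sm [measurable]: "S h \<in> borel_measurable borel" for h
    unfolding S_def
    by (intro borel_measurable_antimono divide_right_mono finite_measure_mono) auto
  have Snn: "S h t \<ge> 0" for h t by (simp add: S_def)
  have Sbound: "S h t \<le> C * exp (- c * t)"
    if "t > 0" and h: "h > 0 \<and> lam h > 0 \<and> (\<forall>s\<in>{0..<1}.
      tail nu (h / (1 - s)) \<le> C * exp (- c * lam h * s) * tail nu h)" for h t
  proof (cases "t < lam h")
    case True
    then have "tail nu (h / (1 - t / lam h)) \<le> C * exp (- c * lam h * (t / lam h)) * tail nu h"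
      using h[THEN conjunct2, THEN conjunct2, rule_format, of "t / lam h"] h \<open>t > 0\<close> by simp
    moreover have "c * lam h * (t / lam h) = c * t" using h by simp
    ultimately have "tail nu (h / (1 - t / lam h)) \<le> C * exp (- c * t) * tail nu h"
      by (simp del: times_divide_eq_right)
    then show ?thesis using h \<open>t > 0\<close> True tail_pos[of h]
      by (simp add: S_def setq pos_divide_le_eq)
  next
    case False
    \<comment> \<open>At s = 0 the assumed bound forces C >= 0, which makes the claim trivial here,
      where \<open>S h t\<close> vanishes.\<close>
    have "tail nu h \<le> C * tail nu h" using h[THEN conjunct2, THEN conjunct2, rule_format, of 0] by simp
    then have "C \<ge> 0" using tail_pos[of h] h by (smt (verit) mult_neg_pos)
    then show ?thesis using False h \<open>t > 0\<close> by (simp add: S_def setq)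
  qed
  have Gnn: "(\<integral>\<^sup>+t. ennreal (a * t powr (a - 1) * exp (- t) * indicator {0<..} t) \<partial>lborel) = ennreal (Gamma (a + 1))"
  proof -
    have "(\<integral>\<^sup>+t. ennreal (a * t powr (a - 1) * exp (- t) * indicator {0<..} t) \<partial>lborel)
        = (\<integral>\<^sup>+t. ennreal a * ennreal (indicator {0..} t * t powr (a - 1) / exp t) \<partial>lborel)"
      using a by (intro nn_integral_cong)
        (auto simp: indicator_def exp_minus field_simps simp flip: ennreal_mult' )
    also have "\<dots> = ennreal a * ennreal (Gamma a)"
      using a by (subst nn_integral_cmult) (auto simp: Gamma_conv_nn_integral_real)
    also have "\<dots> = ennreal (Gamma (a + 1))"
      using a by (simp add: Gamma_plus1 ennreal_mult' nonpos_Ints_def)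
    finally show ?thesis .
  qed
  have Gint1: "integrable lborel (\<lambda>t. a * t powr (a - 1) * exp (- t) * indicator {0<..} t)"
    using a by (intro integrableI_nonneg) (auto simp: Gnn)
  have Gint: "integrable lborel (\<lambda>t. a * t powr (a - 1) * exp (- k * t) * indicator {0<..} t)"
    if "k > 0" for k :: real
  proof -
    \<comment> \<open>Rescaling t by k turns exp (-t) into exp (-k t); the power of k that comes out
      of t powr (a - 1) is divided away.\<close>
    have "integrable lborel (\<lambda>t. inverse (k powr (a - 1)) *
        (a * (0 + k * t) powr (a - 1) * exp (- (0 + k * t)) * indicator {0<..} (0 + k * t)))"
      using that by (intro integrable_mult_right lborel_integrable_real_affine[OF Gint1]) auto
    also have "(\<lambda>t. inverse (k powr (a - 1)) *
        (a * (0 + k * t) powr (a - 1) * exp (- (0 + k * t)) * indicator {0<..} (0 + k * t))) =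
        (\<lambda>t. a * t powr (a - 1) * exp (- k * t) * indicator {0<..} t)"
      using that by (auto simp: fun_eq_iff indicator_def powr_mult zero_less_mult_iff)
    finally show ?thesis .
  qed
  have Geq: "(\<integral>t. ?g t * exp (- t) \<partial>lborel) = Gamma (a + 1)"
  proof -
    have "(\<integral>t. a * t powr (a - 1) * exp (- t) * indicator {0<..} t \<partial>lborel) = Gamma (a + 1)"
      using a Gnn by (subst integral_eq_nn_integral) (auto intro!: Gamma_real_nonneg)
    then show ?thesis by (simp add: mult_ac)
  qed
  have wint: "integrable lborel w"
    unfolding w_def using integrable_mult_right[OF Gint[OF c_pos], of C] by (simp add: mult_ac)
  have Jlim: "(J \<longlongrightarrow> Gamma (a + 1)) at_top"
    unfolding J_def Geq[symmetric]
  proof (rule integral_dominated_convergence_at_top[where w = w])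
    show "\<forall>\<^sub>F h in at_top. AE t in lborel. norm (?g t * S h t) \<le> w t"
      using ev
    proof eventually_elim
      case (elim h)
      show ?case
        using Sbound[OF _ elim] Snn[of h] a
        by (intro AE_I2) (auto simp: w_def indicator_def abs_mult mult_ac intro!: mult_left_mono)
    qed
    show "AE t in lborel. ((\<lambda>h. ?g t * S h t) \<longlongrightarrow>
        ?g t * exp (- t)) at_top"
    proof (intro AE_I2)
      fix t :: real
      show "((\<lambda>h. ?g t * S h t) \<longlongrightarrow>
        ?g t * exp (- t)) at_top"
      proof (cases "t > 0")
        case True
        have "\<forall>\<^sub>F h in at_top. tail nu (h / (1 - t / lam h)) / tail nu h = S h t"
          using ev filterlim_at_top_dense[THEN iffD1, OF lam_at_top, rule_format, of t]
          by eventually_elim (use True in \<open>simp add: S_def setq\<close>)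
        then have "((\<lambda>h. S h t) \<longlongrightarrow> exp (- t)) at_top"
          using tail_ratio_lim[OF True] by (rule tendsto_cong[THEN iffD1])
        then show ?thesis by (intro tendsto_intros)
      qed auto
    qed
  qed (use wint in \<open>auto\<close>)
  have "\<forall>\<^sub>F h in at_top. J h = lam h powr a / tail nu h *
            (\<integral>x. ?q h x \<partial>nu)"
    using ev
  proof eventually_elim
    case (elim h)
    let ?f = "\<lambda>t x. ennreal (a * t powr (a - 1)) * indicator {0<..} t *
      indicator (?X h t) x :: ennreal"
    define I where "I = (\<integral>x. ?q h x \<partial>nu)"
    interpret P: pair_sigma_finite nu lborel by standard
    have i1: "integrable nu (\<lambda>x. ?q h x)"
      using elim a by (intro integrable_const_bound[where B = 1])
        (auto intro!: AE_I2 powr_le1 simp: indicator_def)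
    \<comment> \<open>Layer cake, then Fubini: the power is spread over the levels t, and
      integrating first over x leaves the probabilities \<open>S h t\<close>.\<close>
    have "ennreal (lam h powr a * I)
        = (\<integral>\<^sup>+x. ennreal (lam h powr a * ?q h x) \<partial>nu)"
      unfolding I_def by (subst nn_integral_eq_integral) (use i1 in auto)
    also have "\<dots> = (\<integral>\<^sup>+x. \<integral>\<^sup>+t. ?f t x \<partial>lborel \<partial>nu)"
    proof (intro nn_integral_cong)
      fix x :: real
      show "ennreal (lam h powr a * ?q h x) = (\<integral>\<^sup>+t. ?f t x \<partial>lborel)"
      proof (cases "x > 0")
        case True
        have "lam h powr a * max 0 (1 - h / x) powr a = max 0 (lam h * (1 - h / x)) powr a"
          using elim by (subst powr_mult[symmetric])
            (auto simp: max_def zero_le_mult_iff not_le dest: less_imp_le)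
        moreover have "(\<integral>\<^sup>+t. ?f t x \<partial>lborel) =
          (\<integral>\<^sup>+t. ennreal (a * t powr (a - 1)) * indicator {0<..<lam h * (1 - h / x)} t \<partial>lborel)"
          using True by (intro nn_integral_cong) (auto simp: indicator_def)
        ultimately show ?thesis using True nn_integral_powr_deriv[OF a] by simp
      qed auto
    qed
    also have "\<dots> = (\<integral>\<^sup>+t. \<integral>\<^sup>+x. ?f t x \<partial>nu \<partial>lborel)"
      by (rule P.Fubini'[symmetric]) measurable
    also have "\<dots> = (\<integral>\<^sup>+t. ennreal (tail nu h * (?g t * S h t)) \<partial>lborel)"
    proof (intro nn_integral_cong)
      fix t :: real
      have "(\<integral>\<^sup>+x. ?f t x \<partial>nu) = ennreal (a * t powr (a - 1)) * indicator {0<..} t * emeasure nu (?X h t)"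
        by (subst nn_integral_cmult) (auto intro!: arg_cong2[where f="(*)"] nn_integral_indicator)
      then show "(\<integral>\<^sup>+x. ?f t x \<partial>nu) = ennreal (tail nu h * (?g t * S h t))"
        using a tail_pos[of h] elim
        by (auto simp: S_def indicator_def emeasure_eq_measure ennreal_mult'' [symmetric] field_simps)
    qed
    also have "\<dots> = ennreal (tail nu h * J h)"
      unfolding J_def
    proof (subst nn_integral_eq_integral)
      show "integrable lborel (\<lambda>t. tail nu h * (?g t * S h t))"
      proof (intro integrable_mult_right Bochner_Integration.integrable_bound[OF wint])
        show "AE t in lborel. norm (?g t * S h t) \<le> norm (w t)"
        proof (intro AE_I2)
          fix t :: real
          have "norm (?g t * S h t) \<le> w t"
            using Sbound[OF _ elim, of t] Snn[of h t] a
              mult_left_mono[of "S h t" "C * exp (- c * t)" "a * t powr (a - 1)"]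
            by (auto simp: w_def indicator_def abs_mult mult_ac)
          then show "norm (?g t * S h t) \<le> norm (w t)"
            by simp
        qed
      qed auto
    qed (use a Snn in auto)
    finally have "lam h powr a * I = tail nu h * J h"
      by (subst (asm) ennreal_inj) (use a Snn in \<open>auto simp: I_def J_def intro!: mult_nonneg_nonneg integral_nonneg_AE\<close>)
    then show ?case using tail_pos[of h] elim by (simp add: I_def field_simps)
  qed
  with Jlim show ?thesis by (rule tendsto_cong[THEN iffD1, rotated])
qed

text \<open>R > h / (1 - d) means 1 - h / R > d for a fixed d. Relative to R > h this has
  probability exponentially small in lam(h), which beats every power of lam(h).\<close>

lemma tail_gap_negligible:
  assumes "0 < d" "d < 1"
  shows "((\<lambda>h. lam h powr a / tail nu h * tail nu (h / (1 - d))) \<longlongrightarrow> 0) at_top"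
proof (rule tendsto_sandwich[OF _ _ tendsto_const])
  have "((\<lambda>x. C * (x powr a * exp (- (c * d) * x))) \<longlongrightarrow> C * 0) at_top"
  proof (intro tendsto_mult tendsto_const)
    show "((\<lambda>x. x powr a * exp (- (c * d) * x)) \<longlongrightarrow> 0) at_top"
      using c_pos assms by real_asymp
  qed
  from filterlim_compose[OF this lam_at_top]
  show "((\<lambda>h. C * (lam h powr a * exp (- (c * d) * lam h))) \<longlongrightarrow> 0) at_top" by simp
  show "\<forall>\<^sub>F h in at_top. lam h powr a / tail nu h * tail nu (h / (1 - d))
      \<le> C * (lam h powr a * exp (- (c * d) * lam h))"
    using tail_ratio_bound eventually_gt_at_top[of 0]
  proof eventually_elim
    case (elim h)
    have "tail nu (h / (1 - d)) \<le> C * exp (- c * lam h * d) * tail nu h"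
      using elim assms by auto
    then have "lam h powr a / tail nu h * tail nu (h / (1 - d)) \<le>
      lam h powr a / tail nu h * (C * exp (- c * lam h * d) * tail nu h)"
      by (intro mult_left_mono) auto
    also have "\<dots> = C * (lam h powr a * exp (- (c * d) * lam h))"
      using tail_pos[of h] elim by (simp add: mult_ac)
    finally show ?case .
  qed
qed auto

text \<open>Near 0 the function \<open>A\<close> is within e' s^a of K s^a, and for s > d both are
  bounded while \<open>tail_gap_negligible\<close> makes that range disappear. So the pure power
  from \<open>powr_average_lim\<close> decides the limit. The condition for s <= 0 restricts the
  average to R > h.\<close>

lemma average_lim:
  fixes A :: "real \<Rightarrow> real"
  assumes a: "a > 0" and [measurable]: "A \<in> borel_measurable borel"
    and bdd: "\<And>s. \<bar>A s\<bar> \<le> B" and zero: "\<And>s. s \<le> 0 \<Longrightarrow> A s = 0"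
    and lim: "((\<lambda>s. A s / s powr a) \<longlongrightarrow> K) (at_right 0)"
  shows "((\<lambda>h. lam h powr a / tail nu h *
            (\<integral>x. indicator {0<..} x * A (1 - h / x) \<partial>nu)) \<longlongrightarrow> K * Gamma (a + 1)) at_top"
proof -
  let ?q = "\<lambda>h x. indicator {0<..} x * max 0 (1 - h / x) powr a"
  let ?A = "\<lambda>h x. indicator {0<..} x * A (1 - h / x)"
  define J where "J h = (\<integral>x. ?q h x \<partial>nu)" for h
  define I where "I h = (\<integral>x. ?A h x \<partial>nu)" for h
  define L where "L h = lam h powr a / tail nu h" for h
  have L0: "L h \<ge> 0" for h by (simp add: L_def)
  have Jlim: "((\<lambda>h. L h * J h) \<longlongrightarrow> Gamma (a + 1)) at_top"
    unfolding L_def J_def by (rule powr_average_lim[OF a])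
  have i1: "integrable nu (\<lambda>x. ?q h x)" if "h > 0" for h
    using that a by (intro integrable_const_bound[where B = 1])
        (auto intro!: AE_I2 powr_le1 simp: indicator_def)
  have i2: "integrable nu (\<lambda>x. ?A h x)" for h
    using order_trans[OF abs_ge_zero bdd] bdd by (intro integrable_const_bound[where B = B])
        (auto intro!: AE_I2 simp: indicator_def)
  have "B \<ge> 0" using bdd[of 0] by linarith
  have main: "((\<lambda>h. L h * I h - K * (L h * J h)) \<longlongrightarrow> 0) at_top"
  proof (rule tendstoI)
    fix e :: real assume "e > 0"
    define e' where "e' = e / (2 * (Gamma (a + 1) + 1))"
    have G: "Gamma (a + 1) > 0" using a by (intro Gamma_real_pos) auto
    then have e': "e' > 0" using \<open>e > 0\<close> by (simp add: e'_def)
    have "\<forall>\<^sub>F s in at_right 0. dist (A s / s powr a) K < e'"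
      using lim e' by (rule tendstoD)
    then obtain d0 where d0: "d0 > 0" "\<And>s. 0 < s \<Longrightarrow> s < d0 \<Longrightarrow> dist (A s / s powr a) K < e'"
      by (auto simp: eventually_at_right_field)
    define d where "d = min (d0 / 2) (1 / 2)"
    have d: "0 < d" "d < 1" "d < d0" using d0 by (auto simp: d_def)
    \<comment> \<open>For d < s <= 1 one has s powr a <= 1, so this bounds the distance of A s from
      K s powr a.\<close>
    define M where "M = B + \<bar>K\<bar>"
    have pt: "\<bar>A s - K * max 0 s powr a\<bar> \<le> e' * max 0 s powr a + M * indicator {d<..} s" if "s \<le> 1" for s
    proof -
      consider "s \<le> 0" | "0 < s" "s \<le> d" | "s > d" by linarith
      then show ?thesis
      proof cases
        case 1 then show ?thesis using zero d by (simp add: max_def)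
      next
        case 2
        then have "\<bar>A s / s powr a - K\<bar> < e'" using d0 d by (auto simp: dist_real_def)
        then have "\<bar>A s / s powr a - K\<bar> * s powr a \<le> e' * s powr a"
          by (intro mult_right_mono) auto
        also have "\<bar>A s / s powr a - K\<bar> * s powr a = \<bar>(A s / s powr a - K) * s powr a\<bar>"
          by (simp add: abs_mult)
        also have "(A s / s powr a - K) * s powr a = A s - K * s powr a"
          using 2 by (simp add: left_diff_distrib)
        finally show ?thesis using 2 by (simp add: max_def)
      next
        case 3
        have "s powr a \<le> 1" using 3 d a that by (intro powr_le1) auto
        then have "\<bar>K * s powr a\<bar> \<le> \<bar>K\<bar> * 1" unfolding abs_mult by (intro mult_left_mono) auto
        moreover have "\<bar>A s - K * s powr a\<bar> \<le> \<bar>A s\<bar> + \<bar>K * s powr a\<bar>" by (rule abs_triangle_ineq4)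
        moreover have "0 \<le> e' * s powr a" using e' by simp
        ultimately have "\<bar>A s - K * s powr a\<bar> \<le> e' * s powr a + (B + \<bar>K\<bar>)"
          using bdd[of s] by linarith
        then show ?thesis using 3 d by (simp add: M_def max_def)
      qed
    qed
    have bound: "\<bar>L h * I h - K * (L h * J h)\<bar> \<le> e' * (L h * J h) + M * (L h * tail nu (h / (1 - d)))"
      if h: "h > 0" for h
    proof -
      have eq: "x > 0 \<and> 1 - h / x > d \<longleftrightarrow> x > h / (1 - d)" for x
      proof -
        have "h / (1 - d) > 0" using d h by simp
        moreover have "1 - h / x > d \<longleftrightarrow> x > h / (1 - d)" if "x > 0"
          using that d by (simp add: field_simps)
        ultimately show ?thesis by (metis less_trans)
      qed
      have "\<bar>I h - K * J h\<bar> = \<bar>\<integral>x. ?A h x - K * ?q h x \<partial>nu\<bar>"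
        unfolding I_def J_def using i1[OF h] i2 by simp
      also have "\<dots> \<le> (\<integral>x. e' * ?q h x + M * indicator {h / (1 - d)<..} x \<partial>nu)"
      proof (rule order_trans[OF integral_abs_bound integral_mono])
        show "integrable nu (\<lambda>x. \<bar>?A h x - K * ?q h x\<bar>)"
          using i1[OF h] i2 by auto
        show "integrable nu (\<lambda>x. e' * ?q h x + M * indicator {h / (1 - d)<..} x)"
          using i1[OF h] by (auto simp: less_top[symmetric])
        show "\<bar>?A h x - K * ?q h x\<bar>
            \<le> e' * ?q h x + M * indicator {h / (1 - d)<..} x" for x
        proof (cases "x > 0")
          case True
          then show ?thesis using pt[of "1 - h / x"] h eq[of x] by (auto simp: indicator_def)
        next
          case False
          then have "\<not> x > h / (1 - d)" using eq[of x] by simp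
          then show ?thesis using False by simp
        qed
      qed
      also have "\<dots> = e' * J h + M * tail nu (h / (1 - d))"
        unfolding J_def using i1[OF h] by (subst Bochner_Integration.integral_add) (auto simp: less_top[symmetric])
      finally have "L h * \<bar>I h - K * J h\<bar> \<le> L h * (e' * J h + M * tail nu (h / (1 - d)))"
        using L0 by (intro mult_left_mono)
      also have "L h * \<bar>I h - K * J h\<bar> = \<bar>L h * (I h - K * J h)\<bar>"
        using L0 by (simp add: abs_mult)
      finally show ?thesis by (simp add: algebra_simps)
    qed
    have "((\<lambda>h. e' * (L h * J h) + M * (L h * tail nu (h / (1 - d)))) \<longlongrightarrow> e' * Gamma (a + 1) + M * 0) at_top"
      using Jlim tail_gap_negligible[OF d(1,2), of a] unfolding L_def
      by (intro tendsto_intros)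
    moreover have "e' * Gamma (a + 1) + M * 0 < e"
      using G \<open>e > 0\<close> by (simp add: e'_def field_simps) (smt (verit) mult_pos_pos)
    ultimately have "\<forall>\<^sub>F h in at_top. e' * (L h * J h) + M * (L h * tail nu (h / (1 - d))) < e"
      by (rule order_tendstoD)
    then show "\<forall>\<^sub>F h in at_top. dist (L h * I h - K * (L h * J h)) 0 < e"
      using eventually_gt_at_top[of 0]
      by eventually_elim (use bound in \<open>fastforce simp: dist_real_def\<close>)
  qed
  have "((\<lambda>h. (L h * I h - K * (L h * J h)) + K * (L h * J h)) \<longlongrightarrow> 0 + K * Gamma (a + 1)) at_top"
    by (intro tendsto_intros main Jlim)
  then show ?thesis by (simp add: L_def I_def)
qed

end

section \<open>Slow variation and the class of distributions\<close>

text \<open>The uniform convergence theorem for slowly varying functions, in additive form. The sets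
  \<open>E x\<close> of exceptional increments in \<open>{0..2 U}\<close> have measure tending to 0, so for large \<open>x\<close>
  the sets belonging to \<open>x\<close> and \<open>x + u\<close> cannot cover the overlap of the two windows.\<close>

lemma uniform_increment:
  fixes k :: "real \<Rightarrow> real"
  assumes [measurable]: "k \<in> borel_measurable borel"
    and lim: "\<And>u. u \<ge> 0 \<Longrightarrow> ((\<lambda>x. k (x + u) - k x) \<longlongrightarrow> 0) at_top"
    and U: "U > 0" and e: "e > 0"
  shows "\<forall>\<^sub>F x in at_top. \<forall>u\<in>{0..U}. \<bar>k (x + u) - k x\<bar> < e"
proof -
  define E where "E x = {t \<in> {0..2 * U}. \<bar>k (x + t) - k x\<bar> \<ge> e / 2}" for x
  have Em [measurable]: "E x \<in> sets borel" for x unfolding E_def by measurable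
  have sub: "E x \<subseteq> {0..2 * U}" for x by (auto simp: E_def)
  have fin: "emeasure lborel (E x) < \<infinity>" for x
    using emeasure_mono[OF sub, of lborel x] U by (auto simp: less_top[symmetric] top_unique)
  have "((\<lambda>x. integral\<^sup>L lborel (indicator (E x) :: real \<Rightarrow> real)) \<longlongrightarrow>
      integral\<^sup>L lborel (\<lambda>t::real. 0::real)) at_top"
  proof (rule integral_dominated_convergence_at_top[where w = "indicator {0..2 * U}"])
    show "AE t in lborel. ((\<lambda>x. indicator (E x) t :: real) \<longlongrightarrow> 0) at_top"
    proof (intro AE_I2)
      fix t :: real
      show "((\<lambda>x. indicator (E x) t :: real) \<longlongrightarrow> 0) at_top"
      proof (cases "t \<ge> 0")
        case True
        have "\<forall>\<^sub>F x in at_top. dist (k (x + t) - k x) 0 < e / 2"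
          using lim[OF True] e by (intro tendstoD) auto
        then have "\<forall>\<^sub>F x in at_top. indicator (E x) t = (0 :: real)"
          by eventually_elim (auto simp: E_def indicator_def dist_real_def)
        then show ?thesis by (rule tendsto_eventually)
      qed (auto simp: E_def)
    qed
    show "\<forall>\<^sub>F x in at_top. AE t in lborel. norm (indicator (E x) t :: real) \<le> indicator {0..2 * U} t"
      using sub by (intro always_eventually allI AE_I2) (auto simp: indicator_def subset_iff)
    show "integrable lborel (indicator {0..2 * U} :: real \<Rightarrow> real)"
      by (rule integrable_real_indicator) (auto simp: emeasure_lborel_Icc_eq)
  qed auto
  then have "((\<lambda>x. measure lborel (E x)) \<longlongrightarrow> 0) at_top" by simp
  then have "\<forall>\<^sub>F x in at_top. measure lborel (E x) < U / 2"
    using U by (intro order_tendstoD) auto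
  then obtain X where X: "\<And>x. x \<ge> X \<Longrightarrow> measure lborel (E x) < U / 2"
    by (auto simp: eventually_at_top_linorder)
  have "\<bar>k (x + u) - k x\<bar> < e" if x: "x \<ge> X" and u: "0 \<le> u" "u \<le> U" for x u
  proof (rule ccontr)
    assume neg: "\<not> ?thesis"
    \<comment> \<open>\<open>E (x + u)\<close> is moved by u, so that both exceptional sets are
      described by the same endpoint x + t. A t outside both sets puts k (x + t) within e / 2 of k x
      and of k (x + u).\<close>
    define E' where "E' = (\<lambda>t. - u + t) -` E (x + u)"
    have E'm [measurable]: "E' \<in> sets borel" unfolding E'_def
      by (rule measurable_sets_borel[OF _ Em]) simp
    have "emeasure lborel E' = emeasure (distr lborel borel ((+) (- u))) (E (x + u))"
      unfolding E'_def by (subst emeasure_distr) auto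
    then have em: "emeasure lborel E' = emeasure lborel (E (x + u))" by (simp add: lborel_distr_plus)
    have cover: "{u..2 * U} \<subseteq> E x \<union> E'"
    proof
      fix t assume t: "t \<in> {u..2 * U}"
      show "t \<in> E x \<union> E'"
      proof (rule ccontr)
        assume "t \<notin> E x \<union> E'"
        then have "\<bar>k (x + t) - k x\<bar> < e / 2" "\<bar>k (x + t) - k (x + u)\<bar> < e / 2"
          using t u by (auto simp: E_def E'_def)
        then show False using neg by linarith
      qed
    qed
    \<comment> \<open>The overlap {u..2 U} has length at least U, while the two sets together have
      measure less than U.\<close>
    have "2 * U - u = measure lborel {u..2 * U}" using u by simp
    also have "\<dots> \<le> measure lborel (E x \<union> E')"
      by (intro measure_mono_fmeasurable cover) (use fin em in \<open>auto intro!: fmeasurableI fmeasurable.Un\<close>)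
    also have "\<dots> \<le> measure lborel (E x) + measure lborel E'"
      by (intro measure_Un_le) auto
    also have "measure lborel E' = measure lborel (E (x + u))" using em by (simp add: measure_def)
    also have "measure lborel (E x) + measure lborel (E (x + u)) < U"
      using X[of x] X[of "x + u"] x u by linarith
    finally show False using u by linarith
  qed
  then show ?thesis unfolding eventually_at_top_linorder by (intro exI[of _ X]) auto
qed

text \<open>With k x = ln (ell (exp x)), scaling becomes translation and ratios become differences,
  so \<open>uniform_increment\<close> applies with increments in {0..ln W}.\<close>

lemma slowly_varying_uniform:
  assumes sv: "slowly_varying ell" and W: "W > 1" and e: "e > 0"
  shows "\<forall>\<^sub>F h in at_top. \<forall>v\<in>{1..W}. \<bar>ell (h * v) / ell h - 1\<bar> \<le> e"
proof -
  obtain a where a: "set_borel_measurable borel {a..} ell"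
    using sv by (auto simp: slowly_varying_def)
  have pos: "\<forall>\<^sub>F t in at_top. ell t > 0"
    and lim: "\<And>c. c > 0 \<Longrightarrow> ((\<lambda>t. ell (c * t) / ell t) \<longlongrightarrow> 1) at_top"
    using sv by (auto simp: slowly_varying_def)
  obtain b where b: "b > 0" "b \<ge> a" "\<And>t. t \<ge> b \<Longrightarrow> ell t > 0"
  proof -
    obtain b0 where "\<And>t. t \<ge> b0 \<Longrightarrow> ell t > 0"
      using pos by (auto simp: eventually_at_top_linorder)
    then show ?thesis using that[of "max 1 (max a b0)"] by auto
  qed
  \<comment> \<open>\<open>ell\<close> is measurable only on a half-line; the cut-off makes k Borel
    on the whole line and leaves it unchanged where exp x >= b.\<close>
  define k where "k x = ln (indicator {a..} (exp x) *\<^sub>R ell (exp x))" for x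
  have k_eq: "k x = ln (ell (exp x))" if "exp x \<ge> b" for x
    using that b by (simp add: k_def)
  have [measurable]: "(\<lambda>x. indicator {a..} x *\<^sub>R ell x) \<in> borel_measurable borel"
    using a by (simp add: set_borel_measurable_def)
  have km: "k \<in> borel_measurable borel"
    unfolding k_def by (rule borel_measurable_ln) (rule measurable_compose[of exp], measurable)
  have ev_exp: "\<forall>\<^sub>F x::real in at_top. exp x \<ge> b"
    using exp_at_top by (simp add: filterlim_at_top)
  have klim: "((\<lambda>x. k (x + u) - k x) \<longlongrightarrow> 0) at_top" if "u \<ge> 0" for u
  proof -
    have "((\<lambda>x. ln (ell (exp u * exp x) / ell (exp x))) \<longlongrightarrow> ln 1) at_top"
      by (intro tendsto_ln filterlim_compose[OF lim exp_at_top]) auto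
    moreover have "\<forall>\<^sub>F x in at_top. ln (ell (exp u * exp x) / ell (exp x)) = k (x + u) - k x"
      using ev_exp
    proof eventually_elim
      case (elim x)
      have "1 * exp x \<le> exp u * exp x" using that by (intro mult_right_mono) auto
      then have *: "b \<le> exp u * exp x" using elim by linarith
      then show ?case using elim b(3)[OF elim] b(3)[OF *]
        by (simp add: k_eq exp_add mult.commute ln_div)
    qed
    ultimately show ?thesis by (auto elim: Lim_transform_eventually)
  qed
  obtain d where d: "d > 0" "\<And>y. \<bar>y\<bar> < d \<Longrightarrow> \<bar>exp y - 1\<bar> \<le> e"
  proof -
    have "((\<lambda>y::real. exp y) \<longlongrightarrow> exp 0) (at 0)" by (intro tendsto_intros)
    then have "\<forall>\<^sub>F y::real in at 0. dist (exp y) (exp 0) < e" using e by (rule tendstoD)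
    then obtain d where "d > 0" "\<And>y. y \<noteq> 0 \<Longrightarrow> \<bar>y\<bar> < d \<Longrightarrow> \<bar>exp y - 1\<bar> < e"
      unfolding eventually_at by (auto simp: dist_real_def)
    then show ?thesis using that[of d] e by (metis abs_zero cancel_comm_monoid_add_class.diff_cancel exp_zero less_imp_le)
  qed
  have "\<forall>\<^sub>F x in at_top. \<forall>u\<in>{0..ln W}. \<bar>k (x + u) - k x\<bar> < d"
    using uniform_increment[OF km klim, of "ln W" d] W d by auto
  then have "\<forall>\<^sub>F h in at_top. \<forall>u\<in>{0..ln W}. \<bar>k (ln h + u) - k (ln h)\<bar> < d"
    by (rule eventually_compose_filterlim[OF _ ln_at_top])
  then show ?thesis using eventually_ge_at_top[of b]
  proof eventually_elim
    case (elim h)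
    show ?case
    proof
      fix v assume v: "v \<in> {1..W}"
      have "h > 0" "v > 0" using elim b v by auto
      moreover from this have "h * 1 \<le> h * v" using v by (intro mult_left_mono) auto
      ultimately have hp: "h > 0" "h * v \<ge> b" "v > 0" using elim(2) by linarith+
      have "\<bar>k (ln h + ln v) - k (ln h)\<bar> < d" using elim v W by auto
      moreover have "k (ln h + ln v) = ln (ell (h * v))" "k (ln h) = ln (ell h)"
        using elim hp b by (simp_all add: k_eq exp_add)
      ultimately have "\<bar>exp (ln (ell (h * v)) - ln (ell h)) - 1\<bar> \<le> e" using d(2) by auto
      then show "\<bar>ell (h * v) / ell h - 1\<bar> \<le> e"
        using b(3)[of h] b(3)[of "h * v"] hp elim by (simp add: exp_diff)
    qed
  qed
qed

text \<open>Near v = 1 the power v powr b is close to 1 by continuity. This form controls the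
  rescaled integrand on the short interval from 1 to 1 / (1 - t / lam h), which shrinks to the point
  1.\<close>

lemma slowly_varying_powr_uniform:
  assumes sv: "slowly_varying ell" and e: "e > 0"
  obtains d where "d > 0" "\<forall>\<^sub>F h in at_top. \<forall>v\<in>{1..1 + d}. \<bar>ell (h * v) / ell h * v powr b - 1\<bar> \<le> e"
proof -
  \<comment> \<open>Since x y - 1 = (x - 1)(y - 1) + (x - 1) + (y - 1), two factors within e1 <= 1
    of 1 have a product within 3 e1 of 1.\<close>
  define e1 where "e1 = min 1 (e / 3)"
  have e1: "e1 > 0" "e1 \<le> 1" "3 * e1 \<le> e" using e by (auto simp: e1_def)
  have "((\<lambda>v::real. v powr b) \<longlongrightarrow> 1 powr b) (at 1)" by (intro tendsto_intros) auto
  then have "\<forall>\<^sub>F v::real in at 1. dist (v powr b) (1 powr b) < e1" using e1(1) by (rule tendstoD)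
  then obtain d0 where d0: "d0 > 0" "\<And>v. v \<noteq> 1 \<Longrightarrow> \<bar>v - 1\<bar> < d0 \<Longrightarrow> \<bar>v powr b - 1\<bar> < e1"
    unfolding eventually_at by (auto simp: dist_real_def)
  have d: "\<bar>v powr b - 1\<bar> \<le> e1" if "v \<in> {1..1 + d0 / 2}" for v
  proof (cases "v = 1")
    case False
    have "\<bar>v - 1\<bar> < d0" using that d0 by auto
    then show ?thesis using d0(2)[OF False] by simp
  qed (use e1 in auto)
  have *: "\<bar>x * y - 1\<bar> \<le> e" if "\<bar>x - 1\<bar> \<le> e1" "\<bar>y - 1\<bar> \<le> e1" for x y :: real
  proof -
    have "x * y - 1 = (x - 1) * (y - 1) + (x - 1) + (y - 1)" by (simp add: algebra_simps)
    also have "\<bar>\<dots>\<bar> \<le> \<bar>(x - 1) * (y - 1)\<bar> + \<bar>x - 1\<bar> + \<bar>y - 1\<bar>" by linarith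
    also have "\<bar>(x - 1) * (y - 1)\<bar> \<le> e1 * 1"
      unfolding abs_mult using that e1 by (intro mult_mono) auto
    finally show ?thesis using that e1 by linarith
  qed
  show ?thesis
  proof (rule that)
    show "d0 / 2 > 0" using d0 by simp
    have "\<forall>\<^sub>F h in at_top. \<forall>v\<in>{1..1 + d0 / 2}. \<bar>ell (h * v) / ell h - 1\<bar> \<le> e1"
      using sv d0 e1 by (intro slowly_varying_uniform) auto
    then show "\<forall>\<^sub>F h in at_top. \<forall>v\<in>{1..1 + d0 / 2}. \<bar>ell (h * v) / ell h * v powr b - 1\<bar> \<le> e"
      by eventually_elim (use * d in blast)
  qed
qed

section \<open>The class of distributions: exact tail representation and exponential scaling\<close>

locale tail_class = real_distribution nu for nu :: "real measure" +
  fixes \<beta> :: real and \<gamma> :: ereal and ell :: "real \<Rightarrow> real"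
  assumes in_class: "in_class_with \<beta> \<gamma> ell (cdf nu)"
    and exponent: "\<beta> < 1 \<or> (\<beta> = 1 \<and> \<gamma> = \<infinity>)"
begin

lemma ell_slowly_varying: "slowly_varying ell"
  and ell_tendsto: "((\<lambda>t. ereal (ell t)) \<longlongrightarrow> \<gamma>) at_top"
  and ell_lim_pos: "0 < \<gamma>"
  using in_class by (auto simp: in_class_with_def)

lemma ell_pos: "\<forall>\<^sub>F h in at_top. ell h > 0"
  using ell_slowly_varying by (simp add: slowly_varying_def)

lemma tail_eq: "tail nu x = 1 - cdf nu x"
proof -
  have "{x<..} = space nu - {..x}" by auto
  moreover have "measure nu (space nu - {..x}) = 1 - measure nu {..x}" by (rule prob_compl) auto
  ultimately show ?thesis by (simp add: cdf_def)
qed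

lemma tail_positive: "x > 0 \<Longrightarrow> tail nu x > 0"
  using in_class by (auto simp: in_class_with_def tail_eq)

definition lam :: "real \<Rightarrow> real" where
  "lam h = h powr (1 - \<beta>) * ell h"

text \<open>For beta < 1 the power of h diverges and \<open>ell\<close> stays above a positive
  constant. For beta = 1 the power is constant, so the divergence has to come from
  \<open>ell\<close>; this is why gamma is infinite in that case.\<close>

lemma lam_tendsto: "filterlim lam at_top at_top"
proof (cases "\<beta> < 1")
  case True
  obtain g where g: "0 < ereal g" "ereal g < \<gamma>"
    using ell_lim_pos ereal_dense2 by blast
  have "\<forall>\<^sub>F t in at_top. ereal g < ereal (ell t)"
    using ell_tendsto g(2) by (rule order_tendstoD)
  then have ev: "\<forall>\<^sub>F h in at_top. h powr (1 - \<beta>) * g \<le> lam h"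
    by eventually_elim (auto simp: lam_def intro!: mult_left_mono)
  have "filterlim (\<lambda>h. h powr (1 - \<beta>) * g) at_top at_top"
    using True g by real_asymp
  then show ?thesis using ev by (rule filterlim_at_top_mono)
next
  case False
  then have b: "\<beta> = 1" "\<gamma> = \<infinity>" using exponent by auto
  have "filterlim ell at_top at_top"
    using ell_tendsto b by (simp add: tendsto_PInfty filterlim_at_top_dense)
  moreover have "\<forall>\<^sub>F h in at_top. ell h = lam h"
    using eventually_gt_at_top[of 0]
  proof eventually_elim
    case (elim h)
    then have "h powr (1 - \<beta>) = 1" using b by simp
    then show ?case by (simp only: lam_def mult_1_left)
  qed
  ultimately show ?thesis using filterlim_cong[OF refl refl] by blast
qed

text \<open>Up to the factor h powr (1 - beta), this is the integrand ell t * t powr (-beta) after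
  the substitution t = h v, so the interval from h to h w becomes {1..w}.\<close>

abbreviation density :: "real \<Rightarrow> real \<Rightarrow> real" where
  "density h v \<equiv> ell (h * v) * v powr (- \<beta>)"

text \<open>Only differences of the exponent L enter the tail ratios, and the base point x0 drops
  out of them. Integrability is carried along because the integral of a nonintegrable function would
  silently be 0.\<close>

definition increments :: "(real \<Rightarrow> real) \<Rightarrow> bool" where
  "increments L \<longleftrightarrow> (\<forall>\<^sub>F h in at_top. \<forall>w\<ge>1.
     set_integrable lborel {1..w} (density h) \<and>
     L (h * w) - L h = h powr (1 - \<beta>) * (LBINT v:{1..w}. density h v))"

text \<open>Taking D x = tail(x) exp (L x) absorbs both C(x) and the asymptotic relation, so the
  representation becomes an equality for every x, and the only information left in D is its positive
  limit.\<close>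

lemma tail_representation:
  obtains K D L where "K > 0" "(D \<longlongrightarrow> K) at_top"
    "\<And>x. tail nu x = D x * exp (- L x :: real)"
    "increments L"
proof -
  obtain x0 C K where x0: "x0 \<ge> 0" and K: "0 < K" "(C \<longlongrightarrow> K) at_top"
    and int: "\<And>x. x \<ge> x0 \<Longrightarrow> set_integrable lborel {x0..x} (\<lambda>t. ell t * t powr (- \<beta>))"
    and asy: "(\<lambda>x. 1 - cdf nu x) \<sim>[at_top]
          (\<lambda>x. C x * exp (- (LBINT t:{x0..x}. ell t * t powr (- \<beta>))))"
    using in_class by (auto simp: in_class_with_def)
  define L where "L x = (LBINT t:{x0..x}. ell t * t powr (- \<beta>))" for x
  define D where "D x = tail nu x * exp (L x)" for x
  have Crat: "\<forall>\<^sub>F x in at_top. C x > 0" using K by (intro order_tendstoD)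
  have "((\<lambda>x. (1 - cdf nu x) / (C x * exp (- L x))) \<longlongrightarrow> 1) at_top"
  proof (rule asymp_equivD_strong)
    show "(\<lambda>x. 1 - cdf nu x) \<sim>[at_top] (\<lambda>x. C x * exp (- L x))" using asy by (simp add: L_def)
    show "\<forall>\<^sub>F x in at_top. 1 - cdf nu x \<noteq> 0 \<or> C x * exp (- L x) \<noteq> 0"
      using Crat by eventually_elim auto
  qed
  then have "((\<lambda>x. (1 - cdf nu x) / (C x * exp (- L x)) * C x) \<longlongrightarrow> 1 * K) at_top"
    by (intro tendsto_mult K)
  moreover have "\<forall>\<^sub>F x in at_top. (1 - cdf nu x) / (C x * exp (- L x)) * C x = D x"
    using Crat by eventually_elim (auto simp: D_def tail_eq exp_minus field_simps)
  ultimately have D: "(D \<longlongrightarrow> K) at_top"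
    by (auto elim: Lim_transform_eventually)
  show ?thesis
  proof (rule that[OF K(1) D])
    show "tail nu x = D x * exp (- L x)" for x by (simp add: D_def exp_minus)
    show "increments L" unfolding increments_def
      using eventually_ge_at_top[of "max x0 1"]
    proof (eventually_elim, intro allI impI)
      fix h w :: real assume h: "h \<ge> max x0 1" and w: "w \<ge> 1"
      define f where "f t = ell t * t powr (- \<beta>)" for t
      have hw: "h \<le> h * w" "h > 0" "x0 \<le> h" using h w by auto
      have i: "set_integrable lborel {x0..h * w} f"
        using int[of "h * w"] order_trans[OF hw(3,1)] by (simp add: f_def[abs_def])
      have i1: "set_integrable lborel {x0..h} f" and i2: "set_integrable lborel {h<..h * w} f"
        and i3: "set_integrable lborel {h..h * w} f"
        using hw by (auto intro!: set_integrable_subset[OF i] intro: order_trans[OF _ hw(1)] order_trans[OF hw(3)])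
      have "{x0..h * w} = {x0..h} \<union> {h<..h * w}"
        using ivl_disj_un_two(8)[OF hw(3,1)] by simp
      then have "L (h * w) = L h + (LBINT t:{h<..h * w}. f t)"
        unfolding L_def f_def[symmetric] using i1 i2 by (subst set_integral_Un[symmetric]) auto
      also have "(LBINT t:{h<..h * w}. f t) = (LBINT t:{h..h * w}. f t)"
        unfolding set_lebesgue_integral_def using AE_lborel_singleton[of h] i2 i3
        by (intro integral_cong_AE) (auto simp: set_integrable_def indicator_def dest!: borel_measurable_integrable elim!: eventually_mono)
      \<comment> \<open>Substitution t = h v: the Jacobian h and the factor h powr (-beta) combine
        to h powr (1 - beta).\<close>
      also have "\<dots> = h * (\<integral>v. indicator {h..h * w} (0 + h * v) *\<^sub>R f (0 + h * v) \<partial>lborel)"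
        unfolding set_lebesgue_integral_def using hw by (subst lborel_integral_real_affine[of h _ 0]) auto
      also have "(\<lambda>v. indicator {h..h * w} (0 + h * v) *\<^sub>R f (0 + h * v)) =
          (\<lambda>v. h powr (- \<beta>) * (indicator {1..w} v *\<^sub>R (density h v)))"
        using hw by (auto simp: fun_eq_iff indicator_def f_def powr_mult)
      also have "h * (\<integral>v. h powr (- \<beta>) * (indicator {1..w} v *\<^sub>R (density h v)) \<partial>lborel) =
          h powr (1 - \<beta>) * (LBINT v:{1..w}. density h v)"
        using powr_mult_base[of h "- \<beta>"] hw
        by (simp only: set_lebesgue_integral_def integral_mult_right_zero mult.assoc[symmetric])
          simp
      finally have eq: "L (h * w) - L h = h powr (1 - \<beta>) * (LBINT v:{1..w}. density h v)"
        by simp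
      have "integrable lborel (\<lambda>v. inverse (h powr (- \<beta>)) * (indicator {h..h * w} (0 + h * v) *\<^sub>R f (0 + h * v)))"
        using i3 hw unfolding set_integrable_def
        by (intro integrable_mult_right lborel_integrable_real_affine) auto
      also have "(\<lambda>v. inverse (h powr (- \<beta>)) * (indicator {h..h * w} (0 + h * v) *\<^sub>R f (0 + h * v))) =
          (\<lambda>v. indicator {1..w} v *\<^sub>R (density h v))"
        using hw by (auto simp: fun_eq_iff indicator_def f_def powr_mult)
      finally show "set_integrable lborel {1..w} (density h) \<and>
       L (h * w) - L h = h powr (1 - \<beta>) * (LBINT v:{1..w}. density h v)"
        using eq by (simp add: set_integrable_def)
    qed
  qed
qed

text \<open>For a fixed factor W the quotient D (h W) / D h tends to 1, while the exponent survives
  in full; it becomes the exponential factor of the relative error. Factors that tend to 1 are the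
  subject of \<open>laplace_tail_lam\<close>.\<close>

lemma tail_ratio_asymp:
  assumes "W \<ge> 1"
  shows "((\<lambda>h. tail nu (h * W) / tail nu h /
    exp (- (h powr (1 - \<beta>) * (LBINT v:{1..W}. density h v)))) \<longlongrightarrow> 1) at_top"
proof -
  obtain K D L where K: "K > 0" "(D \<longlongrightarrow> K) at_top"
    and rep: "\<And>x. tail nu x = D x * exp (- L x :: real)"
    and "increments L"
    by (rule tail_representation) blast
  note inc = this(4)[unfolded increments_def]
  have "filterlim (\<lambda>h. h * W) at_top at_top" using assms by real_asymp
  then have "((\<lambda>h. D (h * W)) \<longlongrightarrow> K) at_top" by (rule filterlim_compose[OF K(2)])
  then have "((\<lambda>h. D (h * W) / D h) \<longlongrightarrow> K / K) at_top"
    using K by (intro tendsto_divide) auto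
  moreover have "\<forall>\<^sub>F h in at_top. D (h * W) / D h = tail nu (h * W) / tail nu h /
    exp (- (h powr (1 - \<beta>) * (LBINT v:{1..W}. density h v)))"
    using inc
  proof eventually_elim
    case (elim h)
    have "tail nu (h * W) / tail nu h / exp (- (L (h * W) - L h)) = D (h * W) / D h"
      by (simp add: rep exp_diff exp_minus field_simps)
    then show ?case using elim assms by auto
  qed
  ultimately show ?thesis using K by (auto elim: Lim_transform_eventually)
qed

text \<open>For w = 1 / (1 - s) the exponent grows by about lam(h) (w - 1) when w is near 1. If s =
  t / lam h, then lam(h) (w - 1) = t w, which tends to t and gives the limit exp (-t). The uniform
  bound uses a lower bound for the rescaled integrand on {1..2} when s <= 1/2, and monotonicity of
  the tail for larger s.\<close>

lemma laplace_tail_lam: "\<exists>c. laplace_tail nu lam 2 c"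
proof -
  have const: "(LBINT v:{1..w}. k) = (w - 1) * k" if "1 \<le> w" for w k :: real
    using that by (simp add: set_lebesgue_integral_def)
  have const_int: "set_integrable lborel {1..w} (\<lambda>v. k)" for w k :: real
    unfolding set_integrable_def real_scaleR_def
    by (intro integrable_mult_left integrable_real_indicator) (auto simp: emeasure_lborel_Icc_eq)
  obtain K D L where K: "K > 0" "(D \<longlongrightarrow> K) at_top"
    and rep: "\<And>x. tail nu x = D x * exp (- L x :: real)"
    and "increments L"
    by (rule tail_representation) blast
  note inc = this(4)[unfolded increments_def]
  have ratio: "tail nu y / tail nu x = D y / D x * exp (- (L y - L x))" for x y
    by (simp add: rep exp_diff exp_minus field_simps)
  \<comment> \<open>2 m is the minimum of v powr (-beta) over {1..2}. Together with ell (h v) >= ell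
    h / 2 it bounds the integrand from below by m ell h.\<close>
  define m where "m = min 1 (2 powr (- \<beta>)) / 2"
  have m: "m > 0" by (simp add: m_def)
  have mv: "2 * m \<le> v powr (- \<beta>)" if "v \<in> {1..2}" for v :: real
  proof (cases "\<beta> \<ge> 0")
    case True
    then have "2 powr (- \<beta>) \<le> v powr (- \<beta>)" using that by (intro powr_mono2') auto
    then show ?thesis by (simp add: m_def)
  next
    case False
    then have "1 \<le> v powr (- \<beta>)" using that by (intro ge_one_powr_ge_zero) auto
    then show ?thesis by (simp add: m_def)
  qed
  have uni: "\<forall>\<^sub>F h in at_top. \<forall>v\<in>{1..2}. \<bar>ell (h * v) / ell h - 1\<bar> \<le> 1 / 2"
    by (intro slowly_varying_uniform ell_slowly_varying) auto
  \<comment> \<open>These margins around K bound every quotient of late values of D by 2, the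
    constant supplied to the locale.\<close>
  have "\<forall>\<^sub>F x in at_top. D x > 2 * K / 3" "\<forall>\<^sub>F x in at_top. D x < 4 * K / 3"
    using K by (auto intro!: order_tendstoD[OF K(2)] simp del: less_divide_eq_numeral1 divide_less_eq_numeral1)
  then have "\<forall>\<^sub>F x in at_top. D x > 2 * K / 3 \<and> D x < 4 * K / 3" by eventually_elim auto
  then obtain X where X: "\<And>x. x \<ge> X \<Longrightarrow> D x > 2 * K / 3 \<and> D x < 4 * K / 3"
    by (auto simp: eventually_at_top_linorder)
  have lpos: "\<forall>\<^sub>F h in at_top. lam h > 0" using lam_tendsto by (simp add: filterlim_at_top_dense)
  have bound: "\<forall>\<^sub>F h in at_top. \<forall>s\<in>{0..<1}.
      tail nu (h / (1 - s)) \<le> 2 * exp (- (m / 2) * lam h * s) * tail nu h"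
    using inc uni ell_pos lpos eventually_gt_at_top[of "max 0 X"]
  proof eventually_elim
    case (elim h)
    have h: "h > 0" "h > X" using elim by auto
    have half: "tail nu (h / (1 - s)) \<le> 2 * exp (- m * lam h * s) * tail nu h"
      if s: "0 \<le> s" "s \<le> 1 / 2" for s
    proof -
      define w where "w = 1 / (1 - s)"
      have w: "1 \<le> w" "w \<le> 2" "s \<le> w - 1" using s by (auto simp: w_def field_simps)
      have "(w - 1) * (ell h * m) = (LBINT v:{1..w}. ell h * m)"
        using w by (simp only: const)
      also have "\<dots> \<le> (LBINT v:{1..w}. density h v)"
      proof (rule set_integral_mono)
        show "set_integrable lborel {1..w} (density h)" using elim w by auto
        fix v assume v: "v \<in> {1..w}"
        then have "\<bar>ell (h * v) / ell h - 1\<bar> \<le> 1 / 2" using elim(2) w by auto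
        then have "ell (h * v) / ell h \<ge> 1 / 2" by linarith
        then have "ell h / 2 \<le> ell (h * v)" using elim by (simp add: field_simps)
        then have "ell h / 2 * (2 * m) \<le> density h v"
          using elim mv[of v] v w m by (intro mult_mono) auto
        then show "ell h * m \<le> density h v" by simp
      qed (rule const_int)
      finally have "h powr (1 - \<beta>) * ((w - 1) * (ell h * m)) \<le> L (h * w) - L h"
        using elim w by (auto intro!: mult_left_mono)
      then have "m * lam h * (w - 1) \<le> L (h * w) - L h" by (simp add: lam_def mult_ac)
      moreover have "m * lam h * s \<le> m * lam h * (w - 1)"
        using m elim w by (intro mult_left_mono) auto
      ultimately have "exp (- (L (h * w) - L h)) \<le> exp (- m * lam h * s)" by simp
      moreover have "D (h * w) / D h \<le> 2"
      proof -
        have "h * 1 \<le> h * w" using h w by (intro mult_left_mono) auto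
        then have "h * w \<ge> X" using h by linarith
        then have "D (h * w) \<le> 2 * D h" "D h > 0" using X[of h] X[of "h * w"] h K by auto
        then show ?thesis by (simp add: field_simps)
      qed
      ultimately have "D (h * w) / D h * exp (- (L (h * w) - L h)) \<le> 2 * exp (- m * lam h * s)"
        by (intro mult_mono) auto
      then have "tail nu (h * w) / tail nu h \<le> 2 * exp (- m * lam h * s)"
        by (simp only: ratio)
      then show ?thesis using tail_positive[OF h(1)] by (simp add: pos_divide_le_eq w_def)
    qed
    have "tail nu (h / (1 - s)) \<le> 2 * exp (- (m / 2) * lam h * s) * tail nu h"
      if s: "0 \<le> s" "s < 1" for s
    proof (cases "s \<le> 1 / 2")
      case True
      have "tail nu (h / (1 - s)) \<le> 2 * exp (- m * lam h * s) * tail nu h"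
        using half[of s] True s by auto
      also have "\<dots> \<le> 2 * exp (- (m / 2) * lam h * s) * tail nu h"
        using m elim s by (intro mult_right_mono mult_left_mono) (auto intro!: mult_right_mono)
      finally show ?thesis .
    next
      \<comment> \<open>For s > 1/2 the tail is compared with its value at 1/2. As s / 2 <= 1/2,
        passing from rate m to m / 2 pays for the difference.\<close>
      case False
      have "h / (1 - 1 / 2) \<le> h / (1 - s)" using False s h by (intro divide_left_mono) auto
      then have "tail nu (h / (1 - s)) \<le> tail nu (h / (1 - 1 / 2))"
        by (intro finite_measure_mono) auto
      also have "\<dots> \<le> 2 * exp (- m * lam h * (1 / 2)) * tail nu h"
        by (rule half) auto
      also have "\<dots> \<le> 2 * exp (- (m / 2) * lam h * s) * tail nu h"
        using m elim s by (intro mult_right_mono mult_left_mono) (auto intro!: mult_left_le)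
      finally show ?thesis .
    qed
    then show ?case by auto
  qed
  have lim: "((\<lambda>h. tail nu (h / (1 - t / lam h)) / tail nu h) \<longlongrightarrow> exp (- t)) at_top"
    if t: "t > 0" for t
  proof -
    define w where "w h = 1 / (1 - t / lam h)" for h
    have tl: "((\<lambda>h. t / lam h) \<longlongrightarrow> 0) at_top"
      by (intro tendsto_divide_0[OF tendsto_const] filterlim_at_top_imp_at_infinity lam_tendsto)
    then have "(w \<longlongrightarrow> 1 / (1 - 0)) at_top" unfolding w_def[abs_def] by (intro tendsto_intros) auto
    then have wlim: "(w \<longlongrightarrow> 1) at_top" by simp
    have ltop: "\<forall>\<^sub>F h in at_top. lam h > t" using lam_tendsto by (simp add: filterlim_at_top_dense)
    have w1: "\<forall>\<^sub>F h in at_top. w h \<ge> 1 \<and> lam h * (w h - 1) = t * w h"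
      using ltop by eventually_elim (use t in \<open>auto simp: w_def field_simps\<close>)
    have lw: "((\<lambda>h. t * w h) \<longlongrightarrow> t) at_top" using tendsto_mult[OF tendsto_const wlim, of t] by simp
    have "((\<lambda>h. (L (h * w h) - L h) - t * w h) \<longlongrightarrow> 0) at_top"
    proof (rule tendstoI)
      fix e :: real assume e: "e > 0"
      \<comment> \<open>The deviation below is at most t w e', and t w < t + 1 eventually, so it is
        enough that (t + 1) e' = e / 2.\<close>
      define e' where "e' = (e / 2) / (t + 1)"
      have "e' * (t + 1) = e / 2" by (rule nonzero_eq_divide_eq[THEN iffD1, OF _ e'_def]) (use t in auto)
      then have e': "e' > 0" "e' * (t + 1) < e" using e t by (auto simp: e'_def)
      obtain d where d: "d > 0" and
        dd: "\<forall>\<^sub>F h in at_top. \<forall>v\<in>{1..1 + d}. \<bar>ell (h * v) / ell h * v powr (- \<beta>) - 1\<bar> \<le> e'"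
        using slowly_varying_powr_uniform[OF ell_slowly_varying e'(1)] .
      have wd: "\<forall>\<^sub>F h in at_top. w h < 1 + d" using wlim d by (intro order_tendstoD) auto
      have wt: "\<forall>\<^sub>F h in at_top. t * w h < t + 1" using lw by (intro order_tendstoD) auto
      show "\<forall>\<^sub>F h in at_top. dist (L (h * w h) - L h - t * w h) 0 < e"
        using inc dd wd wt w1 ell_pos lpos eventually_gt_at_top[of 0]
      proof eventually_elim
        case (elim h)
        let ?f = "\<lambda>v. density h v"
        have w: "1 \<le> w h" using elim by auto
        have f: "set_integrable lborel {1..w h} ?f" using elim w by auto
        have ptw: "ell h * (1 - e') \<le> ?f v \<and> ?f v \<le> ell h * (1 + e')" if "v \<in> {1..w h}" for v
        proof -
          have "\<bar>ell (h * v) / ell h * v powr (- \<beta>) - 1\<bar> \<le> e'" using elim that by auto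
          then have "1 - e' \<le> ?f v / ell h" "?f v / ell h \<le> 1 + e'" by auto
          then show ?thesis using elim by (auto simp: field_simps)
        qed
        have "(LBINT v:{1..w h}. ell h * (1 - e')) \<le> (LBINT v:{1..w h}. ?f v)"
          by (intro set_integral_mono f const_int) (use ptw in auto)
        moreover have "(LBINT v:{1..w h}. ?f v) \<le> (LBINT v:{1..w h}. ell h * (1 + e'))"
          by (intro set_integral_mono f const_int) (use ptw in auto)
        ultimately have "(w h - 1) * (ell h * (1 - e')) \<le> (LBINT v:{1..w h}. ?f v)"
            "(LBINT v:{1..w h}. ?f v) \<le> (w h - 1) * (ell h * (1 + e'))"
          using w by (simp_all only: const)
        then have "h powr (1 - \<beta>) * ((w h - 1) * (ell h * (1 - e'))) \<le> L (h * w h) - L h"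
            "L (h * w h) - L h \<le> h powr (1 - \<beta>) * ((w h - 1) * (ell h * (1 + e')))"
          using elim w by (auto intro!: mult_left_mono)
        moreover have "h powr (1 - \<beta>) * ((w h - 1) * (ell h * y)) = t * w h * y" for y
        proof -
          have "h powr (1 - \<beta>) * ((w h - 1) * (ell h * y)) = lam h * (w h - 1) * y"
            by (simp add: lam_def)
          then show ?thesis using elim by simp
        qed
        ultimately have "t * w h * (1 - e') \<le> L (h * w h) - L h" "L (h * w h) - L h \<le> t * w h * (1 + e')"
          by simp_all
        then have "\<bar>L (h * w h) - L h - t * w h\<bar> \<le> t * w h * e'"
          by (simp add: abs_le_iff algebra_simps)
        also have "\<dots> \<le> (t + 1) * e'" using elim e' by (intro mult_right_mono) auto
        also have "\<dots> < e" using e' by (simp add: mult.commute)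
        finally show ?case by (simp add: dist_real_def)
      qed
    qed
    from tendsto_add[OF this lw] have Llim: "((\<lambda>h. L (h * w h) - L h) \<longlongrightarrow> t) at_top" by simp
    have hw: "filterlim (\<lambda>h. h * w h) at_top at_top"
      by (rule filterlim_at_top_mult_tendsto_pos[OF wlim _ filterlim_ident]) simp
    have "((\<lambda>h. D (h * w h) / D h * exp (- (L (h * w h) - L h))) \<longlongrightarrow> K / K * exp (- t)) at_top"
      using K by (intro tendsto_intros Llim filterlim_compose[OF K(2) hw]) auto
    then have "((\<lambda>h. tail nu (h * w h) / tail nu h) \<longlongrightarrow> exp (- t)) at_top"
      unfolding ratio using K by simp
    then show ?thesis by (simp add: w_def)
  qed
  have "laplace_tail nu lam 2 (m / 2)"
    using m bound lim tail_positive lam_tendsto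
    by unfold_locales auto
  then show ?thesis ..
qed

end

section \<open>Lebesgue measure of cones and the uniform distribution on the sphere\<close>

lemma nn_integral_lborel_translate:
  fixes f :: "'a::euclidean_space \<Rightarrow> ennreal"
  assumes [measurable]: "f \<in> borel_measurable borel"
  shows "(\<integral>\<^sup>+x. f (c + x) \<partial>lborel) = (\<integral>\<^sup>+x. f x \<partial>lborel)"
  by (subst (2) lborel_distr_plus[symmetric, of c]) (simp add: nn_integral_distr)

lemma nn_integral_lborel_reflect:
  fixes f :: "'a::euclidean_space \<Rightarrow> ennreal"
  assumes [measurable]: "f \<in> borel_measurable borel"
  shows "(\<integral>\<^sup>+x. f (c - x) \<partial>lborel) = (\<integral>\<^sup>+x. f x \<partial>lborel)"
  by (subst (2) lborel_affine[of "-1" c]) (simp_all add: nn_integral_distr nn_integral_density)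

lemma orthogonal_transformation_measurable [measurable_dest]:
  fixes f :: "'a::euclidean_space \<Rightarrow> 'a"
  assumes "orthogonal_transformation f"
  shows "f \<in> borel_measurable borel"
  using assms by (intro borel_measurable_continuous_onI linear_continuous_on
    linear_conv_bounded_linear[THEN iffD1] orthogonal_transformation_linear)

text \<open>The uniqueness argument for Haar measure: both sides of
  \<open>vol (f\<inverse> A) vol B = vol A vol (f\<inverse> B)\<close> are double integrals that agree by translations,
  and for \<open>B\<close> the unit ball \<open>vol (f\<inverse> B) = vol B\<close>.\<close>

lemma lborel_distr_orthogonal:
  fixes f :: "'a::euclidean_space \<Rightarrow> 'a"
  assumes f: "orthogonal_transformation f"
  shows "distr lborel borel f = lborel"
proof (rule measure_eqI)
  note [measurable] = orthogonal_transformation_measurable[OF f]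
  have add: "f (x + y) = f x + f y" for x y
    using f by (simp add: orthogonal_transformation_def linear_add)
  have surj: "surj f" using f by (rule orthogonal_transformation_surj)
  fix A :: "'a set"
  assume "A \<in> sets (distr lborel borel f)"
  then have A [measurable]: "A \<in> sets borel" by simp
  define B where "B = ball (0::'a) 1"
  have [measurable]: "B \<in> sets borel" by (simp add: B_def)
  let ?A = "indicator A :: 'a \<Rightarrow> ennreal"
  let ?I = "indicator B :: 'a \<Rightarrow> ennreal"
  have "emeasure lborel (f -` A) * emeasure lborel B = (\<integral>\<^sup>+x. ?A (f x) * emeasure lborel B \<partial>lborel)"
  proof -
    have "emeasure lborel (f -` A) = (\<integral>\<^sup>+x. ?A (f x) \<partial>lborel)"
      using measurable_sets[of f borel borel A] by (simp add: indicator_vimage[symmetric] del: indicator_simps nn_integral_indicator_singleton)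
    then show ?thesis by (simp add: nn_integral_multc)
  qed
  also have "\<dots> = (\<integral>\<^sup>+x. ?A (f x) * (\<integral>\<^sup>+y. ?I (f x + y) \<partial>lborel) \<partial>lborel)"
    by (subst nn_integral_lborel_translate) auto
  also have "\<dots> = (\<integral>\<^sup>+x. \<integral>\<^sup>+y. ?A (f x) * ?I (f x + y) \<partial>lborel \<partial>lborel)"
    by (subst nn_integral_cmult) auto
  also have "\<dots> = (\<integral>\<^sup>+y. \<integral>\<^sup>+x. ?A (f x) * ?I (f x + y) \<partial>lborel \<partial>lborel)"
    by (rule lborel_pair.Fubini'[symmetric]) measurable
  \<comment> \<open>Replacing x by z + x, where f z = y, moves the translation by y from the second
    factor to the first; surjectivity of f supplies z.\<close>
  also have "\<dots> = (\<integral>\<^sup>+y. \<integral>\<^sup>+x. ?A (f x - y) * ?I (f x) \<partial>lborel \<partial>lborel)"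
  proof (rule nn_integral_cong)
    fix y
    obtain z where z: "y = f z" using surj by (metis surjD)
    have "(\<integral>\<^sup>+x. ?A (f x - y) * ?I (f x) \<partial>lborel) = (\<integral>\<^sup>+x. ?A (f (z + x) - y) * ?I (f (z + x)) \<partial>lborel)"
      by (rule nn_integral_lborel_translate[symmetric]) measurable
    then show "(\<integral>\<^sup>+x. ?A (f x) * ?I (f x + y) \<partial>lborel) = (\<integral>\<^sup>+x. ?A (f x - y) * ?I (f x) \<partial>lborel)"
      by (simp add: add z add.commute)
  qed
  also have "\<dots> = (\<integral>\<^sup>+x. \<integral>\<^sup>+y. ?A (f x - y) * ?I (f x) \<partial>lborel \<partial>lborel)"
    by (rule lborel_pair.Fubini') measurable
  also have "\<dots> = (\<integral>\<^sup>+x. (\<integral>\<^sup>+y. ?A (f x - y) \<partial>lborel) * ?I (f x) \<partial>lborel)"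
    by (subst nn_integral_multc) auto
  \<comment> \<open>By reflection and translation the inner integral is the volume of A for every x,
    and f x lies in the unit ball exactly when x does, because f preserves norms.\<close>
  also have "\<dots> = (\<integral>\<^sup>+x. emeasure lborel A * ?I x \<partial>lborel)"
    by (subst nn_integral_lborel_reflect)
      (auto simp: indicator_def B_def orthogonal_transformation_norm[OF f] intro!: nn_integral_cong)
  also have "\<dots> = emeasure lborel A * emeasure lborel B"
    by (simp add: nn_integral_cmult)
  finally have "emeasure lborel (f -` A) * emeasure lborel B / emeasure lborel B =
      emeasure lborel A * emeasure lborel B / emeasure lborel B" by simp
  then have "emeasure lborel (f -` A) = emeasure lborel A"
    using emeasure_unit_ball_lborel[where 'a='a] by (simp add: mult_divide_eq_ennreal B_def)
  then show "emeasure (distr lborel borel f) A = emeasure lborel A"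
    by (simp add: emeasure_distr)
qed simp

text \<open>Reflection in the hyperplane orthogonal to a - b: for unit vectors twice the inner
  product of a with a - b equals |a - b|^2, so a goes to b. The last clause records the fixed
  hyperplane, which allows a further reflection without moving a vector already in place.\<close>

lemma exists_reflection:
  fixes a b :: "'a::euclidean_space"
  assumes "norm a = 1" "norm b = 1"
  shows "\<exists>f. orthogonal_transformation f \<and> f a = b \<and> (\<forall>x. x \<bullet> (a - b) = 0 \<longrightarrow> f x = x)"
proof (cases "a = b")
  case True
  then show ?thesis by (intro exI[of _ "\<lambda>x. x"]) auto
next
  case False
  define d where "d = a - b"
  have d: "d \<bullet> d \<noteq> 0" using False by (simp add: d_def)
  define f where "f x = x - (2 * (x \<bullet> d) / (d \<bullet> d)) *\<^sub>R d" for x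
  have "orthogonal_transformation f"
    unfolding orthogonal_transformation_def
  proof (intro conjI allI)
    show "linear f"
      by (rule linearI) (simp_all add: f_def inner_add_left algebra_simps add_divide_distrib)
    show "f v \<bullet> f w = v \<bullet> w" for v w
    proof -
      define p q r where "p = v \<bullet> d" and "q = w \<bullet> d" and "r = d \<bullet> d"
      have "f v \<bullet> f w = v \<bullet> w - (2 * q / r) * p - (2 * p / r) * q + (2 * p / r) * (2 * q / r) * r"
        by (simp add: f_def inner_diff_left inner_diff_right p_def q_def r_def inner_commute)
      also have "\<dots> = v \<bullet> w" using d unfolding r_def[symmetric] by (simp add: field_simps)
      finally show ?thesis .
    qed
  qed
  moreover have "f a = b"
  proof -
    have aa: "a \<bullet> a = 1" "b \<bullet> b = 1" using assms by (simp_all add: norm_eq_1)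
    have "2 * (a \<bullet> d) = d \<bullet> d"
      using aa by (simp add: d_def inner_diff_left inner_diff_right inner_commute)
    then have "2 * (a \<bullet> d) / (d \<bullet> d) = 1" using d by (metis right_inverse_eq)
    then have "f a = a - 1 *\<^sub>R d" unfolding f_def by (simp only:)
    then show ?thesis by (simp add: d_def)
  qed
  ultimately show ?thesis by (intro exI[of _ f]) (auto simp: f_def d_def)
qed

text \<open>Once b1 has been sent to m, a second reflection takes the image of b2 to w. Both of
  these are orthogonal to m, so m lies in the fixed hyperplane.\<close>

lemma orthogonal_frame:
  fixes m w b1 b2 :: "'a::euclidean_space"
  assumes "norm m = 1" "norm w = 1" "m \<bullet> w = 0" "norm b1 = 1" "norm b2 = 1" "b1 \<bullet> b2 = 0"
  obtains f where "orthogonal_transformation f" "f b1 = m" "f b2 = w"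
proof -
  obtain f where f: "orthogonal_transformation f" "f b1 = m"
    using exists_reflection assms by blast
  have "norm (f b2) = 1" using orthogonal_transformation_norm[OF f(1)] assms by simp
  then obtain g where g: "orthogonal_transformation g" "g (f b2) = w"
    "\<And>x. x \<bullet> (f b2 - w) = 0 \<Longrightarrow> g x = x"
    using exists_reflection assms(2) by blast
  have "m \<bullet> f b2 = b1 \<bullet> b2" using f unfolding orthogonal_transformation_def by metis
  then have "m \<bullet> (f b2 - w) = 0" using f assms by (simp add: inner_diff_right)
  then have "g m = m" by (rule g)
  then show ?thesis
    using that[of "g \<circ> f"] f g orthogonal_transformation_compose[OF g(1) f(1)] by auto
qed

text \<open>A cone contains an open ray from the origin entirely or not at all, so normalising x
  does not change membership away from 0, and the push-forward becomes a share of the unit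
  ball.\<close>

lemma measure_sphere_uniform_cone:
  fixes E :: "'a::euclidean_space set"
  assumes [measurable]: "E \<in> sets borel"
    and cone: "\<And>t x. t > 0 \<Longrightarrow> t *\<^sub>R x \<in> E \<longleftrightarrow> x \<in> E"
  shows "measure sphere_uniform E = measure lborel (ball 0 1 \<inter> E) / unit_ball_vol (DIM('a))"
proof -
  let ?s = "\<lambda>x::'a. x /\<^sub>R norm x"
  have s: "?s -` E \<in> sets borel"
    by (rule measurable_sets_borel) measurable
  have "measure sphere_uniform E = measure (uniform_measure lborel (ball 0 1)) (?s -` E)"
    unfolding sphere_uniform_def by (simp add: measure_distr)
  also have "\<dots> = measure lborel (ball 0 1 \<inter> ?s -` E) / measure lborel (ball (0::'a) 1)"
    using s emeasure_unit_ball_lborel[where 'a='a] by (subst measure_uniform_measure) auto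
  also have "measure lborel (ball 0 1 \<inter> ?s -` E) = measure lborel (ball 0 1 \<inter> E)"
    unfolding measure_def
  proof (rule arg_cong[OF emeasure_eq_AE])
    have "AE x in lborel. x \<noteq> (0::'a)" by (rule AE_lborel_singleton)
    then show "AE x in lborel. x \<in> ball 0 1 \<inter> ?s -` E \<longleftrightarrow> x \<in> ball 0 1 \<inter> E"
      by eventually_elim (use cone in auto)
  qed (use s in auto)
  also have "measure lborel (ball (0::'a) 1) = unit_ball_vol (DIM('a))"
    using content_ball[of 1 "0::'a"] by simp
  finally show ?thesis .
qed

lemma emeasure_lborel_scale:
  fixes S :: "'a::euclidean_space set"
  assumes [measurable]: "S \<in> sets borel" and t: "t > 0"
  shows "emeasure lborel ((\<lambda>x. t *\<^sub>R x) -` S) * ennreal (t ^ DIM('a)) = emeasure lborel S"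
proof -
  have "emeasure lborel S = (\<integral>\<^sup>+x. indicator S x \<partial>lborel)" by simp
  also have "\<dots> = (\<integral>\<^sup>+x. ennreal (t ^ DIM('a)) * indicator ((\<lambda>x. t *\<^sub>R x) -` S) x \<partial>lborel)"
    using t by (subst lborel_affine[of t 0])
      (auto simp: emeasure_density nn_integral_density nn_integral_distr indicator_def intro!: nn_integral_cong)
  also have "\<dots> = ennreal (t ^ DIM('a)) * emeasure lborel ((\<lambda>x. t *\<^sub>R x) -` S)"
    by (subst nn_integral_cmult_indicator) (use measurable_sets[of "\<lambda>x::'a. t *\<^sub>R x" borel borel S] in auto)
  finally show ?thesis by (simp add: mult.commute)
qed

text \<open>Replacing the unit ball by the slab \<open>0 < x \<bullet> m < 1\<close> makes the volume of a narrow cone around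
  \<open>m\<close> an iterated integral over sections that scale linearly.\<close>

lemma measure_sphere_uniform_narrow_cone:
  fixes E :: "'a::euclidean_space set" and m :: 'a
  assumes E [measurable]: "E \<in> sets borel"
    and cone: "\<And>t x. t > 0 \<Longrightarrow> t *\<^sub>R x \<in> E \<longleftrightarrow> x \<in> E"
    and m: "norm m = 1" and tau: "0 < \<tau>" "\<tau> \<le> 1"
    and narrow: "\<And>x. x \<in> E \<Longrightarrow> x \<bullet> m \<ge> \<tau> * norm x"
    and V: "emeasure lborel {x \<in> E. 0 < x \<bullet> m \<and> x \<bullet> m < 1} = ennreal V" "V \<ge> 0"
  shows "measure sphere_uniform E \<le> V / unit_ball_vol (DIM('a))"
    "measure sphere_uniform E \<ge> \<tau> ^ DIM('a) * V / unit_ball_vol (DIM('a))"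
proof -
  let ?S = "{x \<in> E. 0 < x \<bullet> m \<and> x \<bullet> m < 1}" and ?T = "{x \<in> E. 0 < x \<bullet> m \<and> x \<bullet> m < \<tau>}"
  have Sm [measurable]: "?S \<in> sets borel" "?T \<in> sets borel" by measurable
  have fin: "emeasure lborel (ball 0 1 \<inter> E) \<noteq> \<infinity>"
    using emeasure_mono[of "ball 0 1 \<inter> E" "ball 0 1" lborel] emeasure_unit_ball_lborel(2)[where 'a='a]
    by (auto simp: top_unique)
  \<comment> \<open>For x in the ball and in E, tau |x| <= <x,m> <= |x| < 1; apart from the origin
    all such points lie in the slab.\<close>
  have "emeasure lborel (ball 0 1 \<inter> E) \<le> emeasure lborel (?S \<union> {0})"
  proof (rule emeasure_mono)
    show "ball 0 1 \<inter> E \<subseteq> ?S \<union> {0}"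
    proof
      fix x assume x: "x \<in> ball 0 1 \<inter> E"
      have "x \<bullet> m \<le> norm x" using norm_cauchy_schwarz[of x m] m by simp
      moreover have "x = 0 \<or> 0 < \<tau> * norm x" using tau(1) by (cases "x = 0") simp_all
      moreover have "\<tau> * norm x \<le> x \<bullet> m" "norm x < 1" using x narrow by auto
      ultimately have "x = 0 \<or> 0 < x \<bullet> m \<and> x \<bullet> m < 1" by linarith
      then show "x \<in> ?S \<union> {0}" using x by auto
    qed
  qed measurable
  also have "\<dots> \<le> emeasure lborel ?S + emeasure lborel {0::'a}"
    by (rule emeasure_subadditive) auto
  finally have "emeasure lborel (ball 0 1 \<inter> E) \<le> ennreal V" using V by simp
  then have "measure lborel (ball 0 1 \<inter> E) \<le> V"
    using fin V by (simp add: emeasure_eq_ennreal_measure)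
  then show "measure sphere_uniform E \<le> V / unit_ball_vol (DIM('a))"
    by (subst measure_sphere_uniform_cone[OF E cone]) (auto intro!: divide_right_mono)
  \<comment> \<open>For the lower bound the part of the cone below height tau fits into the ball. It
    is the dilate by tau of the part below height 1, so its volume is smaller by tau^n.\<close>
  have "(\<lambda>x. \<tau> *\<^sub>R x) -` ?T = ?S" using tau cone by (auto simp: zero_less_mult_iff)
  then have "emeasure lborel ?T = ennreal (V * \<tau> ^ DIM('a))"
    using emeasure_lborel_scale[of ?T \<tau>] tau V by (simp add: ennreal_mult')
  moreover have "emeasure lborel ?T \<le> emeasure lborel (ball 0 1 \<inter> E)"
  proof (rule emeasure_mono)
    show "?T \<subseteq> ball 0 1 \<inter> E"
    proof
      fix x assume x: "x \<in> ?T"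
      then have "\<tau> * norm x \<le> x \<bullet> m" "x \<bullet> m < \<tau>" using narrow by auto
      then have "\<tau> * norm x < \<tau> * 1" by linarith
      then have "norm x < 1" using mult_less_cancel_left_pos[OF tau(1), of "norm x" 1] by blast
      then show "x \<in> ball 0 1 \<inter> E" using x by simp
    qed
  qed measurable
  ultimately have "V * \<tau> ^ DIM('a) \<le> measure lborel (ball 0 1 \<inter> E)"
    using fin V by (simp add: emeasure_eq_ennreal_measure)
  then show "measure sphere_uniform E \<ge> \<tau> ^ DIM('a) * V / unit_ball_vol (DIM('a))"
    by (subst measure_sphere_uniform_cone[OF E cone]) (auto intro!: divide_right_mono simp: mult.commute)
qed

text \<open>Radius 0 is included because sections of the lens degenerate to points on its boundary.
  There the value follows by comparison with small balls, except for an empty index set, where 0 ^ 0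
  = 1 accounts for the single point of the empty product.\<close>

lemma emeasure_PiM_cball:
  assumes "finite A" "r \<ge> 0"
  shows "emeasure (Pi\<^sub>M A (\<lambda>_. lborel))
             {f \<in> space (Pi\<^sub>M A (\<lambda>_. lborel)). sqrt (\<Sum>i\<in>A. (f i)\<^sup>2) \<le> r} =
             ennreal (unit_ball_vol (real (card A)) * r ^ card A)" (is "emeasure ?M (?S r) = _")
proof (cases "r > 0")
  case True
  have "?S r = {f. sqrt (\<Sum>i\<in>A. (f i)\<^sup>2) \<le> r} \<inter> space ?M" by auto
  then show ?thesis using emeasure_cball_aux[OF assms(1) True] by simp
next
  case False
  then have r: "r = 0" using assms by simp
  show ?thesis
  proof (cases "A = {}")
    case True
    have "?S r = {f. sqrt (\<Sum>i\<in>A. (f i)\<^sup>2) \<le> 1} \<inter> space ?M" using True r by auto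
    then show ?thesis using emeasure_cball_aux[OF assms(1), of 1] True by simp
  next
    case ne: False
    have "emeasure ?M (?S r) \<le> ennreal e" if "e > 0" for e
    proof -
      define c where "c = unit_ball_vol (real (card A))"
      have c: "c > 0" by (simp add: c_def)
      define d where "d = min 1 (e / c)"
      have d: "d > 0" "d \<le> 1" "c * d \<le> e" using that c by (auto simp: d_def min_def field_simps)
      have "emeasure ?M (?S r) \<le> emeasure ?M (?S d)"
        using d r assms by (intro emeasure_mono) (auto intro: order_trans[of _ 0])
      also have "?S d = {f. sqrt (\<Sum>i\<in>A. (f i)\<^sup>2) \<le> d} \<inter> space ?M" by auto
      also have "emeasure ?M \<dots> = ennreal (c * d ^ card A)"
        unfolding c_def by (rule emeasure_cball_aux[OF assms(1) d(1)])
      also have "c * d ^ card A \<le> c * d ^ 1"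
        using c d ne assms by (intro mult_left_mono power_decreasing) (auto simp: Suc_le_eq card_gt_0_iff)
      then have "ennreal (c * d ^ card A) \<le> ennreal e" using d by (intro ennreal_leI) simp
      finally show ?thesis .
    qed
    then have "emeasure ?M (?S r) \<le> 0" by - (rule ennreal_le_epsilon, simp)
    then show ?thesis using r ne assms by (simp add: card_gt_0_iff)
  qed
qed

text \<open>Cavalieri along the axis b for sets that depend only on the coordinate on the axis and
  the distance from it. Fubini on the product measure of coordinates splits off b.\<close>

lemma emeasure_lborel_section:
  fixes Q :: "real \<Rightarrow> real \<Rightarrow> bool"
  assumes b: "b \<in> Basis" and Q [measurable]: "Measurable.pred (borel \<Otimes>\<^sub>M borel) (\<lambda>z. Q (fst z) (snd z))"
  shows "emeasure lborel {x::'a::euclidean_space. Q (x \<bullet> b) (\<Sum>i\<in>Basis - {b}. (x \<bullet> i)\<^sup>2)} =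
    (\<integral>\<^sup>+p. emeasure (Pi\<^sub>M (Basis - {b}) (\<lambda>_. lborel))
      {f \<in> space (Pi\<^sub>M (Basis - {b :: 'a}) (\<lambda>_. lborel)). Q p (\<Sum>i\<in>Basis - {b}. (f i)\<^sup>2)} \<partial>lborel)"
proof -
  interpret product_sigma_finite "\<lambda>_. lborel" by standard
  let ?I = "Basis - {b :: 'a}"
  let ?M = "Pi\<^sub>M ?I (\<lambda>_. lborel :: real measure)"
  let ?S = "{x::'a. Q (x \<bullet> b) (\<Sum>i\<in>?I. (x \<bullet> i)\<^sup>2)}"
  have ins: "insert b ?I = Basis" using b by auto
  let ?F = "\<lambda>f. \<Sum>i\<in>Basis. f i *\<^sub>R i :: 'a"
  have Fm [measurable]: "?F \<in> borel_measurable (Pi\<^sub>M Basis (\<lambda>_. lborel))" by measurable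
  have Sm [measurable]: "?S \<in> sets borel"
  proof -
    have "Measurable.pred borel (\<lambda>x::'a. Q (fst (x \<bullet> b, \<Sum>i\<in>?I. (x \<bullet> i)\<^sup>2)) (snd (x \<bullet> b, \<Sum>i\<in>?I. (x \<bullet> i)\<^sup>2)))"
      by (rule measurable_compose[OF _ Q]) measurable
    then show ?thesis by simp
  qed
  have "emeasure lborel ?S = (\<integral>\<^sup>+x. indicator ?S x \<partial>lborel)" by simp
  also have "\<dots> = (\<integral>\<^sup>+f. indicator ?S (?F f) \<partial>Pi\<^sub>M (insert b ?I) (\<lambda>_. lborel))"
    unfolding ins by (subst lborel_eq) (subst nn_integral_distr, auto)
  also have "\<dots> = (\<integral>\<^sup>+p. \<integral>\<^sup>+f. indicator ?S (?F (f(b := p))) \<partial>?M \<partial>lborel)"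
  proof (rule product_nn_integral_insert_rev)
    show "(\<lambda>f. indicator ?S (?F f) :: ennreal) \<in> borel_measurable (Pi\<^sub>M (insert b ?I) (\<lambda>_. lborel))"
      unfolding ins by measurable
  qed auto
  also have "\<dots> = (\<integral>\<^sup>+p. \<integral>\<^sup>+f. indicator {f \<in> space ?M. Q p (\<Sum>i\<in>?I. (f i)\<^sup>2)} f \<partial>?M \<partial>lborel)"
    using b by (intro nn_integral_cong) (auto simp: indicator_def intro!: sum.cong)
  also have "\<dots> = (\<integral>\<^sup>+p. emeasure ?M {f \<in> space ?M. Q p (\<Sum>i\<in>?I. (f i)\<^sup>2)} \<partial>lborel)"
  proof (intro nn_integral_cong nn_integral_indicator)
    fix p
    have "Measurable.pred ?M (\<lambda>f. Q (fst (p, \<Sum>i\<in>?I. (f i)\<^sup>2)) (snd (p, \<Sum>i\<in>?I. (f i)\<^sup>2)))"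
      by (rule measurable_compose[OF _ Q]) measurable
    then show "{f \<in> space ?M. Q p (\<Sum>i\<in>?I. (f i)\<^sup>2)} \<in> sets ?M"
      by simp
  qed
  finally show ?thesis .
qed

text \<open>Two distinguished axes are wanted for the plane spanned by a pair of points; the
  remaining coordinates again enter only through their squared length.\<close>

lemma emeasure_lborel_section2:
  fixes Q :: "real \<Rightarrow> real \<Rightarrow> real \<Rightarrow> bool"
  assumes b: "b \<in> Basis" "b' \<in> Basis" "b \<noteq> b'"
    and Q [measurable]: "Measurable.pred (borel \<Otimes>\<^sub>M borel \<Otimes>\<^sub>M borel) (\<lambda>z. Q (fst z) (fst (snd z)) (snd (snd z)))"
  shows "emeasure lborel {x::'a::euclidean_space. Q (x \<bullet> b) (x \<bullet> b') (\<Sum>i\<in>Basis - {b, b'}. (x \<bullet> i)\<^sup>2)} =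
    (\<integral>\<^sup>+p. \<integral>\<^sup>+y. emeasure (Pi\<^sub>M (Basis - {b, b'}) (\<lambda>_. lborel))
      {f \<in> space (Pi\<^sub>M (Basis - {b, b' :: 'a}) (\<lambda>_. lborel)). Q p y (\<Sum>i\<in>Basis - {b, b'}. (f i)\<^sup>2)} \<partial>lborel \<partial>lborel)"
proof -
  interpret product_sigma_finite "\<lambda>_. lborel" by standard
  let ?I = "Basis - {b, b' :: 'a}"
  let ?M = "Pi\<^sub>M ?I (\<lambda>_. lborel :: real measure)"
  let ?S = "{x::'a. Q (x \<bullet> b) (x \<bullet> b') (\<Sum>i\<in>?I. (x \<bullet> i)\<^sup>2)}"
  have ins: "insert b (insert b' ?I) = Basis" using b by auto
  let ?F = "\<lambda>f. \<Sum>i\<in>Basis. f i *\<^sub>R i :: 'a"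
  have Fm [measurable]: "?F \<in> borel_measurable (Pi\<^sub>M Basis (\<lambda>_. lborel))" by measurable
  have Sm [measurable]: "?S \<in> sets borel"
  proof -
    have "Measurable.pred borel (\<lambda>x::'a. Q (fst (x \<bullet> b, x \<bullet> b', \<Sum>i\<in>?I. (x \<bullet> i)\<^sup>2))
       (fst (snd (x \<bullet> b, x \<bullet> b', \<Sum>i\<in>?I. (x \<bullet> i)\<^sup>2))) (snd (snd (x \<bullet> b, x \<bullet> b', \<Sum>i\<in>?I. (x \<bullet> i)\<^sup>2))))"
      by (rule measurable_compose[OF _ Q]) measurable
    then show ?thesis by simp
  qed
  have m0: "(\<lambda>f. indicator ?S (?F f) :: ennreal) \<in> borel_measurable (Pi\<^sub>M (insert b (insert b' ?I)) (\<lambda>_. lborel))"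
    unfolding ins by measurable
  have "emeasure lborel ?S = (\<integral>\<^sup>+x. indicator ?S x \<partial>lborel)" by simp
  also have "\<dots> = (\<integral>\<^sup>+f. indicator ?S (?F f) \<partial>Pi\<^sub>M (insert b (insert b' ?I)) (\<lambda>_. lborel))"
    unfolding ins by (subst lborel_eq) (subst nn_integral_distr, auto)
  also have "\<dots> = (\<integral>\<^sup>+p. \<integral>\<^sup>+f. indicator ?S (?F (f(b := p))) \<partial>Pi\<^sub>M (insert b' ?I) (\<lambda>_. lborel) \<partial>lborel)"
    by (rule product_nn_integral_insert_rev) (use b m0 in auto)
  also have "\<dots> = (\<integral>\<^sup>+p. \<integral>\<^sup>+y. \<integral>\<^sup>+f. indicator ?S (?F (f(b' := y, b := p))) \<partial>?M \<partial>lborel \<partial>lborel)"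
  proof (intro nn_integral_cong product_nn_integral_insert_rev)
    fix p :: real
    have "(\<lambda>f. f(b := p)) \<in> measurable (Pi\<^sub>M (insert b' ?I) (\<lambda>_. lborel)) (Pi\<^sub>M (insert b (insert b' ?I)) (\<lambda>_. lborel))"
      by (rule measurable_fun_upd) auto
    from measurable_compose[OF this m0]
    show "(\<lambda>f. indicator ?S (?F (f(b := p))) :: ennreal) \<in> borel_measurable (Pi\<^sub>M (insert b' ?I) (\<lambda>_. lborel))" .
  qed auto
  also have "\<dots> = (\<integral>\<^sup>+p. \<integral>\<^sup>+y. \<integral>\<^sup>+f. indicator {f \<in> space ?M. Q p y (\<Sum>i\<in>?I. (f i)\<^sup>2)} f \<partial>?M \<partial>lborel \<partial>lborel)"
  proof (intro nn_integral_cong)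
    fix p y :: real and f :: "'a \<Rightarrow> real" assume f: "f \<in> space ?M"
    have "(\<Sum>i\<in>?I. (?F (f(b' := y, b := p)) \<bullet> i)\<^sup>2) = (\<Sum>i\<in>?I. (f i)\<^sup>2)"
      by (intro sum.cong) auto
    moreover have "?F (f(b' := y, b := p)) \<bullet> b = p" "?F (f(b' := y, b := p)) \<bullet> b' = y" using b by auto
    ultimately show "indicator ?S (?F (f(b' := y, b := p))) =
      (indicator {f \<in> space ?M. Q p y (\<Sum>i\<in>?I. (f i)\<^sup>2)} f :: ennreal)"
      using f by (simp add: indicator_def)
  qed
  also have "\<dots> = (\<integral>\<^sup>+p. \<integral>\<^sup>+y. emeasure ?M {f \<in> space ?M. Q p y (\<Sum>i\<in>?I. (f i)\<^sup>2)} \<partial>lborel \<partial>lborel)"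
  proof (intro nn_integral_cong nn_integral_indicator)
    fix p y :: real
    have "Measurable.pred ?M (\<lambda>f. Q (fst (p, y, \<Sum>i\<in>?I. (f i)\<^sup>2)) (fst (snd (p, y, \<Sum>i\<in>?I. (f i)\<^sup>2))) (snd (snd (p, y, \<Sum>i\<in>?I. (f i)\<^sup>2))))"
      by (rule measurable_compose[OF _ Q]) measurable
    then show "{f \<in> space ?M. Q p y (\<Sum>i\<in>?I. (f i)\<^sup>2)} \<in> sets ?M"
      by simp
  qed
  finally show ?thesis .
qed

section \<open>Spherical caps and their intersections\<close>

lemma nn_integral_power_01:
  "(\<integral>\<^sup>+p. ennreal (p ^ k) * indicator {0<..<1} p \<partial>lborel) = ennreal (1 / real (Suc k))"
proof -
  have "(\<integral>\<^sup>+p. ennreal (p ^ k) * indicator {0..1} p \<partial>lborel) =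
      ennreal ((1 :: real) ^ Suc k / real (Suc k) - 0 ^ Suc k / real (Suc k))"
    by (rule nn_integral_FTC_Icc[where F = "\<lambda>p. p ^ Suc k / real (Suc k)"])
       (auto intro!: DERIV_cong[OF DERIV_cdivide[OF DERIV_pow]] simp del: power_Suc of_nat_Suc)
  moreover have "(\<integral>\<^sup>+p. ennreal (p ^ k) * indicator {0..1} p \<partial>lborel) =
      (\<integral>\<^sup>+p. ennreal (p ^ k) * indicator {0<..<1} p \<partial>lborel)"
  proof (intro nn_integral_cong_AE)
    have "AE p in lborel. p \<notin> {0, 1 :: real}"
      by (intro AE_not_in countable_imp_null_set_lborel) auto
    then show "AE p in lborel. ennreal (p ^ k) * indicator {0..1} p = ennreal (p ^ k) * indicator {0<..<1} p"
      by eventually_elim (auto simp: indicator_def)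
  qed
  ultimately show ?thesis by simp
qed

text \<open>The two bounds differ by the factor sqrt (1 - s) ^ n, which tends to 1, so exchanging
  the ball for the slab does not change the leading term.\<close>

lemma tendsto_narrow_cone:
  fixes M V :: "real \<Rightarrow> real"
  assumes k: "k > 0" and M: "\<forall>\<^sub>F s in at_right 0. M s \<le> V s / k \<and> sqrt (1 - s) ^ n * V s / k \<le> M s"
    and V: "((\<lambda>s. V s / s powr a) \<longlongrightarrow> L) (at_right 0)"
  shows "((\<lambda>s. M s / s powr a) \<longlongrightarrow> L / k) (at_right 0)"
proof (rule tendsto_sandwich)
  show "\<forall>\<^sub>F s in at_right 0. sqrt (1 - s) ^ n * (V s / s powr a / k) \<le> M s / s powr a"
    using M
  proof eventually_elim
    case (elim s)
    then have "sqrt (1 - s) ^ n * V s / k / s powr a \<le> M s / s powr a" by (intro divide_right_mono) auto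
    then show ?case by (simp add: mult_ac divide_divide_eq_left)
  qed
  show "\<forall>\<^sub>F s in at_right 0. M s / s powr a \<le> V s / s powr a / k"
    using M
  proof eventually_elim
    case (elim s)
    then have "M s / s powr a \<le> V s / k / s powr a" by (intro divide_right_mono) auto
    then show ?case by (simp add: mult_ac divide_divide_eq_left)
  qed
  show "((\<lambda>s. V s / s powr a / k) \<longlongrightarrow> L / k) (at_right 0)"
    using V k by (intro tendsto_divide tendsto_const) auto
  have "((\<lambda>s::real. sqrt (1 - s) ^ n) \<longlongrightarrow> sqrt (1 - 0) ^ n) (at_right 0)"
    by (intro tendsto_intros)
  then have "((\<lambda>s. sqrt (1 - s) ^ n * (V s / s powr a / k)) \<longlongrightarrow> 1 * (L / k)) (at_right 0)"
    using V k by (intro tendsto_mult tendsto_divide tendsto_const) auto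
  then show "((\<lambda>s. sqrt (1 - s) ^ n * (V s / s powr a / k)) \<longlongrightarrow> L / k) (at_right 0)" by simp
qed

lemma emeasure_lborel_orthogonal_vimage:
  fixes f :: "'a::euclidean_space \<Rightarrow> 'a"
  assumes "orthogonal_transformation f" "S \<in> sets borel"
  shows "emeasure lborel (f -` S) = emeasure lborel S"
proof -
  have [measurable]: "f \<in> borel_measurable borel"
    using assms(1) by (rule orthogonal_transformation_measurable)
  have "emeasure lborel S = emeasure (distr lborel borel f) S"
    by (simp add: lborel_distr_orthogonal assms)
  also have "\<dots> = emeasure lborel (f -` S)" using assms by (simp add: emeasure_distr)
  finally show ?thesis ..
qed

lemma sqrt_power_eq_powr:
  assumes "(y::real) > 0"
  shows "sqrt y ^ k = y powr (real k / 2)"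
proof -
  have "y powr (real k / 2) = (y powr (1 / 2)) powr real k" by (simp only: powr_powr) simp
  also have "\<dots> = sqrt y ^ k" using assms powr_half_sqrt[of y] by (simp add: powr_realpow)
  finally show ?thesis ..
qed

lemma norm_inner_scaleR_iff:
  "t > 0 \<Longrightarrow> c * norm (t *\<^sub>R x) \<le> u \<bullet> (t *\<^sub>R x) \<longleftrightarrow> c * norm x \<le> u \<bullet> x"
  using mult_le_cancel_left_pos[of t "c * norm x" "u \<bullet> x"] by (simp add: mult.left_commute)

text \<open>The half-angle with cosine sqrt (1 - s) has tangent q = sqrt (s / (1 - s)), so the
  section at height p is a ball of dimension n - 1 and radius p q. Integrating p ^ (n - 1) over the
  unit interval gives 1 / n.\<close>

lemma emeasure_slab_cap:
  fixes u :: "'a::euclidean_space"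
  assumes u: "norm u = 1" and s: "0 < s" "s < 1"
  shows "emeasure lborel {x \<in> {x. u \<bullet> x \<ge> sqrt (1 - s) * norm x}. 0 < x \<bullet> u \<and> x \<bullet> u < 1} =
    ennreal (unit_ball_vol (real (DIM('a) - 1)) * sqrt (s / (1 - s)) ^ (DIM('a) - 1) / real (DIM('a)))"
proof -
  define q where "q = sqrt (s / (1 - s))"
  have q: "q > 0" "q\<^sup>2 = s / (1 - s)" using s by (auto simp: q_def)
  obtain b :: 'a where b: "b \<in> Basis" using nonempty_Basis by blast
  obtain f where f: "orthogonal_transformation f" "f b = u"
    using exists_reflection[of b u] b u by auto
  let ?S = "{x \<in> {x. u \<bullet> x \<ge> sqrt (1 - s) * norm x}. 0 < x \<bullet> u \<and> x \<bullet> u < 1}"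
  let ?I = "Basis - {b}"
  let ?M = "Pi\<^sub>M ?I (\<lambda>_. lborel :: real measure)"
  define Q where "Q p S \<longleftrightarrow> 0 < p \<and> p < 1 \<and> sqrt S \<le> p * q" for p S
  have Qm: "Measurable.pred (borel \<Otimes>\<^sub>M borel) (\<lambda>z. Q (fst z) (snd z))"
    unfolding Q_def by measurable
  have key: "sqrt (1 - s) * sqrt (p\<^sup>2 + S) \<le> p \<longleftrightarrow> sqrt S \<le> p * q" if "p > 0" "S \<ge> 0" for p S
  proof -
    have "sqrt (1 - s) * sqrt (p\<^sup>2 + S) \<le> p \<longleftrightarrow> sqrt ((1 - s) * (p\<^sup>2 + S)) \<le> p"
      by (simp add: real_sqrt_mult)
    also have "\<dots> \<longleftrightarrow> (1 - s) * (p\<^sup>2 + S) \<le> p\<^sup>2" using that s by (intro real_sqrt_le_iff') auto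
    also have "\<dots> \<longleftrightarrow> S \<le> p\<^sup>2 * (s / (1 - s))" using s by (simp add: field_simps)
    also have "\<dots> \<longleftrightarrow> S \<le> (p * q)\<^sup>2" using q by (simp add: power_mult_distrib)
    also have "\<dots> \<longleftrightarrow> sqrt S \<le> p * q" using that q by (intro real_sqrt_le_iff'[symmetric]) auto
    finally show ?thesis .
  qed
  have norm: "norm y = sqrt ((y \<bullet> b)\<^sup>2 + (\<Sum>i\<in>?I. (y \<bullet> i)\<^sup>2))" for y :: 'a
    using b by (simp add: norm_eq_sqrt_inner euclidean_inner[of y y] power2_eq_square sum.remove[of Basis b])
  have inn: "f y \<bullet> u = y \<bullet> b" for y using f by (metis orthogonal_transformation_def)
  have eq: "f -` ?S = {y. Q (y \<bullet> b) (\<Sum>i\<in>?I. (y \<bullet> i)\<^sup>2)}"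
  proof (intro set_eqI)
    fix y
    have "y \<in> f -` ?S \<longleftrightarrow> 0 < y \<bullet> b \<and> y \<bullet> b < 1 \<and> sqrt (1 - s) * norm y \<le> y \<bullet> b"
      using inn[of y] orthogonal_transformation_norm[OF f(1), of y] by (auto simp: inner_commute[of u])
    also have "\<dots> \<longleftrightarrow> Q (y \<bullet> b) (\<Sum>i\<in>?I. (y \<bullet> i)\<^sup>2)"
      unfolding Q_def norm[of y] using key[of "y \<bullet> b" "\<Sum>i\<in>?I. (y \<bullet> i)\<^sup>2"] by (auto simp: sum_nonneg)
    finally show "y \<in> f -` ?S \<longleftrightarrow> y \<in> {y. Q (y \<bullet> b) (\<Sum>i\<in>?I. (y \<bullet> i)\<^sup>2)}" by simp
  qed
  have Sm: "?S \<in> sets borel" by measurable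
  have "emeasure lborel ?S = emeasure lborel (f -` ?S)"
    by (rule emeasure_lborel_orthogonal_vimage[OF f(1) Sm, symmetric])
  also have "\<dots> = emeasure lborel {y. Q (y \<bullet> b) (\<Sum>i\<in>?I. (y \<bullet> i)\<^sup>2)}" by (simp only: eq)
  also have "\<dots> = (\<integral>\<^sup>+p. emeasure ?M
      {f \<in> space ?M. Q p (\<Sum>i\<in>?I. (f i)\<^sup>2)} \<partial>lborel)"
    by (rule emeasure_lborel_section[OF b Qm])
  also have "\<dots> = (\<integral>\<^sup>+p. ennreal (unit_ball_vol (real (DIM('a) - 1)) * q ^ (DIM('a) - 1)) *
      (ennreal (p ^ (DIM('a) - 1)) * indicator {0<..<1} p) \<partial>lborel)"
  proof (intro nn_integral_cong)
    fix p :: real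
    show "emeasure ?M {f \<in> space ?M. Q p (\<Sum>i\<in>?I. (f i)\<^sup>2)} =
      ennreal (unit_ball_vol (real (DIM('a) - 1)) * q ^ (DIM('a) - 1)) * (ennreal (p ^ (DIM('a) - 1)) * indicator {0<..<1} p)"
    proof (cases "0 < p \<and> p < 1")
      case True
      then have "{f \<in> space ?M. Q p (\<Sum>i\<in>?I. (f i)\<^sup>2)} =
         {f \<in> space ?M. sqrt (\<Sum>i\<in>?I. (f i)\<^sup>2) \<le> p * q}"
        by (simp add: Q_def)
      then show ?thesis using True q b
        by (simp add: emeasure_PiM_cball card_Diff_singleton power_mult_distrib ennreal_mult'[symmetric] mult_ac)
    qed (auto simp: Q_def)
  qed
  also have "\<dots> = ennreal (unit_ball_vol (real (DIM('a) - 1)) * q ^ (DIM('a) - 1)) * ennreal (1 / real (Suc (DIM('a) - 1)))"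
    by (subst nn_integral_cmult) (auto simp: nn_integral_power_01 simp del: of_nat_Suc)
  also have "\<dots> = ennreal (unit_ball_vol (real (DIM('a) - 1)) * q ^ (DIM('a) - 1) / real (DIM('a)))"
    using q by (simp add: ennreal_mult'[symmetric] del: of_nat_Suc)
  finally show ?thesis by (simp add: q_def)
qed

lemma sphere_cap_asymp:
  fixes u :: "'a::euclidean_space"
  assumes u: "norm u = 1"
  shows "((\<lambda>s. measure sphere_uniform {x. u \<bullet> x \<ge> sqrt (1 - s)} / s powr (real (DIM('a) - 1) / 2)) \<longlongrightarrow>
    unit_ball_vol (real (DIM('a) - 1)) / real (DIM('a)) / unit_ball_vol (real (DIM('a)))) (at_right 0)"
proof (rule tendsto_narrow_cone)
  show "unit_ball_vol (real DIM('a)) > 0" by simp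
  define k where "k = DIM('a) - 1"
  let ?V = "\<lambda>s. unit_ball_vol (real k) * sqrt (s / (1 - s)) ^ k / real (DIM('a))"
  have small: "\<forall>\<^sub>F s::real in at_right 0. 0 < s \<and> s < 1"
    by (auto simp: eventually_at_right_field intro: exI[of _ 1])
  show "\<forall>\<^sub>F s in at_right 0. measure sphere_uniform {x. u \<bullet> x \<ge> sqrt (1 - s)} \<le> ?V s / unit_ball_vol (real (DIM('a))) \<and>
      sqrt (1 - s) ^ DIM('a) * ?V s / unit_ball_vol (real (DIM('a))) \<le> measure sphere_uniform {x. u \<bullet> x \<ge> sqrt (1 - s)}"
    using small
  proof eventually_elim
    case (elim s)
    let ?E = "{x. u \<bullet> x \<ge> sqrt (1 - s) * norm x}"
    \<comment> \<open>The cap and the cone over it agree where norm x = 1, hence almost surely on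
      the sphere.\<close>
    have "measure sphere_uniform {x. u \<bullet> x \<ge> sqrt (1 - s)} = measure sphere_uniform ?E"
      by (rule measure_eq_AE) (use AE_sphere_uniform in \<open>auto elim: eventually_mono\<close>)
    moreover have "t *\<^sub>R x \<in> ?E \<longleftrightarrow> x \<in> ?E" if "t > 0" for t x using norm_inner_scaleR_iff[OF that] by simp
    moreover have "?E \<in> sets borel" by measurable
    moreover have "emeasure lborel {x \<in> ?E. 0 < x \<bullet> u \<and> x \<bullet> u < 1} = ennreal (?V s)"
      using emeasure_slab_cap[OF u, of s] elim unfolding k_def by simp
    moreover have "?V s \<ge> 0" using elim by simp
    moreover have "sqrt (1 - s) * norm x \<le> x \<bullet> u" if "x \<in> ?E" for x using that by (simp add: inner_commute)
    ultimately show ?case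
      using measure_sphere_uniform_narrow_cone[of ?E u "sqrt (1 - s)" "?V s"] elim u by force
  qed
  have "((\<lambda>s. unit_ball_vol (real k) * (1 - s) powr (- real k / 2) / real (DIM('a))) \<longlongrightarrow>
      unit_ball_vol (real k) * (1 - 0) powr (- real k / 2) / real (DIM('a))) (at_right 0)"
    by (intro tendsto_intros) auto
  moreover have "\<forall>\<^sub>F s in at_right 0. unit_ball_vol (real k) * (1 - s) powr (- real k / 2) / real (DIM('a)) =
      ?V s / s powr (real k / 2)"
    using small
  proof eventually_elim
    case (elim s)
    have "sqrt (s / (1 - s)) ^ k = (s / (1 - s)) powr (real k / 2)"
      using elim by (intro sqrt_power_eq_powr) auto
    also have "\<dots> = s powr (real k / 2) * (1 - s) powr (- real k / 2)"
      using elim by (simp add: powr_divide powr_minus field_simps)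
    finally show ?case using elim by simp
  qed
  ultimately show "((\<lambda>s. ?V s / s powr (real k / 2)) \<longlongrightarrow> unit_ball_vol (real k) / real (DIM('a))) (at_right 0)"
    by (auto elim: Lim_transform_eventually)
qed

text \<open>Let x have component p along u + v and component y = p s z along u - v. The squared
  radius left for the other directions is then p^2 s times this profile, where T is the tangent of
  half the angle between u and v. As s tends to 0 the profile tends to 1 - 2 T |z|.\<close>

definition lens_profile :: "real \<Rightarrow> real \<Rightarrow> real \<Rightarrow> real" where
  "lens_profile T s z = (1 - 2 * T * \<bar>z\<bar> + T\<^sup>2 * s * z\<^sup>2) / (1 - s) - s * z\<^sup>2"

text \<open>The first condition of the indicator is T |y| <= p in the rescaled variable. It excludes
  the spurious branch that appears when an inequality with a square root is squared.\<close>

definition lens_integrand :: "nat \<Rightarrow> real \<Rightarrow> real \<Rightarrow> real \<Rightarrow> real" where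
  "lens_integrand d T s z =
     sqrt (lens_profile T s z) ^ d * indicator {z. T * s * \<bar>z\<bar> \<le> 1 \<and> lens_profile T s z \<ge> 0} z"

lemma lens_profile_measurable [measurable]: "lens_profile T s \<in> borel_measurable borel"
  unfolding lens_profile_def by measurable

lemma lens_integrand_measurable [measurable]: "lens_integrand d T s \<in> borel_measurable borel"
  unfolding lens_integrand_def by measurable

text \<open>Put a = T |z|. On the support s a <= 1, so the quadratic term T^2 s z^2 is at most a and
  the numerator of the profile at most 1 - a. Nonnegativity then gives a <= 1, and 1 - s >= 1/2
  gives profile <= 2; the bound is independent of s.\<close>

lemma lens_integrand_bound:
  assumes "T > 0" "0 < s" "s \<le> 1 / 2"
  shows "norm (lens_integrand d T s z) \<le> sqrt 2 ^ d * indicator {- (1 / T)..1 / T} z"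
proof (cases "T * s * \<bar>z\<bar> \<le> 1 \<and> lens_profile T s z \<ge> 0")
  case True
  define a where "a = T * \<bar>z\<bar>"
  have a: "a \<ge> 0" "s * a \<le> 1" using True assms by (auto simp: a_def mult_ac)
  have "T\<^sup>2 * s * z\<^sup>2 = (s * a) * a" by (simp add: a_def power2_eq_square mult_ac)
  also have "\<dots> \<le> 1 * a" using a by (intro mult_right_mono) auto
  finally have num: "1 - 2 * T * \<bar>z\<bar> + T\<^sup>2 * s * z\<^sup>2 \<le> 1 - a" by (simp add: a_def)
  have "0 \<le> s * z\<^sup>2" using assms by simp
  then have le: "lens_profile T s z \<le> (1 - a) / (1 - s)"
    unfolding lens_profile_def using divide_right_mono[OF num, of "1 - s"] assms by linarith
  then have "0 \<le> (1 - a) / (1 - s)" using True by linarith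
  then have a1: "a \<le> 1" using assms by (simp add: zero_le_divide_iff)
  have "(1 - a) / (1 - s) \<le> 2" using a assms by (simp add: pos_divide_le_eq)
  then have "sqrt (lens_profile T s z) \<le> sqrt 2" using le by simp
  then have "sqrt (lens_profile T s z) ^ d \<le> sqrt 2 ^ d" using True by (intro power_mono) auto
  moreover have "\<bar>z\<bar> \<le> 1 / T" using a1 assms by (simp add: a_def field_simps)
  then have "z \<in> {- (1 / T)..1 / T}" by auto
  ultimately show ?thesis using True by (simp add: lens_integrand_def)
qed (auto simp: lens_integrand_def)

lemma integrable_lens_bound:
  "integrable lborel (\<lambda>z. sqrt 2 ^ d * indicator {- (1 / T)..1 / T :: real} z :: real)"
  by (intro integrable_mult_right integrable_real_indicator) (simp_all add: emeasure_lborel_Icc_eq less_top[symmetric])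

lemma integrable_lens_integrand:
  assumes "T > 0" "0 < s" "s \<le> 1 / 2"
  shows "integrable lborel (lens_integrand d T s)"
  using lens_integrand_bound[OF assms]
  by (intro Bochner_Integration.integrable_bound[OF integrable_lens_bound[of d T]] AE_I2)
     (auto intro: order_trans[OF _ abs_ge_self])

text \<open>Splitting at z = 0 and substituting 1 - 2 T |z| gives twice the integral of the power d
  / 2 over the unit interval, divided by 2 T.\<close>

lemma integral_lens_limit:
  assumes T: "T > 0"
  shows "(\<integral>z. sqrt (1 - 2 * T * \<bar>z\<bar>) ^ d * indicator {z. 2 * T * \<bar>z\<bar> \<le> 1} z \<partial>lborel) = 2 / (real (d + 2) * T)"
proof -
  define g where "g u = sqrt u ^ d * indicator {0..1} u" for u :: real
  have [measurable]: "g \<in> borel_measurable borel" unfolding g_def by measurable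
  have gi: "integrable lborel g"
    by (rule Bochner_Integration.integrable_bound[of _ "indicator {0..1} :: real \<Rightarrow> real"])
       (auto simp: g_def indicator_def intro!: power_le_one)
  have gI: "(\<integral>u. g u \<partial>lborel) = 2 / real (d + 2)"
  proof -
    have "((\<lambda>u. u powr (real d / 2)) has_integral (1 powr (real d / 2 + 1) / (real d / 2 + 1))) {0..1}"
      by (rule has_integral_powr_from_0) auto
    then have "((\<lambda>u. u powr (real d / 2)) has_integral (2 / real (d + 2))) {0..1}"
      by (simp add: field_simps)
    then have "(\<integral>\<^sup>+u. ennreal (indicator {0..1} u * u powr (real d / 2)) \<partial>lborel) = ennreal (2 / real (d + 2))"
      by (intro nn_integral_has_integral_lebesgue) auto
    also have "(\<integral>\<^sup>+u. ennreal (indicator {0..1} u * u powr (real d / 2)) \<partial>lborel) = (\<integral>\<^sup>+u. ennreal (g u) \<partial>lborel)"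
    proof (intro nn_integral_cong_AE)
      have "AE u in lborel. u \<noteq> (0::real)" by (rule AE_lborel_singleton)
      then show "AE u in lborel. ennreal (indicator {0..1} u * u powr (real d / 2)) = ennreal (g u)"
        by eventually_elim (auto simp: g_def indicator_def sqrt_power_eq_powr)
    qed
    finally show ?thesis
      by (subst integral_eq_nn_integral) (auto simp: g_def indicator_def intro!: AE_I2)
  qed
  have half: "(\<integral>z. g (1 + c * z) \<partial>lborel) = 2 / real (d + 2) / \<bar>c\<bar>" if "c \<noteq> 0" for c
  proof -
    have "\<bar>c\<bar> * (\<integral>z. g (1 + c * z) \<partial>lborel) = 2 / real (d + 2)"
      using lborel_integral_real_affine[OF that, of g 1] gI by (simp del: of_nat_add)
    then show ?thesis using that by (simp add: eq_divide_eq mult_ac del: of_nat_add)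
  qed
  have hi: "integrable lborel (\<lambda>z. g (1 + c * z))" if "c \<noteq> 0" for c
    by (rule lborel_integrable_real_affine[OF gi that])
  have "(\<integral>z. sqrt (1 - 2 * T * \<bar>z\<bar>) ^ d * indicator {z. 2 * T * \<bar>z\<bar> \<le> 1} z \<partial>lborel) =
      (\<integral>z. g (1 + (- 2 * T) * z) + g (1 + (2 * T) * z) \<partial>lborel)"
  proof (rule integral_cong_AE)
    \<comment> \<open>At z = 0 both halves contribute 1, so the splitting is an equality only almost
      everywhere.\<close>
    have "AE z in lborel. z \<noteq> (0::real)" by (rule AE_lborel_singleton)
    then show "AE z in lborel. sqrt (1 - 2 * T * \<bar>z\<bar>) ^ d * indicator {z. 2 * T * \<bar>z\<bar> \<le> 1} z =
        g (1 + (- 2 * T) * z) + g (1 + (2 * T) * z)"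
    proof eventually_elim
      case (elim z)
      show ?case
      proof (cases "z > 0")
        case True
        then have "T * z > 0" using T by simp
        then show ?thesis using True by (auto simp: g_def indicator_def)
      next
        case False
        then have "T * z < 0" using T elim by (simp add: mult_less_0_iff)
        then show ?thesis using False by (auto simp: g_def indicator_def)
      qed
    qed
  qed measurable
  also have "\<dots> = 2 / real (d + 2) / \<bar>- 2 * T\<bar> + 2 / real (d + 2) / \<bar>2 * T\<bar>"
    using T hi[of "- 2 * T"] hi[of "2 * T"] half[of "- 2 * T"] half[of "2 * T"]
    by (subst Bochner_Integration.integral_add) simp_all
  also have "\<dots> = 2 / (real (d + 2) * T)"
  proof -
    have "x / \<bar>- 2 * T\<bar> + x / \<bar>2 * T\<bar> = x / T" for x using T by simp
    from this[of "2 / real (d + 2)"] show ?thesis by (simp only: divide_divide_eq_left)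
  qed
  finally show ?thesis .
qed

lemma lens_integral_lim:
  assumes T: "T > 0"
  shows "((\<lambda>s. \<integral>z. lens_integrand d T s z \<partial>lborel) \<longlongrightarrow> 2 / (real (d + 2) * T)) (at_right 0)"
  unfolding filterlim_at_right_to_top integral_lens_limit[OF T, symmetric]
proof (rule integral_dominated_convergence_at_top)
  show "\<forall>\<^sub>F x in at_top. AE z in lborel. norm (lens_integrand d T (inverse x) z) \<le> sqrt 2 ^ d * indicator {- (1 / T)..1 / T} z"
    using eventually_ge_at_top[of 2]
  proof eventually_elim
    case (elim x)
    then show ?case using lens_integrand_bound[OF T, of "inverse x"] by (intro AE_I2) (auto simp: field_simps)
  qed
  \<comment> \<open>At these two points the limiting profile is 0, so the sign of the profile, and
    with it the indicator, need not converge.\<close>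
  have "AE z in lborel. z \<notin> {1 / (2 * T), - (1 / (2 * T))}"
    by (intro AE_not_in countable_imp_null_set_lborel) auto
  then show "AE z in lborel. ((\<lambda>x. lens_integrand d T (inverse x) z) \<longlongrightarrow>
      sqrt (1 - 2 * T * \<bar>z\<bar>) ^ d * indicator {z. 2 * T * \<bar>z\<bar> \<le> 1} z) at_top"
  proof eventually_elim
    case (elim z)
    have i0: "((\<lambda>x::real. inverse x) \<longlongrightarrow> 0) at_top" by (rule tendsto_inverse_0_at_top) (rule filterlim_ident)
    have "((\<lambda>x. lens_profile T (inverse x) z) \<longlongrightarrow> (1 - 2 * T * \<bar>z\<bar> + T\<^sup>2 * 0 * z\<^sup>2) / (1 - 0) - 0 * z\<^sup>2) at_top"
      unfolding lens_profile_def by (intro tendsto_intros i0) auto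
    then have lim: "((\<lambda>x. lens_profile T (inverse x) z) \<longlongrightarrow> 1 - 2 * T * \<bar>z\<bar>) at_top" by simp
    have "((\<lambda>x. T * inverse x * \<bar>z\<bar>) \<longlongrightarrow> T * 0 * \<bar>z\<bar>) at_top" by (intro tendsto_intros i0)
    then have "\<forall>\<^sub>F x in at_top. T * inverse x * \<bar>z\<bar> < 1" by (intro order_tendstoD) auto
    moreover have ne: "2 * T * \<bar>z\<bar> \<noteq> 1" using elim T by (auto simp: abs_if field_simps split: if_splits)
    have "\<forall>\<^sub>F x in at_top. (lens_profile T (inverse x) z \<ge> 0 \<longleftrightarrow> 2 * T * \<bar>z\<bar> \<le> 1)"
    proof (cases "2 * T * \<bar>z\<bar> < 1")
      case True
      then have "\<forall>\<^sub>F x in at_top. lens_profile T (inverse x) z > 0" using lim by (intro order_tendstoD(1)) auto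
      then show ?thesis by eventually_elim (use True in auto)
    next
      case False
      then have "\<forall>\<^sub>F x in at_top. lens_profile T (inverse x) z < 0" using lim ne by (intro order_tendstoD(2)) auto
      then show ?thesis by eventually_elim (use False ne in auto)
    qed
    ultimately have "\<forall>\<^sub>F x in at_top. sqrt (lens_profile T (inverse x) z) ^ d * indicator {z. 2 * T * \<bar>z\<bar> \<le> 1} z =
        lens_integrand d T (inverse x) z"
      by eventually_elim (auto simp: lens_integrand_def indicator_def)
    moreover have "((\<lambda>x. sqrt (lens_profile T (inverse x) z) ^ d * indicator {z. 2 * T * \<bar>z\<bar> \<le> 1} z) \<longlongrightarrow>
        sqrt (1 - 2 * T * \<bar>z\<bar>) ^ d * indicator {z. 2 * T * \<bar>z\<bar> \<le> 1} z) at_top"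
      by (intro tendsto_intros lim)
    ultimately show ?case by (auto elim: Lim_transform_eventually)
  qed
qed (use integrable_lens_bound in \<open>auto simp del: integrable_mult_right_iff integrable_mult_left_iff\<close>)

lemma norm_add_unit:
  fixes u v :: "'a::real_inner"
  assumes "norm u = 1" "norm v = 1" "r > 0" "r\<^sup>2 = (1 + u \<bullet> v) / 2"
  shows "norm (u + v) = 2 * r"
proof -
  have "(u + v) \<bullet> (u + v) = 2 + 2 * (u \<bullet> v)"
    using assms by (simp add: norm_eq_1 inner_add_left inner_add_right inner_commute)
  also have "\<dots> = (2 * r)\<^sup>2" using assms by (simp add: power_mult_distrib)
  finally have "(u + v) \<bullet> (u + v) = (2 * r)\<^sup>2" .
  then have "norm (u + v) = \<bar>2 * r\<bar>" by (simp only: norm_eq_sqrt_inner real_sqrt_abs)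
  then show ?thesis using assms by simp
qed

text \<open>In the orthonormal frame m, w along u + v and u - v, the points are co m + si w and co m
  - si w, and both cone conditions together read sqrt (1 - s) |x| <= p - T |y|. The section over (p,
  y) is a ball of dimension d. The substitution y = p s z yields p s from dy and (p sqrt s) ^ d from
  the radius.\<close>

lemma emeasure_slab_lens:
  fixes u v :: "'a::euclidean_space"
  assumes u: "norm u = 1" and v: "norm v = 1" and dim: "DIM('a) \<ge> 2"
    and co: "co > 0" "co\<^sup>2 = (1 + u \<bullet> v) / 2" and si: "si > 0" "si\<^sup>2 = (1 - u \<bullet> v) / 2"
    and s: "0 < s" "s \<le> 1 / 2" and m_def: "m = (1 / (2 * co)) *\<^sub>R (u + v)"
    and d_def: "d = DIM('a) - 2"
  shows "emeasure lborel {x \<in> {x. co * sqrt (1 - s) * norm x \<le> u \<bullet> x \<and> co * sqrt (1 - s) * norm x \<le> v \<bullet> x}. 0 < x \<bullet> m \<and> x \<bullet> m < 1} =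
    ennreal (unit_ball_vol (real d) * s * sqrt s ^ d / real (DIM('a)) * (\<integral>z. lens_integrand d (si / co) s z \<partial>lborel))"
proof -
  define T where "T = si / co"
  have T: "T > 0" using co si by (simp add: T_def)
  define \<tau> where "\<tau> = sqrt (1 - s)"
  have tau: "\<tau> > 0" "\<tau>\<^sup>2 = 1 - s" using s by (auto simp: \<tau>_def)
  define w where "w = (1 / (2 * si)) *\<^sub>R (u - v)"
  have uu: "u \<bullet> u = 1" "v \<bullet> v = 1" using u v by (simp_all add: norm_eq_1)
  have "norm (u + v) = 2 * co" "norm (u - v) = 2 * si"
    using norm_add_unit[of u v co] norm_add_unit[of u "- v" si] u v co si by simp_all
  then have nm: "norm m = 1" "norm w = 1" using co si by (simp_all add: m_def w_def)
  have mw: "m \<bullet> w = 0"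
  proof -
    have "(u + v) \<bullet> (u - v) = 0"
      using uu by (simp add: inner_add_left inner_diff_right inner_commute[of v u])
    then show ?thesis by (simp add: m_def w_def)
  qed
  have uv: "u = co *\<^sub>R m + si *\<^sub>R w" "v = co *\<^sub>R m - si *\<^sub>R w"
  proof -
    have "co *\<^sub>R m = (1 / 2) *\<^sub>R (u + v)" "si *\<^sub>R w = (1 / 2) *\<^sub>R (u - v)"
      using co si by (simp_all add: m_def w_def)
    then show "u = co *\<^sub>R m + si *\<^sub>R w" "v = co *\<^sub>R m - si *\<^sub>R w"
      by (simp_all only: scaleR_add_right[symmetric] scaleR_diff_right[symmetric]) (simp_all add: scaleR_2[symmetric])
  qed
  obtain b b' :: 'a where b: "b \<in> Basis" "b' \<in> Basis" "b \<noteq> b'"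
  proof -
    obtain b :: 'a where "b \<in> Basis" using nonempty_Basis by blast
    moreover have "Basis - {b} \<noteq> {}"
    proof
      assume "Basis - {b} = {}"
      then have "DIM('a) \<le> card {b}" by (intro card_mono) auto
      then show False using dim by simp
    qed
    ultimately show ?thesis using that by blast
  qed
  obtain f where f: "orthogonal_transformation f" "f b = m" "f b' = w"
    using orthogonal_frame[OF nm mw, of b b'] b by (auto simp: inner_not_same_Basis)
  have inn: "f y \<bullet> m = y \<bullet> b" "f y \<bullet> w = y \<bullet> b'" for y
    using f by (metis orthogonal_transformation_def)+
  let ?S = "{x \<in> {x. co * \<tau> * norm x \<le> u \<bullet> x \<and> co * \<tau> * norm x \<le> v \<bullet> x}. 0 < x \<bullet> m \<and> x \<bullet> m < 1}"
  let ?I = "Basis - {b, b'}"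
  let ?M = "Pi\<^sub>M ?I (\<lambda>_. lborel :: real measure)"
  \<comment> \<open>Solving the squared cone condition for the squared length S of the remaining
    coordinates gives this upper bound.\<close>
  define \<psi> where "\<psi> p y = (p - T * \<bar>y\<bar>)\<^sup>2 / (1 - s) - p\<^sup>2 - y\<^sup>2" for p y
  define Q where "Q p y S \<longleftrightarrow> 0 < p \<and> p < 1 \<and> T * \<bar>y\<bar> \<le> p \<and> S \<le> \<psi> p y" for p y S
  have Qm: "Measurable.pred (borel \<Otimes>\<^sub>M borel \<Otimes>\<^sub>M borel) (\<lambda>z. Q (fst z) (fst (snd z)) (snd (snd z)))"
    unfolding Q_def \<psi>_def by measurable
  have key: "\<tau> * sqrt (p\<^sup>2 + y\<^sup>2 + S) \<le> p - T * \<bar>y\<bar> \<longleftrightarrow> T * \<bar>y\<bar> \<le> p \<and> S \<le> \<psi> p y"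
    if "S \<ge> 0" for p y S
  proof (cases "T * \<bar>y\<bar> \<le> p")
    case True
    have "\<tau> * sqrt (p\<^sup>2 + y\<^sup>2 + S) \<le> p - T * \<bar>y\<bar> \<longleftrightarrow> sqrt ((1 - s) * (p\<^sup>2 + y\<^sup>2 + S)) \<le> p - T * \<bar>y\<bar>"
      by (simp add: real_sqrt_mult \<tau>_def)
    also have "\<dots> \<longleftrightarrow> (1 - s) * (p\<^sup>2 + y\<^sup>2 + S) \<le> (p - T * \<bar>y\<bar>)\<^sup>2"
      using that s True by (intro real_sqrt_le_iff') auto
    also have "\<dots> \<longleftrightarrow> p\<^sup>2 + y\<^sup>2 + S \<le> (p - T * \<bar>y\<bar>)\<^sup>2 / (1 - s)"
      using s by (simp add: pos_le_divide_eq mult.commute)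
    also have "\<dots> \<longleftrightarrow> S \<le> \<psi> p y" unfolding \<psi>_def by linarith
    finally show ?thesis using True by simp
  next
    case False
    have "0 \<le> \<tau> * sqrt (p\<^sup>2 + y\<^sup>2 + S)" using tau that by simp
    then show ?thesis using False by linarith
  qed
  have norm: "norm y = sqrt ((y \<bullet> b)\<^sup>2 + (y \<bullet> b')\<^sup>2 + (\<Sum>i\<in>?I. (y \<bullet> i)\<^sup>2))" for y :: 'a
  proof -
    have "y \<bullet> y = (\<Sum>i\<in>Basis. (y \<bullet> i)\<^sup>2)" by (subst euclidean_inner) (simp add: power2_eq_square)
    also have "\<dots> = (y \<bullet> b)\<^sup>2 + ((y \<bullet> b')\<^sup>2 + (\<Sum>i\<in>Basis - {b} - {b'}. (y \<bullet> i)\<^sup>2))"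
      using b by (subst sum.remove[of _ b], simp, simp, subst sum.remove[of _ b']) auto
    also have "Basis - {b} - {b'} = ?I" by auto
    finally show ?thesis by (simp add: norm_eq_sqrt_inner add.assoc)
  qed
  have eq: "f -` ?S = {y. Q (y \<bullet> b) (y \<bullet> b') (\<Sum>i\<in>?I. (y \<bullet> i)\<^sup>2)}"
  proof (intro set_eqI)
    fix y
    define p q where "p = y \<bullet> b" and "q = y \<bullet> b'"
    have nf: "norm (f y) = norm y" by (rule orthogonal_transformation_norm[OF f(1)])
    have in2: "u \<bullet> f y = co * p + si * q" "v \<bullet> f y = co * p - si * q"
    proof -
      have *: "m \<bullet> f y = p" "w \<bullet> f y = q" using inn[of y] by (simp_all add: inner_commute p_def q_def)
      have "u \<bullet> f y = (co *\<^sub>R m + si *\<^sub>R w) \<bullet> f y" "v \<bullet> f y = (co *\<^sub>R m - si *\<^sub>R w) \<bullet> f y"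
        by (simp_all only: uv[symmetric])
      then show "u \<bullet> f y = co * p + si * q" "v \<bullet> f y = co * p - si * q"
        by (simp_all add: inner_add_left inner_diff_left *)
    qed
    \<comment> \<open>After division by co the two conditions differ only in the sign of q, so
      together they involve |q|.\<close>
    have "co * \<tau> * norm y \<le> co * p + si * q \<and> co * \<tau> * norm y \<le> co * p - si * q \<longleftrightarrow>
        co * (\<tau> * norm y) \<le> co * (p + T * q) \<and> co * (\<tau> * norm y) \<le> co * (p - T * q)"
      using co by (simp add: T_def algebra_simps)
    also have "\<dots> \<longleftrightarrow> \<tau> * norm y \<le> p + T * q \<and> \<tau> * norm y \<le> p - T * q"
      using co by (simp only: mult_le_cancel_left_pos)
    also have "\<dots> \<longleftrightarrow> \<tau> * norm y \<le> p - T * \<bar>q\<bar>"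
    proof -
      have "T * \<bar>q\<bar> = \<bar>T * q\<bar>" using T by (simp add: abs_mult)
      then show ?thesis by (auto simp: abs_if)
    qed
    also have "\<dots> \<longleftrightarrow> T * \<bar>q\<bar> \<le> p \<and> (\<Sum>i\<in>?I. (y \<bullet> i)\<^sup>2) \<le> \<psi> p q"
      unfolding norm[of y] p_def[symmetric] q_def[symmetric] by (rule key) (simp add: sum_nonneg)
    finally show "y \<in> f -` ?S \<longleftrightarrow> y \<in> {y. Q (y \<bullet> b) (y \<bullet> b') (\<Sum>i\<in>?I. (y \<bullet> i)\<^sup>2)}"
      unfolding Q_def vimage_def mem_Collect_eq inn nf in2 p_def[symmetric] q_def[symmetric] by blast
  qed
  have Sm: "?S \<in> sets borel" by measurable
  let ?H = "\<lambda>p y. indicator {0<..<1} p * ennreal (unit_ball_vol (real d) * (sqrt (\<psi> p y) ^ d * indicator {y. T * \<bar>y\<bar> \<le> p \<and> \<psi> p y \<ge> 0} y))"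
  have inner_meas: "emeasure ?M {f \<in> space ?M. Q p y (\<Sum>i\<in>?I. (f i)\<^sup>2)} =
      ?H p y" for p y
  proof (cases "0 < p \<and> p < 1 \<and> T * \<bar>y\<bar> \<le> p \<and> \<psi> p y \<ge> 0")
    case True
    then have "{f \<in> space ?M. Q p y (\<Sum>i\<in>?I. (f i)\<^sup>2)} =
      {f \<in> space ?M. sqrt (\<Sum>i\<in>?I. (f i)\<^sup>2) \<le> sqrt (\<psi> p y)}"
      by (auto simp: Q_def)
    also have "emeasure ?M \<dots> = ennreal (unit_ball_vol (real (card ?I)) * sqrt (\<psi> p y) ^ card ?I)"
      using True by (intro emeasure_PiM_cball) auto
    also have "card ?I = d" using b by (simp add: card_Diff_subset d_def)
    finally show ?thesis using True by simp
  next
    case False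
    \<comment> \<open>A sum of squares below \<open>\<psi> p y\<close> forces
      \<open>\<psi> p y\<close> to be nonnegative, so the section is empty in this case.\<close>
    have "\<not> Q p y (\<Sum>i\<in>?I. (f i)\<^sup>2)" for f :: "'a \<Rightarrow> real"
    proof
      assume *: "Q p y (\<Sum>i\<in>?I. (f i)\<^sup>2)"
      have "0 \<le> (\<Sum>i\<in>?I. (f i)\<^sup>2)" by (simp add: sum_nonneg)
      with * False show False unfolding Q_def by linarith
    qed
    then show ?thesis using False by (auto simp: indicator_def)
  qed
  have scale: "\<psi> p (p * s * z) = p\<^sup>2 * s * lens_profile T s z" if "p > 0" for p z
  proof -
    have "(p - T * \<bar>p * s * z\<bar>)\<^sup>2 = p\<^sup>2 * (1 - T * s * \<bar>z\<bar>)\<^sup>2"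
      using that s by (simp add: abs_mult power2_eq_square algebra_simps)
    also have "(1 - T * s * \<bar>z\<bar>)\<^sup>2 = 1 - 2 * T * s * \<bar>z\<bar> + T\<^sup>2 * s\<^sup>2 * z\<^sup>2"
      by (simp add: power2_diff power_mult_distrib)
    finally have 1: "\<psi> p (p * s * z) = p\<^sup>2 * ((1 - 2 * T * s * \<bar>z\<bar> + T\<^sup>2 * s\<^sup>2 * z\<^sup>2) / (1 - s) - 1 - s\<^sup>2 * z\<^sup>2)"
      by (simp add: \<psi>_def power_mult_distrib right_diff_distrib)
    have "(1 - 2 * T * s * \<bar>z\<bar> + T\<^sup>2 * s\<^sup>2 * z\<^sup>2) / (1 - s) - 1 =
        s * ((1 - 2 * T * \<bar>z\<bar> + T\<^sup>2 * s * z\<^sup>2) / (1 - s))"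
      using s by (simp add: field_simps power2_eq_square)
    then have "(1 - 2 * T * s * \<bar>z\<bar> + T\<^sup>2 * s\<^sup>2 * z\<^sup>2) / (1 - s) - 1 - s\<^sup>2 * z\<^sup>2 = s * lens_profile T s z"
      unfolding lens_profile_def by (simp add: power2_eq_square right_diff_distrib)
    then show ?thesis unfolding 1 by simp
  qed
  have nonneg: "lens_integrand d T s z \<ge> 0" for z by (auto simp: lens_integrand_def indicator_def)
  let ?V = "\<integral>z. lens_integrand d T s z \<partial>lborel"
  have V: "(\<integral>\<^sup>+z. ennreal (lens_integrand d T s z) \<partial>lborel) = ennreal ?V"
    by (intro nn_integral_eq_integral integrable_lens_integrand T s AE_I2 nonneg)
  have Vnn: "?V \<ge> 0" by (intro integral_nonneg_AE AE_I2 nonneg)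
  have inner_int: "(\<integral>\<^sup>+y. ?H p y \<partial>lborel) =
      ennreal (unit_ball_vol (real d) * s * sqrt s ^ d * ?V) * (ennreal (p ^ Suc d) * indicator {0<..<1} p)" for p
  proof (cases "0 < p \<and> p < 1")
    case True
    then have p: "p > 0" by simp
    have psim: "(\<lambda>y. \<psi> p y) \<in> borel_measurable borel" unfolding \<psi>_def by measurable
    note [measurable] = psim
    have pt: "sqrt (\<psi> p (p * s * z)) ^ d * indicator {y. T * \<bar>y\<bar> \<le> p \<and> \<psi> p y \<ge> 0} (p * s * z) =
        p ^ d * sqrt s ^ d * lens_integrand d T s z" for z
    proof -
      have "sqrt (\<psi> p (p * s * z)) ^ d = p ^ d * sqrt s ^ d * sqrt (lens_profile T s z) ^ d"
        using p by (simp add: scale real_sqrt_mult power_mult_distrib)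
      moreover have "T * \<bar>p * s * z\<bar> \<le> p \<longleftrightarrow> T * s * \<bar>z\<bar> \<le> 1"
      proof -
        have *: "T * \<bar>p * s * z\<bar> = p * (T * s * \<bar>z\<bar>)" using p s by (simp add: abs_mult)
        have "p * (T * s * \<bar>z\<bar>) \<le> p * 1 \<longleftrightarrow> T * s * \<bar>z\<bar> \<le> 1" by (rule mult_le_cancel_left_pos[OF p])
        then show ?thesis by (simp only: * mult_1_right)
      qed
      moreover have "\<psi> p (p * s * z) \<ge> 0 \<longleftrightarrow> lens_profile T s z \<ge> 0"
        using mult_le_cancel_left_pos[of "p\<^sup>2 * s" 0 "lens_profile T s z"] p s by (simp add: scale)
      ultimately show ?thesis by (simp add: lens_integrand_def indicator_def)
    qed
    have "(\<integral>\<^sup>+y. ?H p y \<partial>lborel) =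
       (\<integral>\<^sup>+y. ennreal (unit_ball_vol (real d) * (sqrt (\<psi> p y) ^ d * indicator {y. T * \<bar>y\<bar> \<le> p \<and> \<psi> p y \<ge> 0} y)) \<partial>lborel)"
      using True by simp
    also have "\<dots> = ennreal \<bar>p * s\<bar> * (\<integral>\<^sup>+z. ennreal (unit_ball_vol (real d) * (sqrt (\<psi> p (0 + (p * s) * z)) ^ d * indicator {y. T * \<bar>y\<bar> \<le> p \<and> \<psi> p y \<ge> 0} (0 + (p * s) * z))) \<partial>lborel)"
      using p s by (intro nn_integral_real_affine) auto
    also have "\<dots> = ennreal (p * s) * (\<integral>\<^sup>+z. ennreal (unit_ball_vol (real d) * (p ^ d * sqrt s ^ d * lens_integrand d T s z)) \<partial>lborel)"
      using p s by (simp only: add_0 pt abs_of_pos[OF mult_pos_pos])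
    also have "\<dots> = ennreal (p * s) * (\<integral>\<^sup>+z. ennreal (unit_ball_vol (real d) * (p ^ d * sqrt s ^ d)) * ennreal (lens_integrand d T s z) \<partial>lborel)"
      using p s by (simp add: nonneg ennreal_mult''[symmetric] mult.assoc)
    also have "\<dots> = ennreal (p * s) * (ennreal (unit_ball_vol (real d) * (p ^ d * sqrt s ^ d)) * ennreal ?V)"
      by (subst nn_integral_cmult) (simp_all only: V, measurable)
    also have "\<dots> = ennreal (unit_ball_vol (real d) * s * sqrt s ^ d * ?V) * (ennreal (p ^ Suc d) * indicator {0<..<1} p)"
      using True s Vnn by (simp add: ennreal_mult'[symmetric] ennreal_mult''[symmetric] mult_ac)
    finally show ?thesis .
  qed auto
  have "emeasure lborel ?S = emeasure lborel (f -` ?S)"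
    by (rule emeasure_lborel_orthogonal_vimage[OF f(1) Sm, symmetric])
  also have "\<dots> = emeasure lborel {y. Q (y \<bullet> b) (y \<bullet> b') (\<Sum>i\<in>?I. (y \<bullet> i)\<^sup>2)}" by (simp only: eq)
  also have "\<dots> = (\<integral>\<^sup>+p. \<integral>\<^sup>+y. emeasure ?M
      {f \<in> space ?M. Q p y (\<Sum>i\<in>?I. (f i)\<^sup>2)} \<partial>lborel \<partial>lborel)"
    by (rule emeasure_lborel_section2[OF b Qm])
  also have "\<dots> = (\<integral>\<^sup>+p. ennreal (unit_ball_vol (real d) * s * sqrt s ^ d * ?V) * (ennreal (p ^ Suc d) * indicator {0<..<1} p) \<partial>lborel)"
    by (simp only: inner_meas inner_int)
  also have "\<dots> = ennreal (unit_ball_vol (real d) * s * sqrt s ^ d * ?V) * ennreal (1 / real (Suc (Suc d)))"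
    by (subst nn_integral_cmult) (auto simp: nn_integral_power_01 simp del: of_nat_Suc power_Suc)
  also have "Suc (Suc d) = DIM('a)" using dim by (simp add: d_def)
  also have "ennreal (unit_ball_vol (real d) * s * sqrt s ^ d * ?V) * ennreal (1 / real (DIM('a))) =
      ennreal (unit_ball_vol (real d) * s * sqrt s ^ d / real (DIM('a)) * ?V)"
    using s Vnn by (simp add: ennreal_mult''[symmetric] mult_ac)
  finally show ?thesis by (simp only: \<tau>_def T_def)
qed

lemma sphere_lens_asymp:
  fixes u v :: "'a::euclidean_space"
  assumes u: "norm u = 1" and v: "norm v = 1" and dim: "DIM('a) \<ge> 2"
    and co: "co > 0" "co\<^sup>2 = (1 + u \<bullet> v) / 2" and si: "si > 0" "si\<^sup>2 = (1 - u \<bullet> v) / 2"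
  shows "((\<lambda>s. measure sphere_uniform {x. u \<bullet> x \<ge> co * sqrt (1 - s) \<and> v \<bullet> x \<ge> co * sqrt (1 - s)} / s powr (real (DIM('a)) / 2)) \<longlongrightarrow>
    unit_ball_vol (real (DIM('a) - 2)) / real (DIM('a)) * (2 / (real (DIM('a)) * (si / co))) / unit_ball_vol (real (DIM('a)))) (at_right 0)"
proof (rule tendsto_narrow_cone)
  define d where "d = DIM('a) - 2"
  have dd: "d + 2 = DIM('a)" using dim by (simp add: d_def)
  let ?I = "\<lambda>s. \<integral>z. lens_integrand d (si / co) s z \<partial>lborel"
  let ?V = "\<lambda>s. unit_ball_vol (real d) * s * sqrt s ^ d / real (DIM('a)) * ?I s"
  have small: "\<forall>\<^sub>F s::real in at_right 0. 0 < s \<and> s \<le> 1 / 2"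
    unfolding eventually_at_right_field by (intro exI[of _ "1 / 2"]) auto
  show "unit_ball_vol (real (DIM('a))) > 0" by simp
  define m where "m = (1 / (2 * co)) *\<^sub>R (u + v)"
  have "norm (u + v) = 2 * co" using norm_add_unit[OF u v co] .
  then have nm: "norm m = 1" using co by (simp add: m_def)
  show "\<forall>\<^sub>F s in at_right 0.
      measure sphere_uniform {x. u \<bullet> x \<ge> co * sqrt (1 - s) \<and> v \<bullet> x \<ge> co * sqrt (1 - s)} \<le> ?V s / unit_ball_vol (real (DIM('a))) \<and>
      sqrt (1 - s) ^ DIM('a) * ?V s / unit_ball_vol (real (DIM('a))) \<le>
        measure sphere_uniform {x. u \<bullet> x \<ge> co * sqrt (1 - s) \<and> v \<bullet> x \<ge> co * sqrt (1 - s)}"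
    using small
  proof eventually_elim
    case (elim s)
    let ?E = "{x. co * sqrt (1 - s) * norm x \<le> u \<bullet> x \<and> co * sqrt (1 - s) * norm x \<le> v \<bullet> x}"
    have "measure sphere_uniform {x. u \<bullet> x \<ge> co * sqrt (1 - s) \<and> v \<bullet> x \<ge> co * sqrt (1 - s)} = measure sphere_uniform ?E"
      by (rule measure_eq_AE) (use AE_sphere_uniform in \<open>auto elim: eventually_mono\<close>)
    moreover have "t *\<^sub>R x \<in> ?E \<longleftrightarrow> x \<in> ?E" if "t > 0" for t x by (simp only: mem_Collect_eq norm_inner_scaleR_iff[OF that])
    moreover have "?E \<in> sets borel" by measurable
    moreover have "emeasure lborel {x \<in> ?E. 0 < x \<bullet> m \<and> x \<bullet> m < 1} = ennreal (?V s)"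
      using elim by (intro emeasure_slab_lens u v dim co si m_def d_def) auto
    moreover have "?I s \<ge> 0" by (intro integral_nonneg_AE AE_I2) (auto simp: lens_integrand_def indicator_def)
    then have "?V s \<ge> 0" using elim by (intro mult_nonneg_nonneg) auto
    moreover have "sqrt (1 - s) * norm x \<le> x \<bullet> m" if "x \<in> ?E" for x
    proof -
      \<comment> \<open>Adding the two cone conditions leaves only the component along m, which is
        the narrowness condition around m.\<close>
      have "2 * co * (sqrt (1 - s) * norm x) \<le> u \<bullet> x + v \<bullet> x" using that by simp
      also have "\<dots> = 2 * co * (x \<bullet> m)" using co by (simp add: m_def inner_add_right inner_commute)
      finally show ?thesis using co by (simp add: mult_le_cancel_left_pos)
    qed
    ultimately show ?case
      using measure_sphere_uniform_narrow_cone[of ?E m "sqrt (1 - s)" "?V s"] elim nm by force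
  qed
  have "((\<lambda>s. unit_ball_vol (real d) / real (DIM('a)) * ?I s) \<longlongrightarrow>
      unit_ball_vol (real d) / real (DIM('a)) * (2 / (real (d + 2) * (si / co)))) (at_right 0)"
    by (intro tendsto_mult tendsto_const lens_integral_lim) (use co si in auto)
  moreover have "\<forall>\<^sub>F s in at_right 0. unit_ball_vol (real d) / real (DIM('a)) * ?I s = ?V s / s powr (real (DIM('a)) / 2)"
    using small
  proof eventually_elim
    case (elim s)
    have "s powr (real (DIM('a)) / 2) = s powr (1 + real d / 2)" by (simp flip: dd add: add_divide_distrib)
    also have "\<dots> = s * sqrt s ^ d" using elim by (simp add: powr_add sqrt_power_eq_powr)
    finally show ?case using elim by simp
  qed
  ultimately show "((\<lambda>s. ?V s / s powr (real (DIM('a)) / 2)) \<longlongrightarrow>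
      unit_ball_vol (real (DIM('a) - 2)) / real (DIM('a)) * (2 / (real (DIM('a)) * (si / co)))) (at_right 0)"
    unfolding d_def[symmetric] dd by (rule Lim_transform_eventually)
qed

section \<open>Overlaps of the caps and reduction to the radial part\<close>

text \<open>The excess of the Bonferroni sum over the union when the radius is fixed at r: a
  spherical quantity at level t = c / r.\<close>

definition overlap :: "nat \<Rightarrow> (nat \<Rightarrow> 'a::euclidean_space) \<Rightarrow> real \<Rightarrow> real" where
  "overlap N u t = (\<Sum>i=1..N. measure sphere_uniform {x. u i \<bullet> x \<ge> t}) -
     measure sphere_uniform {x. \<exists>i\<in>{1..N}. u i \<bullet> x \<ge> t}"

text \<open>Counts hits beyond the first. This pointwise count replaces inclusion-exclusion: it
  vanishes for at most one hit and equals 1 for exactly two.\<close>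

definition excess :: "nat set \<Rightarrow> real" where
  "excess A = real (card A) - (if A = {} then 0 else 1)"

lemma excess_nonneg: "finite A \<Longrightarrow> 0 \<le> excess A"
  by (auto simp: excess_def Suc_le_eq card_gt_0_iff)

lemma excess_mono: "finite B \<Longrightarrow> A \<subseteq> B \<Longrightarrow> excess A \<le> excess B"
  using card_mono[of B A] by (auto simp: excess_def Suc_le_eq card_gt_0_iff)

lemma excess_eq_0: "(\<And>i j. i \<in> A \<Longrightarrow> j \<in> A \<Longrightarrow> i = j) \<Longrightarrow> excess A = 0"
proof -
  assume *: "\<And>i j. i \<in> A \<Longrightarrow> j \<in> A \<Longrightarrow> i = j"
  show "excess A = 0"
  proof (cases "A = {}")
    case False
    then obtain a where "a \<in> A" by blast
    then have "A = {a}" using * by blast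
    then show ?thesis by (simp add: excess_def)
  qed (simp add: excess_def)
qed

text \<open>Adding the inequalities and applying Cauchy-Schwarz limits the level at which one
  direction can hit two points; this is where the critical level comes from.\<close>

lemma two_hits:
  fixes x a b :: "'a::real_inner"
  assumes "norm x = 1" "a \<bullet> x \<ge> t" "b \<bullet> x \<ge> t"
  shows "2 * t \<le> norm (a + b)"
  using norm_cauchy_schwarz[of "a + b" x] assms by (simp add: inner_add_left)

lemma overlap_eq_integral:
  fixes u :: "nat \<Rightarrow> 'a::euclidean_space"
  shows "overlap N u t = (\<integral>x. excess {i \<in> {1..N}. u i \<bullet> x \<ge> t} \<partial>sphere_uniform)"
    and "integrable sphere_uniform (\<lambda>x. excess {i \<in> {1..N}. u i \<bullet> x \<ge> t})"
proof -
  interpret prob_space "sphere_uniform :: 'a measure" by (rule prob_space_sphere_uniform)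
  have eq: "excess {i \<in> {1..N}. u i \<bullet> x \<ge> t} = (\<Sum>i=1..N. indicator {x. u i \<bullet> x \<ge> t} x) -
     indicator {x. \<exists>i\<in>{1..N}. u i \<bullet> x \<ge> t} x" for x
  proof -
    have "(\<Sum>i=1..N. indicator {x. u i \<bullet> x \<ge> t} x :: real) = real (card {i \<in> {1..N}. u i \<bullet> x \<ge> t})"
      by (simp add: indicator_def of_bool_def sum.If_cases Int_def)
    then show ?thesis by (auto simp: excess_def indicator_def)
  qed
  have s: "{x. u i \<bullet> x \<ge> t} \<in> sets borel" "{x. \<exists>i\<in>{1..N}. u i \<bullet> x \<ge> t} \<in> sets borel" for i
    by measurable
  have i: "integrable sphere_uniform (\<lambda>x. indicator {x. u i \<bullet> x \<ge> t} x :: real)"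
    "integrable sphere_uniform (\<lambda>x. indicator {x. \<exists>i\<in>{1..N}. u i \<bullet> x \<ge> t} x :: real)" for i
    using s by (auto intro!: integrable_real_indicator simp: less_top[symmetric])
  show "integrable sphere_uniform (\<lambda>x. excess {i \<in> {1..N}. u i \<bullet> x \<ge> t})"
    unfolding eq using i by (intro Bochner_Integration.integrable_diff Bochner_Integration.integrable_sum)
  show "overlap N u t = (\<integral>x. excess {i \<in> {1..N}. u i \<bullet> x \<ge> t} \<partial>sphere_uniform)"
    unfolding eq overlap_def using i s
    by (subst Bochner_Integration.integral_diff, intro Bochner_Integration.integrable_sum)
      (auto simp: Bochner_Integration.integral_sum)
qed

lemma overlap_nonneg: "0 \<le> overlap N u t"
  unfolding overlap_eq_integral(1) by (intro integral_nonneg_AE AE_I2 excess_nonneg) auto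

text \<open>A difference of two decreasing functions, whose monotonicity is seen only pointwise:
  raising t shrinks the set of hits, and \<open>excess\<close> is monotone. It gives measurability
  in t and the value at the critical level later.\<close>

lemma overlap_antimono: "t \<le> t' \<Longrightarrow> overlap N u t' \<le> overlap N u t"
  unfolding overlap_eq_integral(1)
  by (intro integral_mono overlap_eq_integral(2) excess_mono) auto

lemma overlap_le: "overlap N (u :: nat \<Rightarrow> 'a::euclidean_space) t \<le> real N"
proof -
  interpret prob_space "sphere_uniform :: 'a measure" by (rule prob_space_sphere_uniform)
  have "(\<Sum>i=1..N. prob {x. u i \<bullet> x \<ge> t}) \<le> (\<Sum>i=1..N. 1)" by (intro sum_mono) auto
  also have "\<dots> = real N" by simp
  finally show ?thesis using measure_nonneg[of sphere_uniform "{x. \<exists>i\<in>{1..N}. u i \<bullet> x \<ge> t}"]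
    unfolding overlap_def by linarith
qed

section \<open>Closest pairs and the critical level \<open>co\<close>\<close>

locale sphere_points =
  fixes N :: nat and u :: "nat \<Rightarrow> 'a::euclidean_space"
  assumes N: "N \<ge> 2" and unit: "\<And>i. i \<in> {1..N} \<Longrightarrow> norm (u i) = 1" and inj: "inj_on u {1..N}"
begin

abbreviation "rho \<equiv> rho_star N u"

definition co :: real where "co = sqrt ((1 + rho) / 2)"

definition closest :: "(nat \<times> nat) set" where
  "closest = {(i, j). i \<in> {1..N} \<and> j \<in> {1..N} \<and> u i \<bullet> u j = rho}"

lemma inner_self: "i \<in> {1..N} \<Longrightarrow> u i \<bullet> u i = 1"
  using unit by (simp add: norm_eq_1[symmetric])

lemma norm_add_sq: "i \<in> {1..N} \<Longrightarrow> j \<in> {1..N} \<Longrightarrow> (norm (u i + u j))\<^sup>2 = 2 + 2 * (u i \<bullet> u j)"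
  by (simp add: power2_norm_eq_inner inner_add_left inner_add_right inner_self inner_commute[of "u j" "u i"])

lemma norm_diff_sq: "i \<in> {1..N} \<Longrightarrow> j \<in> {1..N} \<Longrightarrow> (norm (u i - u j))\<^sup>2 = 2 - 2 * (u i \<bullet> u j)"
  by (simp add: power2_norm_eq_inner inner_diff_left inner_diff_right inner_self inner_commute[of "u j" "u i"])

lemma finite_inners: "finite {u i \<bullet> u j | i j. i \<in> {1..N} \<and> j \<in> {1..N} \<and> i \<noteq> j}" (is "finite ?S")
  by (rule finite_subset[of _ "(\<lambda>(i, j). u i \<bullet> u j) ` ({1..N} \<times> {1..N})"]) auto

lemma rho_ge: "i \<in> {1..N} \<Longrightarrow> j \<in> {1..N} \<Longrightarrow> i \<noteq> j \<Longrightarrow> u i \<bullet> u j \<le> rho"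
  unfolding rho_star_def by (intro Max_ge finite_inners) auto

lemma rho_attained: obtains i j where "i \<in> {1..N}" "j \<in> {1..N}" "i \<noteq> j" "u i \<bullet> u j = rho"
proof -
  have "u 1 \<bullet> u 2 \<in> {u i \<bullet> u j | i j. i \<in> {1..N} \<and> j \<in> {1..N} \<and> i \<noteq> j}"
    using N by (intro CollectI exI[of _ 1] exI[of _ 2]) auto
  then have "rho \<in> {u i \<bullet> u j | i j. i \<in> {1..N} \<and> j \<in> {1..N} \<and> i \<noteq> j}"
    unfolding rho_star_def using finite_inners by (intro Max_in) auto
  then show ?thesis using that by auto
qed

lemma rho_less_1: "rho < 1" and rho_ge_m1: "rho \<ge> -1"
proof -
  obtain i j where ij: "i \<in> {1..N}" "j \<in> {1..N}" "i \<noteq> j" "u i \<bullet> u j = rho" by (rule rho_attained)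
  have "u i \<noteq> u j" using ij inj by (auto dest: inj_onD)
  then have "(norm (u i - u j))\<^sup>2 > 0" by simp
  then show "rho < 1" using norm_diff_sq[OF ij(1,2)] ij(4) by linarith
  have "(norm (u i + u j))\<^sup>2 \<ge> 0" by simp
  then show "rho \<ge> -1" using norm_add_sq[OF ij(1,2)] ij(4) by linarith
qed

lemma co_nonneg: "co \<ge> 0" and co_less_1: "co < 1" and co_sq: "co\<^sup>2 = (1 + rho) / 2"
  using rho_less_1 rho_ge_m1 by (auto simp: co_def)

text \<open>\<open>num_closest\<close> does not exclude i = j explicitly; the diagonal drops out
  because its inner product is 1, which exceeds rho.\<close>

lemma closest_distinct: "(i, j) \<in> closest \<Longrightarrow> i \<noteq> j"
  using inner_self rho_less_1 by (auto simp: closest_def)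

lemma finite_closest: "finite closest"
  by (rule finite_subset[of _ "{1..N} \<times> {1..N}"]) (auto simp: closest_def)

lemma card_closest: "card closest = num_closest N u"
  by (simp add: closest_def num_closest_def)

lemma card_closest_pos: "card closest > 0"
proof -
  obtain i j where "i \<in> {1..N}" "j \<in> {1..N}" "i \<noteq> j" "u i \<bullet> u j = rho" by (rule rho_attained)
  then have "(i, j) \<in> closest" by (simp add: closest_def)
  then show ?thesis using finite_closest by (auto simp: card_gt_0_iff)
qed

lemma norm_add_le: "i \<in> {1..N} \<Longrightarrow> j \<in> {1..N} \<Longrightarrow> i \<noteq> j \<Longrightarrow> norm (u i + u j) \<le> 2 * co"
  using rho_ge[of i j] norm_add_sq[of i j] co_sq co_nonneg
  by - (rule power2_le_imp_le, auto simp: power_mult_distrib)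

lemma overlap_eq_0:
  assumes "t > co"
  shows "overlap N u t = 0"
proof -
  have "AE x in sphere_uniform. excess {i \<in> {1..N}. u i \<bullet> x \<ge> t} = 0"
    using AE_sphere_uniform
  proof eventually_elim
    case (elim x)
    show ?case
    proof (rule excess_eq_0, rule ccontr)
      fix i j assume ij: "i \<in> {i \<in> {1..N}. u i \<bullet> x \<ge> t}" "j \<in> {i \<in> {1..N}. u i \<bullet> x \<ge> t}" "i \<noteq> j"
      then show False using two_hits[OF elim, of t "u i" "u j"] norm_add_le[of i j] assms by auto
    qed
  qed
  then show ?thesis unfolding overlap_eq_integral(1) by (rule integral_eq_zero_AE)
qed

lemma sqrt_lim: "((\<lambda>s. co * sqrt (1 - s)) \<longlongrightarrow> co) (at_right 0)"
proof -
  have "((\<lambda>s. co * sqrt (1 - s)) \<longlongrightarrow> co * sqrt (1 - 0)) (at_right 0)" by (intro tendsto_intros)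
  then show ?thesis by simp
qed

text \<open>Finitely many pairs leave a gap: for pairs that are not closest the sum has norm
  strictly below 2 co, and co sqrt (1 - s) tends to co. By \<open>two_hits\<close> such pairs cannot
  be hit together for small s.\<close>

lemma only_closest:
  "\<forall>\<^sub>F s in at_right 0. \<forall>(i, j) \<in> {1..N} \<times> {1..N}. i \<noteq> j \<longrightarrow> (i, j) \<notin> closest \<longrightarrow>
     norm (u i + u j) < 2 * (co * sqrt (1 - s))"
proof (rule eventually_ball_finite)
  show "\<forall>ij\<in>{1..N} \<times> {1..N}. \<forall>\<^sub>F s in at_right 0. case ij of (i, j) \<Rightarrow> i \<noteq> j \<longrightarrow> (i, j) \<notin> closest \<longrightarrow>
     norm (u i + u j) < 2 * (co * sqrt (1 - s))"
  proof clarify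
    fix i j assume ij: "i \<in> {1..N}" "j \<in> {1..N}"
    show "\<forall>\<^sub>F s in at_right 0. i \<noteq> j \<longrightarrow> (i, j) \<notin> closest \<longrightarrow> norm (u i + u j) < 2 * (co * sqrt (1 - s))"
    proof (cases "i \<noteq> j \<and> (i, j) \<notin> closest")
      case True
      then have "u i \<bullet> u j < rho" using rho_ge[of i j] ij by (auto simp: closest_def)
      then have "(norm (u i + u j))\<^sup>2 < (2 * co)\<^sup>2"
        using norm_add_sq[OF ij] co_sq by (simp add: power_mult_distrib)
      then have "norm (u i + u j) < 2 * co" using co_nonneg by - (rule power2_less_imp_less, auto)
      moreover have "((\<lambda>s. 2 * (co * sqrt (1 - s))) \<longlongrightarrow> 2 * co) (at_right 0)"
        by (intro tendsto_mult tendsto_const sqrt_lim)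
      ultimately have "\<forall>\<^sub>F s in at_right 0. norm (u i + u j) < 2 * (co * sqrt (1 - s))"
        by (intro order_tendstoD)
      then show ?thesis by eventually_elim simp
    qed auto
  qed
qed auto

text \<open>A point close to the faces of two different closest pairs would be close to both of their
  midpoints.\<close>

lemma no_triple:
  assumes co: "co > 0"
  shows "\<forall>\<^sub>F s in at_right 0. \<forall>(j, k) \<in> {1..N} \<times> {1..N}. j \<noteq> k \<longrightarrow>
     norm (u j - u k) > 4 * co * sqrt (2 - 2 * sqrt (1 - s))"
proof (rule eventually_ball_finite)
  show "\<forall>jk\<in>{1..N} \<times> {1..N}. \<forall>\<^sub>F s in at_right 0. case jk of (j, k) \<Rightarrow> j \<noteq> k \<longrightarrow>
     norm (u j - u k) > 4 * co * sqrt (2 - 2 * sqrt (1 - s))"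
  proof clarify
    fix j k assume jk: "j \<in> {1..N}" "k \<in> {1..N}"
    show "\<forall>\<^sub>F s in at_right 0. j \<noteq> k \<longrightarrow> norm (u j - u k) > 4 * co * sqrt (2 - 2 * sqrt (1 - s))"
    proof (cases "j = k")
      case False
      then have "norm (u j - u k) > 0" using inj jk by (auto dest: inj_onD)
      moreover have "((\<lambda>s. 4 * co * sqrt (2 - 2 * sqrt (1 - s))) \<longlongrightarrow> 4 * co * sqrt (2 - 2 * sqrt (1 - 0))) (at_right 0)"
        by (intro tendsto_intros)
      ultimately have "\<forall>\<^sub>F s in at_right 0. norm (u j - u k) > 4 * co * sqrt (2 - 2 * sqrt (1 - s))"
        by (intro order_tendstoD(2)) auto
      then show ?thesis by eventually_elim simp
    qed auto
  qed
qed auto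

text \<open>Both 2 co x and u i + u j have norm 2 co, and the hypotheses bound their inner product
  below by (2 co)^2 tau; expanding the square gives the estimate.\<close>

lemma near_midpoint:
  assumes x: "norm x = 1" and ij: "i \<in> {1..N}" "j \<in> {1..N}" "u i \<bullet> u j = rho"
    and t: "u i \<bullet> x \<ge> co * \<tau>" "u j \<bullet> x \<ge> co * \<tau>" and co: "co > 0"
  shows "norm ((2 * co) *\<^sub>R x - (u i + u j)) \<le> 2 * co * sqrt (2 - 2 * \<tau>)"
proof -
  have xx: "x \<bullet> x = 1" using x by (simp add: norm_eq_1)
  have "(norm (u i + u j))\<^sup>2 = (2 * co)\<^sup>2"
    using norm_add_sq[OF ij(1,2)] ij(3) co_sq by (simp add: power_mult_distrib)
  then have "(u i + u j) \<bullet> (u i + u j) = (2 * co)\<^sup>2" by (simp add: power2_norm_eq_inner)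
  then have "(norm ((2 * co) *\<^sub>R x - (u i + u j)))\<^sup>2 = (2 * co)\<^sup>2 + (2 * co)\<^sup>2 - 4 * co * (u i \<bullet> x + u j \<bullet> x)"
    unfolding power2_norm_eq_inner inner_diff_left inner_diff_right
    using xx by (simp add: power2_eq_square inner_add_left inner_add_right inner_commute algebra_simps)
  also have "\<dots> \<le> (2 * co)\<^sup>2 + (2 * co)\<^sup>2 - 4 * co * (co * \<tau> + co * \<tau>)"
    using t co by (intro diff_left_mono mult_left_mono add_mono) auto
  also have "\<dots> = (2 * co)\<^sup>2 * (2 - 2 * \<tau>)" by (simp add: power2_eq_square algebra_simps)
  finally have "sqrt ((norm ((2 * co) *\<^sub>R x - (u i + u j)))\<^sup>2) \<le> sqrt ((2 * co)\<^sup>2 * (2 - 2 * \<tau>))"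
    by (rule real_sqrt_le_mono)
  then show ?thesis using co by (simp add: real_sqrt_mult)
qed

text \<open>For small s any two hits form a closest pair and three hits are impossible. The single
  pair that may remain has excess 1 but occurs in \<open>closest\<close> in both orders, hence the
  factor 2.\<close>

lemma excess_eq_pairs:
  assumes co: "co > 0"
  shows "\<forall>\<^sub>F s in at_right 0. \<forall>x. norm x = 1 \<longrightarrow>
    2 * excess {i \<in> {1..N}. u i \<bullet> x \<ge> co * sqrt (1 - s)} =
    (\<Sum>(i, j)\<in>closest. indicator {x. u i \<bullet> x \<ge> co * sqrt (1 - s) \<and> u j \<bullet> x \<ge> co * sqrt (1 - s)} x)"
  using only_closest no_triple[OF co]
proof (eventually_elim, intro allI impI)
  fix s and x :: 'a
  assume oc: "\<forall>(i, j) \<in> {1..N} \<times> {1..N}. i \<noteq> j \<longrightarrow> (i, j) \<notin> closest \<longrightarrow> norm (u i + u j) < 2 * (co * sqrt (1 - s))"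
    and nt: "\<forall>(j, k) \<in> {1..N} \<times> {1..N}. j \<noteq> k \<longrightarrow> norm (u j - u k) > 4 * co * sqrt (2 - 2 * sqrt (1 - s))"
    and x: "norm x = 1"
  define A where "A = {i \<in> {1..N}. u i \<bullet> x \<ge> co * sqrt (1 - s)}"
  have fin: "finite A" by (simp add: A_def)
  have cl: "(i, j) \<in> closest" if "i \<in> A" "j \<in> A" "i \<noteq> j" for i j
    using two_hits[OF x, of "co * sqrt (1 - s)" "u i" "u j"] oc[rule_format, of "(i, j)"] that
    by (auto simp: A_def)
  have triple: "j = k" if "i \<in> A" "j \<in> A" "k \<in> A" "i \<noteq> j" "i \<noteq> k" for i j k
  proof (rule ccontr)
    assume "j \<noteq> k"
    have "norm ((2 * co) *\<^sub>R x - (u i + u j)) \<le> 2 * co * sqrt (2 - 2 * sqrt (1 - s))"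
      using cl[of i j] that x co by (intro near_midpoint) (auto simp: A_def closest_def)
    moreover have "norm ((2 * co) *\<^sub>R x - (u i + u k)) \<le> 2 * co * sqrt (2 - 2 * sqrt (1 - s))"
      using cl[of i k] that x co by (intro near_midpoint) (auto simp: A_def closest_def)
    \<comment> \<open>The common point u i cancels, so u j - u k is a difference of two vectors that
      \<open>near_midpoint\<close> has just shown to be short.\<close>
    moreover have "u j - u k = ((2 * co) *\<^sub>R x - (u i + u k)) - ((2 * co) *\<^sub>R x - (u i + u j))" by simp
    then have "norm (u j - u k) \<le> norm ((2 * co) *\<^sub>R x - (u i + u k)) + norm ((2 * co) *\<^sub>R x - (u i + u j))"
      by (metis norm_triangle_ineq4)
    ultimately have "norm (u j - u k) \<le> 4 * co * sqrt (2 - 2 * sqrt (1 - s))" by linarith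
    moreover have "norm (u j - u k) > 4 * co * sqrt (2 - 2 * sqrt (1 - s))"
      using nt[rule_format, of "(j, k)"] \<open>j \<noteq> k\<close> that by (simp add: A_def)
    ultimately show False by simp
  qed
  have "(\<Sum>(i, j)\<in>closest. indicator {x. u i \<bullet> x \<ge> co * sqrt (1 - s) \<and> u j \<bullet> x \<ge> co * sqrt (1 - s)} x) =
      (\<Sum>ij\<in>closest. if ij \<in> A \<times> A then 1 else 0 :: real)"
    by (intro sum.cong) (auto simp: A_def closest_def indicator_def)
  also have "\<dots> = real (card (closest \<inter> A \<times> A))"
    using finite_closest by (simp add: sum.If_cases Int_def)
  also have "closest \<inter> A \<times> A = {(i, j). i \<in> A \<and> j \<in> A \<and> i \<noteq> j}"
    using cl closest_distinct by auto
  also have "real (card {(i, j). i \<in> A \<and> j \<in> A \<and> i \<noteq> j}) = 2 * excess A"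
  proof (cases "\<exists>i\<in>A. \<exists>j\<in>A. i \<noteq> j")
    case True
    then obtain i j where ij: "i \<in> A" "j \<in> A" "i \<noteq> j" by blast
    then have A: "A = {i, j}" using triple[of i j] by blast
    have "{(i, j). i \<in> A \<and> j \<in> A \<and> i \<noteq> j} = {(i, j), (j, i)}" using ij unfolding A by auto
    then show ?thesis using ij unfolding A by (simp add: excess_def)
  next
    case False
    then have e: "{(i, j). i \<in> A \<and> j \<in> A \<and> i \<noteq> j} = {}" by auto
    have "excess A = 0" using False by (intro excess_eq_0) auto
    then show ?thesis unfolding e by simp
  qed
  finally show "2 * excess {i \<in> {1..N}. u i \<bullet> x \<ge> co * sqrt (1 - s)} =
    (\<Sum>(i, j)\<in>closest. indicator {x. u i \<bullet> x \<ge> co * sqrt (1 - s) \<and> u j \<bullet> x \<ge> co * sqrt (1 - s)} x)"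
    by (simp add: A_def)
qed

definition si :: real where "si = sqrt ((1 - rho) / 2)"

lemma si_pos: "si > 0" and si_sq: "si\<^sup>2 = (1 - rho) / 2"
  using rho_less_1 by (auto simp: si_def)

text \<open>All closest pairs share the inner product rho and therefore the same lens constant; the
  factor 1 / 2 undoes the count of ordered pairs.\<close>

lemma overlap_asymp:
  assumes co: "co > 0" and dim: "DIM('a) \<ge> 2"
  shows "((\<lambda>s. overlap N u (co * sqrt (1 - s)) / s powr (real (DIM('a)) / 2)) \<longlongrightarrow>
    real (card closest) / 2 * (unit_ball_vol (real (DIM('a) - 2)) / real (DIM('a)) *
      (2 / (real (DIM('a)) * (si / co))) / unit_ball_vol (real (DIM('a))))) (at_right 0)"
proof -
  interpret prob_space "sphere_uniform :: 'a measure" by (rule prob_space_sphere_uniform)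
  define K where "K = unit_ball_vol (real (DIM('a) - 2)) / real (DIM('a)) *
      (2 / (real (DIM('a)) * (si / co))) / unit_ball_vol (real (DIM('a)))"
  let ?E = "\<lambda>s ij. {x. u (fst ij) \<bullet> x \<ge> co * sqrt (1 - s) \<and> u (snd ij) \<bullet> x \<ge> co * sqrt (1 - s)}"
  let ?p = "\<lambda>s. s powr (real (DIM('a)) / 2)"
  have "((\<lambda>s. \<Sum>ij\<in>closest. prob (?E s ij) / ?p s) \<longlongrightarrow> (\<Sum>ij\<in>closest. K)) (at_right 0)"
  proof (rule tendsto_sum)
    fix ij assume "ij \<in> closest"
    then have ij: "fst ij \<in> {1..N}" "snd ij \<in> {1..N}" "u (fst ij) \<bullet> u (snd ij) = rho"
      by (auto simp: closest_def)
    then show "((\<lambda>s. prob (?E s ij) / ?p s) \<longlongrightarrow> K) (at_right 0)"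
      unfolding K_def using co dim si_pos si_sq co_sq unit by (intro sphere_lens_asymp) auto
  qed
  then have "((\<lambda>s. 1 / 2 * (\<Sum>ij\<in>closest. prob (?E s ij) / ?p s)) \<longlongrightarrow> 1 / 2 * (\<Sum>ij\<in>closest. K)) (at_right 0)"
    by (rule tendsto_mult[OF tendsto_const])
  moreover have "\<forall>\<^sub>F s in at_right 0. 1 / 2 * (\<Sum>ij\<in>closest. prob (?E s ij) / ?p s) = overlap N u (co * sqrt (1 - s)) / ?p s"
    using excess_eq_pairs[OF co]
  proof eventually_elim
    case (elim s)
    have s: "?E s ij \<in> sets borel" for ij by measurable
    have "2 * overlap N u (co * sqrt (1 - s)) = (\<integral>x. 2 * excess {i \<in> {1..N}. u i \<bullet> x \<ge> co * sqrt (1 - s)} \<partial>sphere_uniform)"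
      by (simp add: overlap_eq_integral(1))
    also have "\<dots> = (\<integral>x. (\<Sum>ij\<in>closest. indicator (?E s ij) x) \<partial>sphere_uniform)"
    proof (rule integral_cong_AE)
      show "AE x in sphere_uniform. 2 * excess {i \<in> {1..N}. u i \<bullet> x \<ge> co * sqrt (1 - s)} = (\<Sum>ij\<in>closest. indicator (?E s ij) x)"
        using AE_sphere_uniform by eventually_elim (use elim in \<open>auto simp: case_prod_beta\<close>)
      show "(\<lambda>x. 2 * excess {i \<in> {1..N}. u i \<bullet> x \<ge> co * sqrt (1 - s)}) \<in> borel_measurable sphere_uniform"
        using borel_measurable_integrable[OF overlap_eq_integral(2)] by (intro borel_measurable_times) auto
      show "(\<lambda>x. \<Sum>ij\<in>closest. indicator (?E s ij) x :: real) \<in> borel_measurable sphere_uniform"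
        using s by (intro borel_measurable_sum borel_measurable_indicator) auto
    qed
    also have "\<dots> = (\<Sum>ij\<in>closest. prob (?E s ij))"
      using s by (subst Bochner_Integration.integral_sum) (auto intro!: integrable_real_indicator simp: less_top[symmetric])
    finally have ov: "overlap N u (co * sqrt (1 - s)) = 1 / 2 * (\<Sum>ij\<in>closest. prob (?E s ij))" by simp
    show ?case unfolding ov by (simp add: sum_divide_distrib[symmetric])
  qed
  ultimately have "((\<lambda>s. overlap N u (co * sqrt (1 - s)) / ?p s) \<longlongrightarrow> 1 / 2 * (\<Sum>ij\<in>closest. K)) (at_right 0)"
    by (rule Lim_transform_eventually)
  moreover have "1 / 2 * (\<Sum>ij\<in>closest. K) = real (card closest) / 2 * K" by simp
  ultimately show ?thesis by (simp only: K_def)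
qed

end

section \<open>From asymptotics on the sphere to averages over R\<close>

lemma single_asymp:
  fixes u :: "nat \<Rightarrow> 'a::euclidean_space"
  assumes "\<And>i. i \<in> {1..N} \<Longrightarrow> norm (u i) = 1"
  shows "((\<lambda>s. (\<Sum>i=1..N. measure sphere_uniform {x. u i \<bullet> x \<ge> 1 * sqrt (1 - s)}) / s powr (real (DIM('a) - 1) / 2)) \<longlongrightarrow>
    real N * (unit_ball_vol (real (DIM('a) - 1)) / real (DIM('a)) / unit_ball_vol (real (DIM('a))))) (at_right 0)"
proof -
  have "((\<lambda>s. \<Sum>i=1..N. measure sphere_uniform {x. u i \<bullet> x \<ge> sqrt (1 - s)} / s powr (real (DIM('a) - 1) / 2)) \<longlongrightarrow>
    (\<Sum>i=1..N. unit_ball_vol (real (DIM('a) - 1)) / real (DIM('a)) / unit_ball_vol (real (DIM('a))))) (at_right 0)"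
    using assms by (intro tendsto_sum sphere_cap_asymp) auto
  then show ?thesis by (simp add: sum_divide_distrib)
qed

text \<open>With h = (c / k)^2 and s = 1 - h / x one has c / sqrt x = k sqrt (1 - s), which brings
  the radial average into the form of \<open>average_lim\<close>. It is applied with k = co to the
  overlap and with k = 1 to the single caps, hence the factor 1 in front of the root in
  \<open>single_asymp\<close>.\<close>

lemma (in laplace_tail) antimono_average_lim:
  fixes \<phi> :: "real \<Rightarrow> real"
  assumes a: "a > 0" and k: "k > 0" and anti: "\<And>t t'. t \<le> t' \<Longrightarrow> \<phi> t' \<le> \<phi> t"
    and nn: "\<And>t. 0 \<le> \<phi> t" and bdd: "\<And>t. \<phi> t \<le> B" and zero: "\<And>t. t > k \<Longrightarrow> \<phi> t = 0"
    and lim: "((\<lambda>s. \<phi> (k * sqrt (1 - s)) / s powr a) \<longlongrightarrow> K) (at_right 0)"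
  shows "((\<lambda>c. lam ((c / k)\<^sup>2) powr a / tail nu ((c / k)\<^sup>2) *
            (\<integral>x. indicator {0<..} x * \<phi> (c / sqrt x) \<partial>nu)) \<longlongrightarrow> K * Gamma (a + 1)) at_top"
proof -
  define A where "A s = \<phi> (k * sqrt (1 - s))" for s
  have [measurable]: "\<phi> \<in> borel_measurable borel"
    using anti by (rule borel_measurable_antimono)
  have Am: "A \<in> borel_measurable borel" unfolding A_def by measurable
  \<comment> \<open>The assumption \<open>zero\<close> covers only t > k. At t = k monotonicity
    gives A 0 <= A s, and A s tends to 0 because A s / s powr a converges.\<close>
  have A0: "A 0 = 0"
  proof -
    have pz: "((\<lambda>s. s powr a) \<longlongrightarrow> 0) (at_right 0)"
      using a by real_asymp
    have "((\<lambda>s. A s / s powr a * s powr a) \<longlongrightarrow> K * 0) (at_right 0)"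
      unfolding A_def by (intro tendsto_mult lim pz)
    moreover have "\<forall>\<^sub>F s in at_right 0. A 0 \<le> A s / s powr a * s powr a"
      using eventually_at_right_less[of 0]
    proof eventually_elim
      case (elim s)
      then show ?case using k by (auto simp: A_def intro!: anti mult_left_le)
    qed
    ultimately have "A 0 \<le> K * 0" by (intro tendsto_lowerbound[of _ _ "at_right 0"]) auto
    then show ?thesis using nn[of "k * sqrt (1 - 0)"] by (simp add: A_def)
  qed
  have "((\<lambda>h. lam h powr a / tail nu h * (\<integral>x. indicator {0<..} x * A (1 - h / x) \<partial>nu)) \<longlongrightarrow> K * Gamma (a + 1)) at_top"
  proof (rule average_lim[OF a Am])
    show "\<bar>A s\<bar> \<le> B" for s using nn bdd by (simp add: A_def)
    show "A s = 0" if "s \<le> 0" for s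
    proof (cases "s = 0")
      case False
      then have "1 < sqrt (1 - s)" using that by simp
      then have "k * 1 < k * sqrt (1 - s)" using k by (intro mult_strict_left_mono)
      then show ?thesis unfolding A_def by (intro zero) simp
    qed (simp add: A0)
    show "((\<lambda>s. A s / s powr a) \<longlongrightarrow> K) (at_right 0)" using lim by (simp add: A_def)
  qed
  moreover have "filterlim (\<lambda>c. (c / k)\<^sup>2) at_top at_top" using k by real_asymp
  ultimately have "((\<lambda>c. lam ((c / k)\<^sup>2) powr a / tail nu ((c / k)\<^sup>2) *
      (\<integral>x. indicator {0<..} x * A (1 - (c / k)\<^sup>2 / x) \<partial>nu)) \<longlongrightarrow> K * Gamma (a + 1)) at_top"
    by (rule filterlim_compose)
  moreover have "\<forall>\<^sub>F c in at_top. lam ((c / k)\<^sup>2) powr a / tail nu ((c / k)\<^sup>2) *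
      (\<integral>x. indicator {0<..} x * A (1 - (c / k)\<^sup>2 / x) \<partial>nu) =
      lam ((c / k)\<^sup>2) powr a / tail nu ((c / k)\<^sup>2) * (\<integral>x. indicator {0<..} x * \<phi> (c / sqrt x) \<partial>nu)"
    using eventually_gt_at_top[of 0]
  proof eventually_elim
    case (elim c)
    have *: "indicator {0<..} x * A (1 - (c / k)\<^sup>2 / x) = indicator {0<..} x * \<phi> (c / sqrt x)" for x
    proof (cases "x > 0")
      case True
      have "k * sqrt ((c / k)\<^sup>2 / x) = c / sqrt x" using k elim by (simp add: real_sqrt_divide)
      then show ?thesis by (simp add: A_def)
    qed auto
    show ?case by (simp only: *)
  qed
  ultimately show ?thesis by (rule Lim_transform_eventually)
qed

text \<open>By independence the law of the pair of radius and direction is a product, so the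
  direction can be integrated out at fixed radius. As the direction has norm 1 and the radius is
  positive almost surely, the radius is sqrt R, which leaves an integral over the law of R.\<close>

lemma spherically_contoured_measure:
  fixes \<xi> :: "'b \<Rightarrow> 'a::euclidean_space" and G :: "real \<Rightarrow> 'a set"
  assumes "prob_space P" and sc: "spherically_contoured P \<xi>"
    and G [measurable]: "\<And>t. G t \<in> sets borel"
    and scale: "\<And>r t y. r > 0 \<Longrightarrow> r *\<^sub>R y \<in> G t \<longleftrightarrow> y \<in> G (t / r)"
    and anti: "\<And>t t'. t \<le> t' \<Longrightarrow> G t' \<subseteq> G t"
  shows "measure P {\<omega> \<in> space P. \<xi> \<omega> \<in> G c} =
    (\<integral>x. indicator {0<..} x * measure sphere_uniform (G (c / sqrt x)) \<partial>distr P borel (\<lambda>\<omega>. (norm (\<xi> \<omega>))\<^sup>2))"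
    and "\<xi> \<in> borel_measurable P"
proof -
  interpret prob_space P by fact
  interpret S: prob_space "sphere_uniform :: 'a measure" by (rule prob_space_sphere_uniform)
  obtain r \<eta> where [measurable]: "r \<in> borel_measurable P" "\<eta> \<in> borel_measurable P"
    and rpos: "AE \<omega> in P. r \<omega> > 0" and eta: "distr P borel \<eta> = (sphere_uniform :: 'a measure)"
    and ind: "indep_set {r -` A \<inter> space P | A. A \<in> sets borel} {\<eta> -` B \<inter> space P | B. B \<in> sets borel}"
    and xi: "\<And>\<omega>. \<omega> \<in> space P \<Longrightarrow> \<xi> \<omega> = r \<omega> *\<^sub>R \<eta> \<omega>"
    using sc unfolding spherically_contoured_def by blast
  have "(\<lambda>\<omega>. r \<omega> *\<^sub>R \<eta> \<omega>) \<in> borel_measurable P" by measurable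
  then show xim [measurable]: "\<xi> \<in> borel_measurable P"
    by (rule measurable_cong[THEN iffD1, rotated]) (simp add: xi)
  interpret R: prob_space "distr P borel r" by (rule prob_space_distr) simp
  interpret RS: pair_prob_space "distr P borel r" "sphere_uniform :: 'a measure" ..
  \<comment> \<open>Independence is available for the generated sigma-algebras; the product law
    follows by comparing values on measurable rectangles.\<close>
  have joint: "distr P borel r \<Otimes>\<^sub>M sphere_uniform = distr P (borel \<Otimes>\<^sub>M borel) (\<lambda>\<omega>. (r \<omega>, \<eta> \<omega>))"
  proof (rule pair_measure_eqI)
    show "sigma_finite_measure (distr P borel r)" "sigma_finite_measure (sphere_uniform :: 'a measure)"
      by unfold_locales
    show "sets (distr P borel r \<Otimes>\<^sub>M sphere_uniform) = sets (distr P (borel \<Otimes>\<^sub>M borel) (\<lambda>\<omega>. (r \<omega>, \<eta> \<omega>)))"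
      by (simp cong: sets_pair_measure_cong)
    fix A B assume "A \<in> sets (distr P borel r)" "B \<in> sets (sphere_uniform :: 'a measure)"
    then have AB [measurable]: "A \<in> sets borel" "B \<in> sets borel" by auto
    have "emeasure (distr P borel r) A * emeasure sphere_uniform B =
        emeasure P (r -` A \<inter> space P) * emeasure P (\<eta> -` B \<inter> space P)"
      unfolding eta[symmetric] by (simp add: emeasure_distr)
    also have "\<dots> = ennreal (prob (r -` A \<inter> space P) * prob (\<eta> -` B \<inter> space P))"
      by (simp add: emeasure_eq_measure ennreal_mult)
    also have "prob (r -` A \<inter> space P) * prob (\<eta> -` B \<inter> space P) =
        prob ((r -` A \<inter> space P) \<inter> (\<eta> -` B \<inter> space P))"
      using AB by (intro indep_setD[OF ind, symmetric]) auto
    also have "(r -` A \<inter> space P) \<inter> (\<eta> -` B \<inter> space P) = (\<lambda>\<omega>. (r \<omega>, \<eta> \<omega>)) -` (A \<times> B) \<inter> space P"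
      by auto
    finally show "emeasure (distr P borel r) A * emeasure sphere_uniform B =
        emeasure (distr P (borel \<Otimes>\<^sub>M borel) (\<lambda>\<omega>. (r \<omega>, \<eta> \<omega>))) (A \<times> B)"
      by (simp add: emeasure_distr emeasure_eq_measure)
  qed
  define m where "m t = measure sphere_uniform (G t)" for t
  have mm [measurable]: "m \<in> borel_measurable borel" unfolding m_def
    by (intro borel_measurable_antimono S.finite_measure_mono) (auto dest: anti)
  have mb: "0 \<le> m t" "m t \<le> 1" for t by (auto simp: m_def)
  have set: "{z. fst z *\<^sub>R snd z \<in> G c} \<in> sets (borel \<Otimes>\<^sub>M borel :: (real \<times> 'a) measure)"
  proof -
    have "(\<lambda>z :: real \<times> 'a. fst z *\<^sub>R snd z) \<in> borel_measurable (borel \<Otimes>\<^sub>M borel)" by measurable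
    from measurable_sets[OF this G[of c]] show ?thesis by (simp add: space_pair_measure vimage_def)
  qed
  have "emeasure P {\<omega> \<in> space P. \<xi> \<omega> \<in> G c} = emeasure (distr P (borel \<Otimes>\<^sub>M borel) (\<lambda>\<omega>. (r \<omega>, \<eta> \<omega>))) {z. fst z *\<^sub>R snd z \<in> G c}"
    using set by (subst emeasure_distr) (auto simp: xi intro!: arg_cong[where f = "emeasure P"])
  also have "\<dots> = (\<integral>\<^sup>+\<rho>. emeasure sphere_uniform {y. \<rho> *\<^sub>R y \<in> G c} \<partial>distr P borel r)"
    unfolding joint[symmetric] using set
    by (subst S.emeasure_pair_measure_alt) (auto simp: vimage_def cong: sets_pair_measure_cong)
  also have "\<dots> = (\<integral>\<^sup>+\<rho>. ennreal (m (c / \<rho>)) \<partial>distr P borel r)"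
  proof (rule nn_integral_cong_AE)
    have "AE \<rho> in distr P borel r. \<rho> > 0" using rpos by (subst AE_distr_iff) auto
    then show "AE \<rho> in distr P borel r. emeasure sphere_uniform {y. \<rho> *\<^sub>R y \<in> G c} = ennreal (m (c / \<rho>))"
      by eventually_elim (simp add: scale m_def S.emeasure_eq_measure)
  qed
  also have "\<dots> = (\<integral>\<^sup>+\<omega>. ennreal (m (c / r \<omega>)) \<partial>P)" by (subst nn_integral_distr) auto
  also have "\<dots> = (\<integral>\<^sup>+\<omega>. ennreal (indicator {0<..} ((norm (\<xi> \<omega>))\<^sup>2) * m (c / sqrt ((norm (\<xi> \<omega>))\<^sup>2))) \<partial>P)"
  proof (rule nn_integral_cong_AE)
    have "AE \<omega> in P. norm (\<eta> \<omega>) = 1"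
      using AE_sphere_uniform[where 'a='a] unfolding eta[symmetric] by (subst (asm) AE_distr_iff) auto
    then show "AE \<omega> in P. ennreal (m (c / r \<omega>)) = ennreal (indicator {0<..} ((norm (\<xi> \<omega>))\<^sup>2) * m (c / sqrt ((norm (\<xi> \<omega>))\<^sup>2)))"
      using rpos AE_space by eventually_elim (simp add: xi)
  qed
  also have "\<dots> = (\<integral>\<^sup>+x. ennreal (indicator {0<..} x * m (c / sqrt x)) \<partial>distr P borel (\<lambda>\<omega>. (norm (\<xi> \<omega>))\<^sup>2))"
    by (subst nn_integral_distr) auto
  finally have "emeasure P {\<omega> \<in> space P. \<xi> \<omega> \<in> G c} =
      (\<integral>\<^sup>+x. ennreal (indicator {0<..} x * m (c / sqrt x)) \<partial>distr P borel (\<lambda>\<omega>. (norm (\<xi> \<omega>))\<^sup>2))" .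
  then have "measure P {\<omega> \<in> space P. \<xi> \<omega> \<in> G c} =
      enn2real (\<integral>\<^sup>+x. ennreal (indicator {0<..} x * m (c / sqrt x)) \<partial>distr P borel (\<lambda>\<omega>. (norm (\<xi> \<omega>))\<^sup>2))"
    by (simp add: measure_def)
  also have "\<dots> = (\<integral>x. indicator {0<..} x * m (c / sqrt x) \<partial>distr P borel (\<lambda>\<omega>. (norm (\<xi> \<omega>))\<^sup>2))"
    by (rule integral_eq_nn_integral[symmetric]) (auto simp: mb)
  finally show "measure P {\<omega> \<in> space P. \<xi> \<omega> \<in> G c} =
    (\<integral>x. indicator {0<..} x * measure sphere_uniform (G (c / sqrt x)) \<partial>distr P borel (\<lambda>\<omega>. (norm (\<xi> \<omega>))\<^sup>2))"
    by (simp only: m_def)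
qed

text \<open>Expressing the difference as one average of the nonnegative function
  \<open>overlap\<close> avoids subtracting two asymptotic expansions whose leading terms
  cancel.\<close>

lemma spherically_contoured_bonferroni:
  fixes \<xi> :: "'b \<Rightarrow> 'a::euclidean_space"
  assumes P: "prob_space P" and sc: "spherically_contoured P \<xi>" and N: "N \<ge> 1"
  defines "\<nu> \<equiv> distr P borel (\<lambda>\<omega>. (norm (\<xi> \<omega>))\<^sup>2)"
  shows "bonferroni P \<xi> N u c = (\<integral>x. indicator {0<..} x * (\<Sum>i=1..N. measure sphere_uniform {y. u i \<bullet> y \<ge> c / sqrt x}) \<partial>\<nu>)" (is ?A)
    and "bonferroni P \<xi> N u c - max_tail P \<xi> N u c = (\<integral>x. indicator {0<..} x * overlap N u (c / sqrt x) \<partial>\<nu>)" (is ?B)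
proof -
  interpret prob_space P by fact
  interpret S: prob_space "sphere_uniform :: 'a measure" by (rule prob_space_sphere_uniform)
  let ?U = "\<lambda>t. {y. \<exists>i\<in>{1..N}. u i \<bullet> y \<ge> t}"
  let ?m = "\<lambda>i x. indicator {0<..} x * measure sphere_uniform {y. u i \<bullet> y \<ge> c / sqrt x} :: real"
  let ?M = "\<lambda>x. indicator {0<..} x * measure sphere_uniform (?U (c / sqrt x)) :: real"
  have Us: "?U t \<in> sets borel" for t by measurable
  have hs: "{y. u i \<bullet> y \<ge> t} \<in> sets borel" for i t by measurable
  have sca: "t \<le> r * (u i \<bullet> y) \<longleftrightarrow> u i \<bullet> y \<ge> t / r" if "r > 0" for i r t y
    using that by (simp add: pos_divide_le_eq mult.commute)
  have single: "measure P {\<omega> \<in> space P. \<xi> \<omega> \<in> {y. u i \<bullet> y \<ge> c}} = (\<integral>x. ?m i x \<partial>\<nu>)" for i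
    unfolding \<nu>_def using hs by (intro spherically_contoured_measure(1)[OF P sc, where G = "\<lambda>t. {y. u i \<bullet> y \<ge> t}"]) (auto simp: sca)
  have union: "measure P {\<omega> \<in> space P. \<xi> \<omega> \<in> ?U c} = (\<integral>x. ?M x \<partial>\<nu>)"
    unfolding \<nu>_def using Us by (intro spherically_contoured_measure(1)[OF P sc, where G = ?U]) (auto simp: sca intro: order_trans)
  \<comment> \<open>The family of empty sets meets every condition on G, so the measurability
    conclusion can be extracted with it.\<close>
  have xim [measurable]: "\<xi> \<in> borel_measurable P"
    by (rule spherically_contoured_measure(2)[OF P sc, where G = "\<lambda>t. {}"]) auto
  interpret nu: prob_space \<nu> unfolding \<nu>_def by (rule prob_space_distr) measurable
  have meas: "(\<lambda>t. measure sphere_uniform (G t)) \<in> borel_measurable borel"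
    if "\<And>t. G t \<in> sets borel" "\<And>t t'. t \<le> t' \<Longrightarrow> G t' \<subseteq> G t" for G :: "real \<Rightarrow> 'a set"
    using that by (intro borel_measurable_antimono S.finite_measure_mono) auto
  have m1 [measurable]: "(\<lambda>t. measure sphere_uniform {y. u i \<bullet> y \<ge> t}) \<in> borel_measurable borel" for i
    using hs by (intro meas) auto
  have m2 [measurable]: "(\<lambda>t. measure sphere_uniform (?U t)) \<in> borel_measurable borel"
    using Us by (intro meas) (auto intro: order_trans)
  have i1: "integrable \<nu> (?m i)" for i
    by (rule nu.integrable_const_bound[where B = 1]) (auto simp: indicator_def \<nu>_def)
  have "?M \<in> borel_measurable \<nu>" unfolding \<nu>_def by measurable
  then have i2: "integrable \<nu> ?M"
    by (intro nu.integrable_const_bound[where B = 1] AE_I2) (auto simp: indicator_def)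
  have b: "bonferroni P \<xi> N u c = (\<Sum>i=1..N. \<integral>x. ?m i x \<partial>\<nu>)"
    unfolding bonferroni_def using single by simp
  show ?A
    unfolding b by (subst Bochner_Integration.integral_sum[symmetric]) (auto simp: i1 sum_distrib_left)
  have "Max ((\<lambda>i. u i \<bullet> y) ` {1..N}) \<ge> c \<longleftrightarrow> y \<in> ?U c" for y
    using N by (subst Max_ge_iff) auto
  then have "max_tail P \<xi> N u c = (\<integral>x. ?M x \<partial>\<nu>)"
    unfolding max_tail_def using union by simp
  then have "bonferroni P \<xi> N u c - max_tail P \<xi> N u c = (\<integral>x. (\<Sum>i=1..N. ?m i x) - ?M x \<partial>\<nu>)"
    unfolding b
    by (simp only: Bochner_Integration.integral_diff[OF Bochner_Integration.integrable_sum[OF i1] i2]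
        Bochner_Integration.integral_sum[OF i1])
  also have "\<dots> = (\<integral>x. indicator {0<..} x * overlap N u (c / sqrt x) \<partial>\<nu>)"
    by (intro Bochner_Integration.integral_cong) (auto simp: overlap_def sum_distrib_left right_diff_distrib)
  finally show ?B .
qed

section \<open>Asymptotics of the radial tail\<close>

lemma set_integrable_power:
  assumes "(W::real) \<ge> 1"
  shows "set_integrable lborel {1..W} (\<lambda>v. v powr (- b))"
proof -
  have "continuous_on {1..W} (\<lambda>v. v powr (- b))" by (intro continuous_intros) auto
  then show ?thesis by (rule borel_integrable_atLeastAtMost')
qed

text \<open>The two cases in the definition of g_beta are the power and the logarithmic primitive of
  v powr (-beta), evaluated between 1 and 1 / y.\<close>

lemma set_integral_power:
  assumes y: "0 < y" "y \<le> 1" and b: "b \<le> 1"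
  shows "(LBINT v:{1..inverse y}. v powr (- b)) = g_fun b y"
proof -
  have W: "1 \<le> inverse y" using y by (simp add: one_le_inverse)
  have "(LBINT v:{1..inverse y}. v powr (- b)) = integral {1..inverse y} (\<lambda>v. v powr (- b))"
    by (rule set_borel_integral_eq_integral(2)[OF set_integrable_power[OF W]])
  also have "\<dots> = g_fun b y"
  proof (rule integral_unique)
    show "((\<lambda>v. v powr (- b)) has_integral g_fun b y) {1..inverse y}"
    proof (cases "b < 1")
      case True
      have "((\<lambda>v. v powr (- b)) has_integral (inverse y powr (1 - b) / (1 - b) - 1 powr (1 - b) / (1 - b))) {1..inverse y}"
      proof (rule fundamental_theorem_of_calculus[OF W])
        fix x :: real assume "x \<in> {1..inverse y}"
        then have "((\<lambda>x. x powr (1 - b) / (1 - b)) has_real_derivative ((1 - b) * x powr (1 - b - 1) / (1 - b))) (at x within {1..inverse y})"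
          by (intro DERIV_cdivide has_field_derivative_at_within[OF has_real_derivative_powr]) auto
        then show "((\<lambda>x. x powr (1 - b) / (1 - b)) has_vector_derivative x powr (- b)) (at x within {1..inverse y})"
          using True by (simp add: has_real_derivative_iff_has_vector_derivative)
      qed
      moreover have "inverse y powr (1 - b) = y powr (b - 1)"
        using y by (simp add: powr_minus[symmetric] inverse_powr[symmetric] inverse_powr)
      ultimately show ?thesis using True by (simp add: g_fun_def diff_divide_distrib)
    next
      case False
      then have "b = 1" using b by simp
      have "((\<lambda>v. v powr (- b)) has_integral (ln (inverse y) - ln 1)) {1..inverse y}"
      proof (rule fundamental_theorem_of_calculus[OF W])
        fix x :: real assume "x \<in> {1..inverse y}"
        then show "(ln has_vector_derivative x powr (- b)) (at x within {1..inverse y})"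
          using \<open>b = 1\<close> by (auto simp: powr_minus powr_one inverse_eq_divide
            intro!: has_real_derivative_iff_has_vector_derivative[THEN iffD1] derivative_eq_intros)
      qed
      then show ?thesis using False y by (simp add: g_fun_def ln_inverse)
    qed
  qed
  finally show ?thesis .
qed

context tail_class
begin

lemma beta_le_1: "\<beta> \<le> 1"
  using exponent by auto

lemma ell0_ratio:
  assumes "ell0 \<sim>[at_top] ell"
  shows "((\<lambda>h. ell0 h / ell h) \<longlongrightarrow> 1) at_top"
  using assms ell_pos by (intro asymp_equivD_strong) (auto elim: eventually_mono)

lemma set_integrable_ell:
  assumes W: "W \<ge> 1"
  shows "\<forall>\<^sub>F h in at_top. set_integrable lborel {1..W} (density h)"
proof -
  obtain K D L where "K > (0::real)" "(D \<longlongrightarrow> K) at_top"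
    "\<And>x. tail nu x = D x * exp (- L x :: real)"
    and "increments L"
    by (rule tail_representation) blast
  note inc = this(4)[unfolded increments_def]
  from inc show ?thesis by eventually_elim (use W in blast)
qed

text \<open>Writing ell (h v) as ell0 h plus the rest, the first part integrates to the g_beta term,
  and the rest is r_beta by definition.\<close>

lemma exponent_split:
  assumes y: "0 < y" "y \<le> 1"
  shows "\<forall>\<^sub>F h in at_top. h powr (1 - \<beta>) * (LBINT v:{1..inverse y}. density h v) =
    h powr (1 - \<beta>) * ell0 h * g_fun \<beta> y + r_fun \<beta> ell ell0 h y"
proof -
  have W: "1 \<le> inverse y" using y by (simp add: one_le_inverse)
  show ?thesis using set_integrable_ell[OF W]
  proof eventually_elim
    case (elim h)
    have "(LBINT v:{1..inverse y}. (ell (h * v) - ell0 h) * v powr (- \<beta>)) =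
        (LBINT v:{1..inverse y}. density h v - ell0 h * v powr (- \<beta>))"
      by (simp add: left_diff_distrib)
    also have "\<dots> = (LBINT v:{1..inverse y}. density h v) - (LBINT v:{1..inverse y}. ell0 h * v powr (- \<beta>))"
      using elim set_integrable_power[OF W, of \<beta>] by (intro set_integral_diff) auto
    also have "(LBINT v:{1..inverse y}. ell0 h * v powr (- \<beta>)) = ell0 h * g_fun \<beta> y"
      using set_integral_power[OF y beta_le_1] by simp
    finally have eq: "(LBINT v:{1..inverse y}. (ell (h * v) - ell0 h) * v powr (- \<beta>)) =
        (LBINT v:{1..inverse y}. density h v) - ell0 h * g_fun \<beta> y" .
    show ?case unfolding r_fun_def eq by (simp add: right_diff_distrib mult.assoc)
  qed
qed

text \<open>On the compact range {1..1 / y} both ell (h v) and ell0 h lie within a small multiple of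
  ell h, the former uniformly in v, so their difference is small under the integral.\<close>

lemma r_fun_small:
  assumes y: "0 < y" "y < 1" and e0: "ell0 \<sim>[at_top] ell"
  shows "(\<lambda>h. r_fun \<beta> ell ell0 h y) \<in> o(\<lambda>h. h powr (1 - \<beta>) * ell0 h)"
proof (rule landau_o.smallI)
  fix c :: real assume c: "c > 0"
  define W where "W = inverse y"
  have W: "W > 1" using y by (simp add: W_def one_less_inverse)
  define G where "G = (LBINT v:{1..W}. v powr (- \<beta>))"
  have G: "G \<ge> 0" unfolding G_def set_lebesgue_integral_def by (intro integral_nonneg_AE AE_I2) (auto simp: indicator_def)
  \<comment> \<open>The bound e <= 1 yields ell h <= 2 ell0 h, and the final estimate asks for 2 e
    (G + 1) <= c.\<close>
  define e where "e = min 1 (c / (4 * (G + 1)))"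
  have "e \<le> c / (4 * (G + 1))" by (simp add: e_def)
  then have "e * (4 * (G + 1)) \<le> c" using G by (simp add: pos_le_divide_eq)
  moreover have "4 * e * (G + 1) = e * (4 * (G + 1))" by simp
  moreover have "e > 0" "e \<le> 1" using c G by (auto simp: e_def)
  ultimately have e: "e > 0" "e \<le> 1" "4 * e * (G + 1) \<le> c" by linarith+
  have "\<forall>\<^sub>F h in at_top. \<bar>ell0 h / ell h - 1\<bar> < e / 2"
    using tendstoD[OF ell0_ratio[OF e0], of "e / 2"] e by (simp add: dist_real_def)
  moreover have "\<forall>\<^sub>F h in at_top. \<forall>v\<in>{1..W}. \<bar>ell (h * v) / ell h - 1\<bar> \<le> e / 2"
    using e W by (intro slowly_varying_uniform ell_slowly_varying) auto
  moreover have "\<forall>\<^sub>F h in at_top. set_integrable lborel {1..W} (density h)"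
    using W by (intro set_integrable_ell) auto
  ultimately show "\<forall>\<^sub>F h in at_top. norm (r_fun \<beta> ell ell0 h y) \<le> c * norm (h powr (1 - \<beta>) * ell0 h)"
    using ell_pos
  proof eventually_elim
    case (elim h)
    have "1 / 2 \<le> ell0 h / ell h" using elim(1) e by linarith
    then have l0: "ell h \<le> 2 * ell0 h" using elim by (simp add: field_simps)
    have pw: "\<bar>ell (h * v) - ell0 h\<bar> \<le> e * ell h" if "v \<in> {1..W}" for v
    proof -
      have "\<bar>ell (h * v) / ell h - 1\<bar> \<le> e / 2" using elim(2) that by blast
      then have "\<bar>ell (h * v) / ell h - ell0 h / ell h\<bar> \<le> e" using elim(1) by linarith
      then have "\<bar>(ell (h * v) - ell0 h) / ell h\<bar> \<le> e" by (simp add: diff_divide_distrib)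
      then show ?thesis using elim by (simp add: pos_divide_le_eq)
    qed
    have pint: "set_integrable lborel {1..W} (\<lambda>v. v powr (- \<beta>))" using W by (intro set_integrable_power) auto
    have int: "set_integrable lborel {1..W} (\<lambda>v. (ell (h * v) - ell0 h) * v powr (- \<beta>))"
      using set_integral_diff(1)[OF elim(3) set_integrable_mult_right[OF pint], of "ell0 h"]
      by (simp add: left_diff_distrib)
    have "\<bar>LBINT v:{1..W}. (ell (h * v) - ell0 h) * v powr (- \<beta>)\<bar> \<le> (LBINT v:{1..W}. \<bar>(ell (h * v) - ell0 h) * v powr (- \<beta>)\<bar>)"
      using set_integral_norm_bound[OF int] by simp
    also have "\<dots> \<le> (LBINT v:{1..W}. (e * ell h) * v powr (- \<beta>))"
    proof (rule set_integral_mono)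
      show "set_integrable lborel {1..W} (\<lambda>v. \<bar>(ell (h * v) - ell0 h) * v powr (- \<beta>)\<bar>)"
        using int by (rule set_integrable_abs)
      show "set_integrable lborel {1..W} (\<lambda>v. (e * ell h) * v powr (- \<beta>))"
        using pint by (intro set_integrable_mult_right)
      show "\<bar>(ell (h * v) - ell0 h) * v powr (- \<beta>)\<bar> \<le> (e * ell h) * v powr (- \<beta>)" if "v \<in> {1..W}" for v
        using pw[OF that] unfolding abs_mult by (intro mult_mono) auto
    qed
    also have "\<dots> = e * ell h * G" unfolding G_def by simp
    also have "\<dots> \<le> e * (2 * ell0 h) * (G + 1)"
      using e G l0 elim by (intro mult_mono) auto
    also have "\<dots> \<le> c * ell0 h"
    proof -
      have "0 \<le> ell0 h" using l0 elim by linarith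
      then have "(2 * e * (G + 1)) * ell0 h \<le> c * ell0 h" using e G c by (intro mult_right_mono) auto
      then show ?thesis by (simp add: mult_ac)
    qed
    finally have "h powr (1 - \<beta>) * \<bar>LBINT v:{1..W}. (ell (h * v) - ell0 h) * v powr (- \<beta>)\<bar> \<le> h powr (1 - \<beta>) * (c * ell0 h)"
      by (intro mult_left_mono) auto
    moreover have "ell0 h \<ge> 0" using l0 elim by linarith
    ultimately show ?case by (simp add: r_fun_def W_def[symmetric] abs_mult mult_ac)
  qed
qed

lemma tail_ratio_asymp_split:
  assumes y: "0 < y" "y \<le> 1"
  shows "((\<lambda>h. tail nu (h / y) / tail nu h /
    exp (- (h powr (1 - \<beta>) * ell0 h * g_fun \<beta> y) - r_fun \<beta> ell ell0 h y)) \<longlongrightarrow> 1) at_top"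
proof -
  have "((\<lambda>h. tail nu (h * inverse y) / tail nu h /
    exp (- (h powr (1 - \<beta>) * (LBINT v:{1..inverse y}. density h v)))) \<longlongrightarrow> 1) at_top"
    using y by (intro tail_ratio_asymp) (simp add: one_le_inverse)
  moreover have "\<forall>\<^sub>F h in at_top. tail nu (h * inverse y) / tail nu h /
    exp (- (h powr (1 - \<beta>) * (LBINT v:{1..inverse y}. density h v))) =
    tail nu (h / y) / tail nu h /
    exp (- (h powr (1 - \<beta>) * ell0 h * g_fun \<beta> y) - r_fun \<beta> ell ell0 h y)"
    using exponent_split[OF y, of ell0]
  proof eventually_elim
    case (elim h)
    show ?case unfolding elim by (simp add: divide_inverse)
  qed
  ultimately show ?thesis by (rule Lim_transform_eventually)
qed

text \<open>The g_beta and r_beta terms reassemble into the integral of an eventually nonnegative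
  function. In the proof of tail validity this bounds the exponential factor by 1.\<close>

lemma exponent_nonneg:
  assumes y: "0 < y" "y < 1"
  shows "\<forall>\<^sub>F h in at_top. h powr (1 - \<beta>) * ell0 h * g_fun \<beta> y + r_fun \<beta> ell ell0 h y \<ge> 0"
proof -
  have W: "1 < inverse y" using y by (simp add: one_less_inverse)
  obtain X where X: "\<And>h. h \<ge> X \<Longrightarrow> ell h > 0" using ell_pos by (auto simp: eventually_at_top_linorder)
  show ?thesis using exponent_split[OF y(1) less_imp_le[OF y(2)], of ell0] eventually_ge_at_top[of "max 0 X"]
  proof eventually_elim
    case (elim h)
    have "ell (h * v) \<ge> 0" if "v \<ge> 1" for v
    proof -
      have "h * 1 \<le> h * v" using that elim by (intro mult_left_mono) auto
      then show ?thesis using X[of "h * v"] elim by auto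
    qed
    then have "(LBINT v:{1..inverse y}. density h v) \<ge> 0"
      unfolding set_lebesgue_integral_def by (intro integral_nonneg_AE AE_I2) (auto simp: indicator_def)
    then have "h powr (1 - \<beta>) * (LBINT v:{1..inverse y}. density h v) \<ge> 0" by simp
    then show ?case using elim by simp
  qed
qed

text \<open>The powers of \<open>lam\<close> from numerator and denominator of the relative error combine to
  \<open>lam\<^sup>-\<^sup>1\<^sup>/\<^sup>2\<close> up to the constant coming from regular variation of \<open>lam\<close>.\<close>

lemma lam_powers:
  assumes y: "0 < y" "y \<le> 1" and e0: "ell0 \<sim>[at_top] ell"
  shows "((\<lambda>h. lam h powr ((n - 1) / 2) / lam (h / y) powr (n / 2) /
     (h powr (1 - \<beta>) * ell0 h) powr (- (1/2))) \<longlongrightarrow> y powr (n * (1 - \<beta>) / 2)) at_top"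
proof -
  have "((\<lambda>h. ell (inverse y * h) / ell h) \<longlongrightarrow> 1) at_top"
    using ell_slowly_varying y by (simp add: slowly_varying_def)
  then have "((\<lambda>h. (y powr (1 - \<beta>) / (ell (inverse y * h) / ell h)) powr (n / 2)
      * (ell0 h / ell h) powr (1 / 2)) \<longlongrightarrow> (y powr (1 - \<beta>) / 1) powr (n / 2) * 1 powr (1 / 2)) at_top"
    using y by (intro tendsto_intros ell0_ratio[OF e0]) auto
  moreover have "(y powr (1 - \<beta>) / 1) powr (n / 2) * 1 powr (1 / 2) = y powr (n * (1 - \<beta>) / 2)"
    by (simp add: powr_powr mult.commute)
  ultimately have lim: "((\<lambda>h. (y powr (1 - \<beta>) / (ell (inverse y * h) / ell h)) powr (n / 2)
      * (ell0 h / ell h) powr (1 / 2)) \<longlongrightarrow> y powr (n * (1 - \<beta>) / 2)) at_top"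
    by (simp only:)
  have "filterlim (\<lambda>h. inverse y * h) at_top at_top" using y by real_asymp
  then have "\<forall>\<^sub>F h in at_top. ell (inverse y * h) > 0"
    by (rule eventually_compose_filterlim[OF ell_pos])
  moreover have "\<forall>\<^sub>F h in at_top. ell0 h / ell h > 0" using ell0_ratio[OF e0] by (intro order_tendstoD) auto
  ultimately have ev: "\<forall>\<^sub>F h in at_top. (y powr (1 - \<beta>) / (ell (inverse y * h) / ell h)) powr (n / 2) * (ell0 h / ell h) powr (1 / 2) =
     lam h powr ((n - 1) / 2) / lam (h / y) powr (n / 2) / (h powr (1 - \<beta>) * ell0 h) powr (- (1/2))"
    using ell_pos eventually_gt_at_top[of 0]
  proof eventually_elim
    case (elim h)
    define p where "p = h powr (1 - \<beta>)"
    have pos: "p > 0" "ell h > 0" "ell0 h > 0" "ell (inverse y * h) > 0"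
      using elim by (auto simp: p_def zero_less_divide_iff)
    define l where "l = p * ell h"
    have l: "l > 0" using pos by (simp add: l_def)
    have l1: "lam h = l" by (simp add: lam_def p_def l_def)
    have hy: "(h / y) powr (1 - \<beta>) = p / y powr (1 - \<beta>)" using elim y by (simp add: p_def powr_divide)
    \<comment> \<open>Chosen so that lam (h / y) = lam h / q; q tends to y powr (1 - beta), the
      source of the limiting constant.\<close>
    define q where "q = y powr (1 - \<beta>) / (ell (inverse y * h) / ell h)"
    have q: "q > 0" using pos y by (simp add: q_def)
    have "lam (h / y) = (h / y) powr (1 - \<beta>) * ell (inverse y * h)"
      by (simp add: lam_def divide_inverse mult.commute)
    also have "\<dots> = l / q" unfolding hy q_def l_def using pos by simp
    finally have l2: "lam (h / y) = l / q" .
    have l3: "p * ell0 h = l * (ell0 h / ell h)" using pos by (simp add: l_def)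
    have z: "ell0 h / ell h > 0" using pos by simp
    have "l powr ((n - 1) / 2) / (l / q) powr (n / 2) / (l * (ell0 h / ell h)) powr (- (1/2)) =
       (l powr ((n - 1) / 2) / l powr (n / 2) * l powr (1 / 2)) * (q powr (n / 2) * (ell0 h / ell h) powr (1 / 2))"
    proof -
      have p1: "(l / q) powr (n / 2) = l powr (n / 2) / q powr (n / 2)"
        by (rule powr_divide)
      have p2: "(l * (ell0 h / ell h)) powr (- (1/2)) = 1 / (l powr (1 / 2) * (ell0 h / ell h) powr (1 / 2))"
        using l z by (subst powr_minus, subst powr_mult) (auto simp: inverse_eq_divide)
      show ?thesis unfolding p1 p2 by simp
    qed
    also have "l powr ((n - 1) / 2) / l powr (n / 2) * l powr (1 / 2) = l powr ((n - 1) / 2 - n / 2 + 1 / 2)"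
      by (simp only: powr_add powr_diff)
    also have "(n - 1) / 2 - n / 2 + 1 / 2 = 0" by (simp add: diff_divide_distrib)
    finally show ?case unfolding l1 l2 p_def[symmetric] l3 q_def[symmetric] using l by simp
  qed
  from lim ev show ?thesis by (rule Lim_transform_eventually)
qed

end

text \<open>The volume of the unit ball in dimension m times Gamma (m / 2 + 1) is pi powr (m / 2).
  The cap constant has this form with m = n - 1; the lens constant reaches it with m = n - 2 after
  Gamma (n / 2 + 1) = (n / 2) Gamma (n / 2). The quotient keeps one factor sqrt pi and the tangent
  T.\<close>

lemma unit_ball_vol_ratio:
  assumes n: "n \<ge> 2" and that: "k > 0" "T > 0"
  shows "(unit_ball_vol (real (n - 2)) / real n * (2 / (real n * T)) / k * Gamma (real n / 2 + 1)) /
     (unit_ball_vol (real (n - 1)) / real n / k * Gamma (real (n - 1) / 2 + 1)) = 1 / (sqrt pi * T)"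
proof -
  have r: "real (n - 1) = real n - 1" "real (n - 2) = real n - 2" "real n \<ge> 2" using n by auto
  have "real (n - 1) / 2 + 1 > 0" using r by linarith
  then have g: "Gamma (real n / 2) > 0" "Gamma (real (n - 1) / 2 + 1) > 0"
    using n by (auto intro!: Gamma_real_pos simp del: of_nat_diff)
  have a: "Gamma (real n / 2 + 1) = real n / 2 * Gamma (real n / 2)"
    using n by (intro Gamma_plus1) (auto dest: nonpos_Ints_nonpos)
  have b: "unit_ball_vol (real (n - 2)) * Gamma (real n / 2) = pi powr (real (n - 2) / 2)"
  proof -
    have "real (n - 2) / 2 + 1 = real n / 2" using r by linarith
    then have "unit_ball_vol (real (n - 2)) = pi powr (real (n - 2) / 2) / Gamma (real n / 2)"
      by (simp only: unit_ball_vol_def)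
    then show ?thesis using g by simp
  qed
  have "unit_ball_vol x * Gamma (x / 2 + 1) = pi powr (x / 2)" if "Gamma (x / 2 + 1) > 0" for x :: real
    using that by (simp add: unit_ball_vol_def)
  then have c: "unit_ball_vol (real (n - 1)) * Gamma (real (n - 1) / 2 + 1) = pi powr (real (n - 1) / 2)"
    using g(2) by blast
  have "real (n - 1) / 2 = real (n - 2) / 2 + 1 / 2" using r by linarith
  then have d: "pi powr (real (n - 1) / 2) = pi powr (real (n - 2) / 2) * sqrt pi"
    by (simp only: powr_add powr_half_sqrt[OF pi_ge_zero])
  have "unit_ball_vol (real (n - 2)) / real n * (2 / (real n * T)) / k * Gamma (real n / 2 + 1) =
    (unit_ball_vol (real (n - 2)) * Gamma (real n / 2)) / (real n * T * k)"
    unfolding a using n that by (simp add: field_simps)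
  also have "\<dots> = pi powr (real (n - 2) / 2) / (real n * T * k)" by (simp only: b)
  finally have num: "unit_ball_vol (real (n - 2)) / real n * (2 / (real n * T)) / k * Gamma (real n / 2 + 1) =
    pi powr (real (n - 2) / 2) / (real n * T * k)" .
  have "unit_ball_vol (real (n - 1)) / real n / k * Gamma (real (n - 1) / 2 + 1) =
    (unit_ball_vol (real (n - 1)) * Gamma (real (n - 1) / 2 + 1)) / (real n * k)" by simp
  also have "\<dots> = pi powr (real (n - 2) / 2) * sqrt pi / (real n * k)" by (simp only: c d)
  finally show ?thesis unfolding num using n that by (simp add: field_simps)
qed

section \<open>The relative error\<close>

context sphere_points
begin

text \<open>Here rho = -1, so distinct points are antipodal and no direction has positive inner
  product with two of them. Formally, each level c / sqrt x with c > 0 and x > 0 exceeds the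
  critical level 0.\<close>

lemma rel_error_eq_0:
  fixes \<xi> :: "'b \<Rightarrow> 'a"
  assumes "prob_space P" "spherically_contoured P \<xi>" and co: "co = 0" and c: "c > 0"
  shows "rel_error P \<xi> N u c = 0"
proof -
  have "bonferroni P \<xi> N u c - max_tail P \<xi> N u c =
      (\<integral>x. indicator {0<..} x * overlap N u (c / sqrt x) \<partial>distr P borel (\<lambda>\<omega>. (norm (\<xi> \<omega>))\<^sup>2))"
    using assms N by (intro spherically_contoured_bonferroni(2)) auto
  also have "\<dots> = (\<integral>x. 0 \<partial>distr P borel (\<lambda>\<omega>. (norm (\<xi> \<omega>))\<^sup>2))"
    using co c by (intro Bochner_Integration.integral_cong) (auto simp: indicator_def intro!: overlap_eq_0)
  finally show ?thesis by (simp add: rel_error_def)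
qed

text \<open>Numerator and denominator are normalised at different levels, (c / co)^2 and c^2. The
  quotient of the tails at these levels gives the exponential, and the quotient of the powers of lam
  gives the power -1/2 together with a power of co.\<close>

lemma rel_error_ratio_lim:
  fixes \<xi> :: "'b \<Rightarrow> 'a"
  assumes P: "prob_space P" and sc: "spherically_contoured P \<xi>" and dim: "DIM('a) \<ge> 2"
    and tail: "tail_class (distr P borel (\<lambda>\<omega>. (norm (\<xi> \<omega>))\<^sup>2)) \<beta> \<gamma> ell"
    and e0: "ell0 \<sim>[at_top] ell" and co: "co > 0"
  shows "((\<lambda>c. rel_error P \<xi> N u c /
      ((c powr (2 * (1 - \<beta>)) * ell0 (c\<^sup>2)) powr (- (1/2)) *
       exp (- (c powr (2 * (1 - \<beta>)) * ell0 (c\<^sup>2) * g_fun \<beta> (co\<^sup>2)) - r_fun \<beta> ell ell0 (c\<^sup>2) (co\<^sup>2)))) \<longlongrightarrow>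
    real (num_closest N u) / real N * (co powr (real (DIM('a)) * (1 - \<beta>)) / (2 * sqrt pi * (si / co)))) at_top"
proof -
  define \<nu> where "\<nu> = distr P borel (\<lambda>\<omega>. (norm (\<xi> \<omega>))\<^sup>2)"
  define n where "n = DIM('a)"
  interpret tail_class \<nu> \<beta> \<gamma> ell using tail by (simp add: \<nu>_def)
  obtain c0 where "laplace_tail \<nu> lam 2 c0" using laplace_tail_lam by blast
  then interpret laplace_tail \<nu> lam 2 c0 .
  define y where "y = co\<^sup>2"
  have y: "0 < y" "y < 1" using co co_less_1 by (auto simp: y_def power_less_one_iff)
  define Fb where "Fb x = tail \<nu> x" for x
  define num where "num c = bonferroni P \<xi> N u c - max_tail P \<xi> N u c" for c
  define den where "den c = bonferroni P \<xi> N u c" for c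
  define k where "k = unit_ball_vol (real n)"
  have k: "k > 0" by (simp add: k_def)
  \<comment> \<open>The limits of the normalised denominator and numerator: a constant from the
    sphere times the exponential moment of order (n - 1) / 2 for caps and n / 2 for lenses.\<close>
  define a1 where "a1 = real N * (unit_ball_vol (real (n - 1)) / real n / k) * Gamma (real (n - 1) / 2 + 1)"
  define a2 where "a2 = real (card closest) / 2 * (unit_ball_vol (real (n - 2)) / real n * (2 / (real n * (si / co))) / k) * Gamma (real n / 2 + 1)"
  have N0: "N \<ge> 1" using N by simp
  have n2: "n \<ge> 2" using dim by (simp add: n_def)
  have num_lim: "((\<lambda>c. lam ((c / co)\<^sup>2) powr (real n / 2) / Fb ((c / co)\<^sup>2) * num c) \<longlongrightarrow> a2) at_top"
    unfolding num_def spherically_contoured_bonferroni(2)[OF P sc N0] Fb_def \<nu>_def[symmetric] a2_def k_def n_def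
    using dim co
    by (intro antimono_average_lim[where B = "real N"] overlap_antimono overlap_nonneg overlap_le overlap_eq_0 overlap_asymp) auto
  interpret S: prob_space "sphere_uniform :: 'a measure" by (rule prob_space_sphere_uniform)
  have hs: "{x. u i \<bullet> x \<ge> t} \<in> sets borel" for i t by measurable
  have den_lim: "((\<lambda>c. lam ((c / 1)\<^sup>2) powr (real (n - 1) / 2) / Fb ((c / 1)\<^sup>2) * den c) \<longlongrightarrow> a1) at_top"
    unfolding den_def spherically_contoured_bonferroni(1)[OF P sc N0] Fb_def \<nu>_def[symmetric] a1_def k_def n_def
  proof (rule antimono_average_lim[where B = "real N"])
    show "(\<Sum>i=1..N. measure sphere_uniform {x. u i \<bullet> x \<ge> t'}) \<le> (\<Sum>i=1..N. measure sphere_uniform {x. u i \<bullet> x \<ge> t})"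
      if "t \<le> t'" for t t'
      using that hs by (intro sum_mono S.finite_measure_mono) auto
    show "0 \<le> (\<Sum>i=1..N. measure sphere_uniform {x. u i \<bullet> x \<ge> t})" for t by (intro sum_nonneg) auto
    show "(\<Sum>i=1..N. measure sphere_uniform {x. u i \<bullet> x \<ge> t}) \<le> real N" for t
    proof -
      have "(\<Sum>i=1..N. measure sphere_uniform {x. u i \<bullet> x \<ge> t}) \<le> (\<Sum>i=1..N. 1)" by (intro sum_mono) auto
      then show ?thesis by simp
    qed
    show "(\<Sum>i=1..N. measure sphere_uniform {x. u i \<bullet> x \<ge> t}) = 0" if "t > 1" for t
    proof (intro sum.neutral ballI)
      fix i assume i: "i \<in> {1..N}"
      have "measure sphere_uniform {x. u i \<bullet> x \<ge> t} = measure sphere_uniform ({} :: 'a set)"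
      proof (rule measure_eq_AE)
        show "AE x in sphere_uniform. x \<in> {x. u i \<bullet> x \<ge> t} \<longleftrightarrow> x \<in> {}"
          using AE_sphere_uniform
        proof eventually_elim
          case (elim x)
          then show ?case using norm_cauchy_schwarz[of "u i" x] unit[OF i] that by auto
        qed
      qed (use hs in auto)
      then show "measure sphere_uniform {x. u i \<bullet> x \<ge> t} = 0" by simp
    qed
    show "((\<lambda>s. (\<Sum>i=1..N. measure sphere_uniform {x. u i \<bullet> x \<ge> 1 * sqrt (1 - s)}) / s powr (real (DIM('a) - 1) / 2)) \<longlongrightarrow>
      real N * (unit_ball_vol (real (DIM('a) - 1)) / real (DIM('a)) / unit_ball_vol (real (DIM('a))))) (at_right 0)"
      by (rule single_asymp) (rule unit)
  qed (use dim in auto)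
  have "real (n - 1) / 2 + 1 > 0" using of_nat_0_le_iff[of "n - 1", where 'a = real] by linarith
  then have "Gamma (real (n - 1) / 2 + 1) > 0" by (rule Gamma_real_pos)
  then have a1: "a1 > 0"
    unfolding a1_def using N n2 k by (intro mult_pos_pos divide_pos_pos) auto
  have sq: "filterlim (\<lambda>c::real. c\<^sup>2) at_top at_top" by real_asymp
  let ?E = "\<lambda>c. exp (- ((c\<^sup>2) powr (1 - \<beta>) * ell0 (c\<^sup>2) * g_fun \<beta> y) - r_fun \<beta> ell ell0 (c\<^sup>2) y)"
  let ?L = "\<lambda>c. ((c\<^sup>2) powr (1 - \<beta>) * ell0 (c\<^sup>2)) powr (- (1/2))"
  let ?N = "\<lambda>c. lam ((c / co)\<^sup>2) powr (real n / 2) / Fb ((c / co)\<^sup>2) * num c"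
  let ?D = "\<lambda>c. lam ((c / 1)\<^sup>2) powr (real (n - 1) / 2) / Fb ((c / 1)\<^sup>2) * den c"
  have r1: "((\<lambda>c. Fb (c\<^sup>2 / y) / Fb (c\<^sup>2) / ?E c) \<longlongrightarrow> 1) at_top"
    using filterlim_compose[OF tail_ratio_asymp_split[of y ell0] sq] y by (simp add: Fb_def)
  have r2: "((\<lambda>c. lam (c\<^sup>2) powr ((real n - 1) / 2) / lam (c\<^sup>2 / y) powr (real n / 2) /
     ?L c) \<longlongrightarrow> y powr (real n * (1 - \<beta>) / 2)) at_top"
    using filterlim_compose[OF lam_powers[OF y(1) less_imp_le[OF y(2)] e0] sq] .
  \<comment> \<open>In this product all tails and all powers of lam cancel, leaving the relative
    error divided by the claimed rate.\<close>
  have "((\<lambda>c. ?N c /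
        ?D c *
      (Fb (c\<^sup>2 / y) / Fb (c\<^sup>2) / ?E c) *
      (lam (c\<^sup>2) powr ((real n - 1) / 2) / lam (c\<^sup>2 / y) powr (real n / 2) /
     ?L c)) \<longlongrightarrow> a2 / a1 * 1 * y powr (real n * (1 - \<beta>) / 2)) at_top"
    using a1 by (intro tendsto_mult tendsto_divide num_lim den_lim r1 r2) auto
  moreover have "a2 / a1 * 1 * y powr (real n * (1 - \<beta>) / 2) =
      real (num_closest N u) / real N * (co powr (real (DIM('a)) * (1 - \<beta>)) / (2 * sqrt pi * (si / co)))"
  proof -
    have "a2 / a1 = real (card closest) / (2 * real N) *
        ((unit_ball_vol (real (n - 2)) / real n * (2 / (real n * (si / co))) / k * Gamma (real n / 2 + 1)) /
        (unit_ball_vol (real (n - 1)) / real n / k * Gamma (real (n - 1) / 2 + 1)))"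
      by (simp add: a1_def a2_def)
    also have "\<dots> = real (card closest) / (2 * real N) * (1 / (sqrt pi * (si / co)))"
      using unit_ball_vol_ratio[OF n2 k, of "si / co"] si_pos co by simp
    finally have "a2 / a1 = real (card closest) / (2 * real N) * (1 / (sqrt pi * (si / co)))" .
    moreover have "y powr (real n * (1 - \<beta>) / 2) = co powr (real n * (1 - \<beta>))"
    proof -
      have "y = co powr 2" using co by (simp add: y_def powr_numeral)
      then show ?thesis by (simp add: powr_powr)
    qed
    ultimately show ?thesis by (simp add: card_closest n_def mult_ac)
  qed
  moreover have "\<forall>\<^sub>F c in at_top. ?N c /
        ?D c *
      (Fb (c\<^sup>2 / y) / Fb (c\<^sup>2) / ?E c) *
      (lam (c\<^sup>2) powr ((real n - 1) / 2) / lam (c\<^sup>2 / y) powr (real n / 2) /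
     ?L c) =
    rel_error P \<xi> N u c /
      ((c powr (2 * (1 - \<beta>)) * ell0 (c\<^sup>2)) powr (- (1/2)) *
       exp (- (c powr (2 * (1 - \<beta>)) * ell0 (c\<^sup>2) * g_fun \<beta> (co\<^sup>2)) - r_fun \<beta> ell ell0 (c\<^sup>2) (co\<^sup>2)))"
  proof -
    have lp: "\<forall>\<^sub>F h in at_top. lam h > 0" using lam_tendsto by (simp add: filterlim_at_top_dense)
    have "filterlim (\<lambda>c::real. c\<^sup>2 / y) at_top at_top" using y by real_asymp
    then have "\<forall>\<^sub>F c in at_top. lam (c\<^sup>2 / y) > 0" by (rule eventually_compose_filterlim[OF lp])
    moreover have "\<forall>\<^sub>F c in at_top. lam (c\<^sup>2) > 0" by (rule eventually_compose_filterlim[OF lp sq])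
    ultimately show ?thesis using eventually_gt_at_top[of 0]
    proof eventually_elim
      case (elim c)
      have 1: "(c / co)\<^sup>2 = c\<^sup>2 / y" by (simp add: y_def power_divide)
      have 2: "(c\<^sup>2) powr (1 - \<beta>) = c powr (2 * (1 - \<beta>))"
      proof -
        have "c\<^sup>2 = c powr 2" using elim by (simp add: powr_numeral)
        then show ?thesis by (simp add: powr_powr)
      qed
      have 3: "real (n - 1) = real n - 1" using n2 by simp
      have F: "Fb (c\<^sup>2) > 0" "Fb (c\<^sup>2 / y) > 0" unfolding Fb_def using elim y by (auto intro!: tail_positive)
      define p q where "p = lam (c\<^sup>2 / y) powr (real n / 2)" and "q = lam (c\<^sup>2) powr ((real n - 1) / 2)"
      have pq: "p > 0" "q > 0" using elim by (auto simp: p_def q_def)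
      have cancel: "(p / F1 * b) / (q / F2 * d) * (F1 / F2 / e) * (q / p / l) = b / d / (l * e)"
        if "F1 > 0" "F2 > 0" for F1 F2 b d e l :: real
        using pq that by (simp add: field_simps)
      have "rel_error P \<xi> N u c = num c / den c" by (simp add: rel_error_def num_def den_def)
      then show ?case
        unfolding 1 div_by_1 3 p_def[symmetric] q_def[symmetric] cancel[OF F(2,1)] 2 y_def[symmetric] by simp
    qed
  qed
  ultimately show ?thesis by (simp only: Lim_transform_eventually)
qed

end

theorem theorem4:
  fixes P :: "'b measure" and \<xi> :: "'b \<Rightarrow> real ^ 'n"
    and N :: nat and u :: "nat \<Rightarrow> real ^ 'n"
    and \<beta> :: real and \<gamma> :: ereal and ell ell0 :: "real \<Rightarrow> real"
  defines "\<theta> \<equiv> theta_star N u"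
    and "D \<equiv> real (num_closest N u)"
    and "\<Delta> \<equiv> rel_error P \<xi> N u"
  assumes "CARD('n) \<ge> 2"
    and "N \<ge> 2"
    and "\<And>i. i \<in> {1..N} \<Longrightarrow> norm (u i) = 1"
    and "inj_on u {1..N}"
    and "prob_space P"
    and "spherically_contoured P \<xi>"
    and "in_class_with \<beta> \<gamma> ell (cdf (distr P borel (\<lambda>\<omega>. (norm (\<xi> \<omega>))\<^sup>2)))"
    and "\<beta> < 1 \<or> (\<beta> = 1 \<and> \<gamma> = \<infinity>)"
    and "ell0 \<sim>[at_top] ell"
  shows
    "(cos \<theta> > 0 \<longrightarrow>
        \<Delta> \<sim>[at_top]
          (\<lambda>c. D / real N
             * (cos \<theta> powr (real CARD('n) * (1 - \<beta>)) / (2 * sqrt pi * tan \<theta>))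
             * (c powr (2 * (1 - \<beta>)) * ell0 (c\<^sup>2)) powr (- (1/2))
             * exp (- (c powr (2 * (1 - \<beta>)) * ell0 (c\<^sup>2) * g_fun \<beta> ((cos \<theta>)\<^sup>2))
                    - r_fun \<beta> ell ell0 (c\<^sup>2) ((cos \<theta>)\<^sup>2)))
        \<and> (\<lambda>c. ln (\<Delta> c)
              - (- (c powr (2 * (1 - \<beta>)) * ell0 (c\<^sup>2) * g_fun \<beta> ((cos \<theta>)\<^sup>2))
                 - 1/2 * ln (c powr (2 * (1 - \<beta>)) * ell0 (c\<^sup>2))
                 - r_fun \<beta> ell ell0 (c\<^sup>2) ((cos \<theta>)\<^sup>2)
                 + ln (cos \<theta> powr (real CARD('n) * (1 - \<beta>)) / (2 * sqrt pi * tan \<theta>))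
                 + ln (D / real N)))
            \<in> o[at_top](\<lambda>_. 1)
        \<and> (\<lambda>c. r_fun \<beta> ell ell0 (c\<^sup>2) ((cos \<theta>)\<^sup>2))
            \<in> o[at_top](\<lambda>c. c powr (2 * (1 - \<beta>)) * ell0 (c\<^sup>2)))
     \<and> (cos \<theta> = 0 \<longrightarrow> eventually (\<lambda>c. \<Delta> c = 0) at_top)
     \<and> bonferroni_tail_valid P \<xi> N u"
proof -
  interpret prob_space P by fact
  interpret sp: sphere_points N u by unfold_locales (use assms in auto)
  have xim [measurable]: "\<xi> \<in> borel_measurable P"
    by (rule spherically_contoured_measure(2)[OF \<open>prob_space P\<close> \<open>spherically_contoured P \<xi>\<close>, where G = "\<lambda>t. {}"]) auto
  define \<nu> where "\<nu> = distr P borel (\<lambda>\<omega>. (norm (\<xi> \<omega>))\<^sup>2)"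
  interpret rd: real_distribution \<nu> unfolding \<nu>_def by (rule real_distribution_distr) measurable
  interpret tail: tail_class \<nu> \<beta> \<gamma> ell
    by unfold_locales (use assms in \<open>auto simp: \<nu>_def\<close>)
  have cos: "cos \<theta> = sp.co"
    unfolding \<theta>_def theta_star_def sp.co_def[symmetric]
    using sp.co_nonneg sp.co_less_1 by (intro cos_arccos) auto
  have tan: "tan \<theta> = sp.si / sp.co"
  proof -
    have "sin \<theta> = sqrt (1 - sp.co\<^sup>2)"
      unfolding \<theta>_def theta_star_def sp.co_def[symmetric]
      using sp.co_nonneg sp.co_less_1 by (intro sin_arccos) auto
    also have "1 - sp.co\<^sup>2 = (1 - sp.rho) / 2" by (simp add: sp.co_sq field_simps)
    finally show ?thesis by (simp add: tan_def cos sp.si_def)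
  qed
  define lam0 where "lam0 c = c powr (2 * (1 - \<beta>)) * ell0 (c\<^sup>2)" for c
  define E where "E c = - (lam0 c * g_fun \<beta> (sp.co\<^sup>2)) - r_fun \<beta> ell ell0 (c\<^sup>2) (sp.co\<^sup>2)" for c
  define B where "B = sp.co powr (real CARD('n) * (1 - \<beta>)) / (2 * sqrt pi * (sp.si / sp.co))"
  have D: "D > 0" using sp.card_closest_pos by (simp add: D_def sp.card_closest)
  have sq: "filterlim (\<lambda>c::real. c\<^sup>2) at_top at_top" by real_asymp
  have sqp: "(c\<^sup>2) powr (1 - \<beta>) = c powr (2 * (1 - \<beta>))" if "c > 0" for c :: real
  proof -
    have "c\<^sup>2 = c powr 2" using that by (simp add: powr_numeral)
    then show ?thesis by (simp add: powr_powr)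
  qed
  let ?ln = "\<lambda>c. ln (\<Delta> c) - (- (lam0 c * g_fun \<beta> (sp.co\<^sup>2)) - 1/2 * ln (lam0 c)
                 - r_fun \<beta> ell ell0 (c\<^sup>2) (sp.co\<^sup>2) + ln B + ln (D / real N))"
  \<comment> \<open>For co > 0 the number y = co^2 lies strictly between 0 and 1, so the two tails
    are compared at levels with a finite ratio 1 / y > 1, and the tangent is finite.\<close>
  have pos: "\<Delta> \<sim>[at_top] (\<lambda>c. D / real N * B * lam0 c powr (- (1/2)) * exp (E c))
        \<and> (\<lambda>c. ?ln c) \<in> o[at_top](\<lambda>_. 1)
        \<and> (\<lambda>c. r_fun \<beta> ell ell0 (c\<^sup>2) (sp.co\<^sup>2)) \<in> o[at_top](lam0)
        \<and> (\<Delta> \<longlongrightarrow> 0) at_top"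
    if co: "sp.co > 0"
  proof -
    have y: "0 < sp.co\<^sup>2" "sp.co\<^sup>2 < 1" using co sp.co_less_1 by (auto simp: power_less_one_iff)
    have B: "B > 0" using co sp.si_pos by (simp add: B_def)
    define A where "A = D / real N * B"
    let ?T = "\<lambda>c. A * lam0 c powr (- (1/2)) * exp (E c)"
    have A: "A > 0" using D B sp.N by (simp add: A_def)
    have lim: "((\<lambda>c. \<Delta> c / (lam0 c powr (- (1/2)) * exp (E c))) \<longlongrightarrow> A) at_top"
      using sp.rel_error_ratio_lim[OF \<open>prob_space P\<close> \<open>spherically_contoured P \<xi>\<close> _ _ \<open>ell0 \<sim>[at_top] ell\<close> co, of \<beta> \<gamma>]
        tail.tail_class_axioms \<open>CARD('n) \<ge> 2\<close>
      unfolding A_def B_def D_def \<Delta>_def lam0_def E_def \<nu>_def by simp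
    from tendsto_divide[OF this tendsto_const[of A]] A
    have lim1: "((\<lambda>c. \<Delta> c / ?T c) \<longlongrightarrow> 1) at_top"
      by (simp add: mult_ac)
    then have 1: "\<Delta> \<sim>[at_top] ?T" by (rule asymp_equivI')
    have small: "(\<lambda>c. r_fun \<beta> ell ell0 (c\<^sup>2) (sp.co\<^sup>2)) \<in> o[at_top](\<lambda>c. (c\<^sup>2) powr (1 - \<beta>) * ell0 (c\<^sup>2))"
      by (rule landau_o.small.compose[OF tail.r_fun_small[OF y \<open>ell0 \<sim>[at_top] ell\<close>] sq])
    have "\<forall>\<^sub>F c in at_top. (c\<^sup>2) powr (1 - \<beta>) * ell0 (c\<^sup>2) = lam0 c"
      using eventually_gt_at_top[of 0] by eventually_elim (simp add: sqp lam0_def)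
    from landau_o.small.cong[OF this] small
    have 3: "(\<lambda>c. r_fun \<beta> ell ell0 (c\<^sup>2) (sp.co\<^sup>2)) \<in> o[at_top](lam0)" by simp
    \<comment> \<open>Up to a factor tending to 1, lam0 c is lam at c^2, whose divergence is
      known.\<close>
    have lam0_top: "filterlim lam0 at_top at_top"
    proof -
      have "filterlim (\<lambda>h. ell0 h / ell h * tail.lam h) at_top at_top"
        by (rule filterlim_tendsto_pos_mult_at_top[OF tail.ell0_ratio[OF \<open>ell0 \<sim>[at_top] ell\<close>] _ tail.lam_tendsto]) simp
      from filterlim_compose[OF this sq]
      have "filterlim (\<lambda>c. ell0 (c\<^sup>2) / ell (c\<^sup>2) * tail.lam (c\<^sup>2)) at_top at_top" .
      moreover have "\<forall>\<^sub>F c in at_top. ell0 (c\<^sup>2) / ell (c\<^sup>2) * tail.lam (c\<^sup>2) = lam0 c"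
        using eventually_compose_filterlim[OF tail.ell_pos sq] eventually_gt_at_top[of 0]
        by eventually_elim (simp add: tail.lam_def lam0_def sqp)
      ultimately show ?thesis by (rule filterlim_cong[OF refl refl, THEN iffD1, rotated])
    qed
    then have lam0_pos: "\<forall>\<^sub>F c in at_top. lam0 c > 0" by (simp add: filterlim_at_top_dense)
    have "((\<lambda>c. ln (\<Delta> c / ?T c)) \<longlongrightarrow> ln 1) at_top"
      using lim1 by (rule tendsto_ln) simp
    \<comment> \<open>A quotient with limit 1 is eventually positive, and so is the claimed rate;
      hence Delta c is positive and its logarithm splits into the logarithms of the factors.\<close>
    moreover have "\<forall>\<^sub>F c in at_top. \<Delta> c / ?T c > 0"
      using lim1 by (rule order_tendstoD) simp
    then have "\<forall>\<^sub>F c in at_top. ln (\<Delta> c / ?T c) =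
        ?ln c"
      using lam0_pos
    proof eventually_elim
      case (elim c)
      define p where "p = lam0 c powr (- (1/2))"
      have p: "p > 0" "ln p = - 1/2 * ln (lam0 c)" using elim by (auto simp: p_def ln_powr)
      have pe: "A * p * exp (E c) > 0" using A p by simp
      have "\<Delta> c > 0" using elim(1) pe unfolding p_def[symmetric] by (simp add: zero_less_divide_iff)
      then have "ln (\<Delta> c / (A * p * exp (E c))) = ln (\<Delta> c) - ln (A * p * exp (E c))"
        using pe by (rule ln_divide_pos)
      also have "ln (A * p * exp (E c)) = ln A + ln p + E c"
        using A p by (simp add: ln_mult)
      also have "ln A = ln (D / real N) + ln B"
        unfolding A_def using D B sp.N by (intro ln_mult_pos) auto
      finally show ?case unfolding p_def[symmetric] p(2) by (simp add: E_def)
    qed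
    ultimately have "((\<lambda>c. ?ln c) \<longlongrightarrow> ln 1) at_top"
      by (rule Lim_transform_eventually)
    then have 2: "(\<lambda>c. ?ln c) \<in> o[at_top](\<lambda>_. 1)"
      by (intro smalloI_tendsto) auto
    have pz: "((\<lambda>x::real. x powr (- (1/2))) \<longlongrightarrow> 0) at_top" by real_asymp
    \<comment> \<open>The exponential is eventually at most 1 and the power of lam0 already tends to
      0. Multiplying by the convergent quotient in \<open>lim\<close> then shows that Delta tends to
      0.\<close>
    have "((\<lambda>c. lam0 c powr (- (1/2)) * exp (E c)) \<longlongrightarrow> 0) at_top"
    proof (rule tendsto_sandwich[OF _ _ tendsto_const])
      show "((\<lambda>c. lam0 c powr (- (1/2))) \<longlongrightarrow> 0) at_top"
        by (rule filterlim_compose[OF pz lam0_top])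
      show "\<forall>\<^sub>F c in at_top. lam0 c powr (- (1/2)) * exp (E c) \<le> lam0 c powr (- (1/2))"
        using eventually_compose_filterlim[OF tail.exponent_nonneg[OF y, of ell0] sq] eventually_gt_at_top[of 0]
        by eventually_elim (auto simp: E_def lam0_def sqp intro!: mult_left_le)
    qed auto
    from tendsto_mult[OF lim this]
    have "((\<lambda>c. \<Delta> c / (lam0 c powr (- (1/2)) * exp (E c)) * (lam0 c powr (- (1/2)) * exp (E c))) \<longlongrightarrow> 0) at_top" by simp
    moreover have "\<forall>\<^sub>F c in at_top. \<Delta> c / (lam0 c powr (- (1/2)) * exp (E c)) * (lam0 c powr (- (1/2)) * exp (E c)) = \<Delta> c"
      using lam0_pos by eventually_elim simp
    ultimately have 4: "(\<Delta> \<longlongrightarrow> 0) at_top" by (rule Lim_transform_eventually)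
    show ?thesis using 1 2 3 4 unfolding A_def by blast
  qed
  have zero: "\<forall>\<^sub>F c in at_top. \<Delta> c = 0" if "sp.co = 0"
    unfolding \<Delta>_def using eventually_gt_at_top[of 0]
    by eventually_elim (use that assms in \<open>auto intro!: sp.rel_error_eq_0\<close>)
  have "(\<Delta> \<longlongrightarrow> 0) at_top"
  proof (cases "sp.co = 0")
    case True
    then show ?thesis using zero by (intro tendsto_eventually) auto
  next
    case False
    then show ?thesis using pos sp.co_nonneg by auto
  qed
  then have valid: "bonferroni_tail_valid P \<xi> N u" by (simp add: bonferroni_tail_valid_def \<Delta>_def)
  show ?thesis
    unfolding cos tan lam0_def[symmetric] B_def[symmetric] E_def[symmetric]
    using pos zero valid by blast
qed

end
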